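(* Let $\alpha,\beta>-1$ and let $j\ge0$ be an integer. (1) There is a constant $C=C(\alpha,\beta,j)>0$ such that $$|\partial_\theta^jH_t^{\alpha,\beta}(\theta,\varphi)|\le C\,\big(t^2+\theta^2+\varphi^2\big)^{-\alpha-1/2}\big(t^2+(\pi-\theta)^2+(\pi-\varphi)^2\big)^{-\beta-1/2}\frac{t}{[t^2+(\theta-\varphi)^2]^{1+j/2}}$$ for all $0<t\le1$ and $\theta,\varphi\in(0,\pi)$. (2) Excluding the case when $j=\tau_{\alpha,\beta}=0$, there exist a constant $c=c_{\alpha,\beta}>0$ and a constant $C=C(\alpha,\beta,j)>0$ such that $$|\partial_\theta^jH_t^{\alpha,\beta}(\theta,\varphi)|\le C\,e^{-ct},\qquad t\ge1,\ \theta,\varphi\in(0,\pi).$$ (3) The estimate in (2) holds with no restriction on $\alpha,\beta>-1$ and $j\ge0$ if $H_t^{\alpha,\beta}(\theta,\varphi)$ is replaced by $\widetilde H_t^{\alpha,\beta}(\theta,\varphi)$.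
   Context: For $\alpha,\beta>-1$ let $d\mu_{\alpha,\beta}(\theta)=(\sin\frac\theta2)^{2\alpha+1}(\cos\frac\theta2)^{2\beta+1}d\theta$ on $(0,\pi)$ and $\tau_{\alpha,\beta}=\frac{\alpha+\beta+1}{2}$. Let $\mathcal P_n^{\alpha,\beta}(\theta)=c_n^{\alpha,\beta}P_n^{\alpha,\beta}(\cos\theta)$, $n\ge0$, where $P_n^{\alpha,\beta}$ are the classical Jacobi polynomials (Szegő's convention) and $c_n^{\alpha,\beta}>0$ are such that $\{\mathcal P_n^{\alpha,\beta}:n\ge0\}$ is an orthonormal basis of $L^2(d\mu_{\alpha,\beta})$. The Jacobi-Poisson kernel is $$H_t^{\alpha,\beta}(\theta,\varphi)=\sum_{n=0}^\infty e^{-t|n+\tau_{\alpha,\beta}|}\mathcal P_n^{\alpha,\beta}(\theta)\mathcal P_n^{\alpha,\beta}(\varphi),\qquad t>0,\ \theta,\varphi\in(0,\pi),$$ a smooth function of $(t,\theta,\varphi)$ (the series may be differentiated term by term), and the compensated Jacobi-Poisson kernel is $$\widetilde H_t^{\alpha,\beta}(\theta,\varphi)=H_t^{\alpha,\beta}(\theta,\varphi)-e^{-t|\tau_{\alpha,\beta}|}\mathcal P_0^{\alpha,\beta}(\theta)\mathcal P_0^{\alpha,\beta}(\varphi).$$ *)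

theory Defs
  imports "HOL-Analysis.Analysis"
begin

definition jacobi_measure :: "real \<Rightarrow> real \<Rightarrow> real measure" where
  "jacobi_measure \<alpha> \<beta> =
     density (restrict_space lborel {0<..<pi})
       (\<lambda>\<theta>. ennreal (sin (\<theta> / 2) powr (2 * \<alpha> + 1) * cos (\<theta> / 2) powr (2 * \<beta> + 1)))"

definition jacobi_tau :: "real \<Rightarrow> real \<Rightarrow> real" where
  "jacobi_tau \<alpha> \<beta> = (\<alpha> + \<beta> + 1) / 2"

(* Formula (4.3.2) of Szego's "Orthogonal Polynomials". *)
definition jacobi_P :: "real \<Rightarrow> real \<Rightarrow> nat \<Rightarrow> real \<Rightarrow> real" where
  "jacobi_P \<alpha> \<beta> n x =
     (\<Sum>k\<le>n. ((real n + \<alpha>) gchoose (n - k)) * ((real n + \<beta>) gchoose k) *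
        ((x - 1) / 2) ^ k * ((x + 1) / 2) ^ (n - k))"

lemma jacobi_P_at_1: "jacobi_P \<alpha> \<beta> n 1 = (real n + \<alpha>) gchoose n"
proof -
  have "jacobi_P \<alpha> \<beta> n 1 = (\<Sum>k\<le>n. if k = 0 then (real n + \<alpha>) gchoose n else 0)"
    unfolding jacobi_P_def by (intro sum.cong) auto
  then show ?thesis
    by simp
qed

(* Since the polynomials are mutually orthogonal in L^2 of the measure, the positive constants
   making the system orthonormal are the reciprocals of the L^2 norms. *)
definition jacobi_c :: "real \<Rightarrow> real \<Rightarrow> nat \<Rightarrow> real" where
  "jacobi_c \<alpha> \<beta> n =
     1 / sqrt (LINT \<theta>|jacobi_measure \<alpha> \<beta>. (jacobi_P \<alpha> \<beta> n (cos \<theta>))\<^sup>2)"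

definition jacobi_fun :: "real \<Rightarrow> real \<Rightarrow> nat \<Rightarrow> real \<Rightarrow> real" where
  "jacobi_fun \<alpha> \<beta> n \<theta> = jacobi_c \<alpha> \<beta> n * jacobi_P \<alpha> \<beta> n (cos \<theta>)"

definition jacobi_poisson :: "real \<Rightarrow> real \<Rightarrow> real \<Rightarrow> real \<Rightarrow> real \<Rightarrow> real" where
  "jacobi_poisson \<alpha> \<beta> t \<theta> \<phi> =
     (\<Sum>n. exp (- t * \<bar>real n + jacobi_tau \<alpha> \<beta>\<bar>) * jacobi_fun \<alpha> \<beta> n \<theta> * jacobi_fun \<alpha> \<beta> n \<phi>)"

definition compensated_jacobi_poisson :: "real \<Rightarrow> real \<Rightarrow> real \<Rightarrow> real \<Rightarrow> real \<Rightarrow> real" where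
  "compensated_jacobi_poisson \<alpha> \<beta> t \<theta> \<phi> =
     jacobi_poisson \<alpha> \<beta> t \<theta> \<phi> -
       exp (- t * \<bar>jacobi_tau \<alpha> \<beta>\<bar>) * jacobi_fun \<alpha> \<beta> 0 \<theta> * jacobi_fun \<alpha> \<beta> 0 \<phi>"

end

theory Submission
  imports Defs "HOL-Complex_Analysis.Complex_Analysis" "HOL-Real_Asymp.Real_Asymp"
begin

text \<open>
  Write \<open>u = sin (\<theta>/2) sin (\<phi>/2)\<close>, \<open>v = cos (\<theta>/2) cos (\<phi>/2)\<close>, \<open>K = cosh (t/2)\<close> and \<open>s = \<alpha> + \<beta> + 2\<close>. Up to the
  term \<open>n = 0\<close>, where \<open>\<bar>n + \<tau>\<bar>\<close> may differ from \<open>n + \<tau>\<close>, the kernel has Bailey's closed form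
  \<open>2 sinh (t/2) (2K)\<^sup>-\<^sup>s \<Sum>\<^sub>k\<^sub>l A\<^sub>k\<^sub>l (u/K)\<^sup>2\<^sup>k (v/K)\<^sup>2\<^sup>l\<close> with positive coefficients for all \<open>\<alpha>, \<beta> > -1\<close>. It is obtained
  by expanding \<open>\<Sum>\<^sub>k\<^sub>+\<^sub>l\<^sub>=\<^sub>N A\<^sub>k\<^sub>l u\<^sup>2\<^sup>k v\<^sup>2\<^sup>l\<close> in products of Jacobi polynomials and summing over \<open>N\<close>;
  absolute convergence off the diagonal follows from positivity on the diagonal. Writing the Gamma
  factor of \<open>A\<^sub>k\<^sub>l\<close> as an Euler integral turns the double series into
  a Laplace integral of two modified Bessel functions, which gives a bound of the required shape. Since
  all coefficients are positive, the same bound holds for complex \<open>\<theta>\<close> in a disc of radius comparable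
  to \<open>(t\<^sup>2 + (\<theta> - \<phi>)\<^sup>2)\<^sup>1\<^sup>/\<^sup>2\<close>, and Cauchy's estimates on that disc control all \<open>\<theta>\<close>-derivatives. For \<open>t \<ge> 1\<close>
  the term \<open>k = l = 0\<close> does not depend on \<open>\<theta>\<close> and the remaining ones gain a factor \<open>K\<^sup>-\<^sup>2\<close>.
\<close>

section \<open>The Bessel series\<close>

text \<open>The shape of the bound comes from one rescaling. With \<open>x = u/K\<close>,
  \<open>y = v/K\<close> and \<open>\<delta> = 1 - x - y\<close>, the Laplace integral lives at the
  scale \<open>\<rho> ~ 1/\<delta>\<close>. There the Bessel factors, which behave like
  \<open>e^(\<rho> x) (1 + \<rho> x)^(-\<alpha>-1/2)\<close> and
  \<open>e^(\<rho> y) (1 + \<rho> y)^(-\<beta>-1/2)\<close>, contribute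
  \<open>((\<delta> + x)/\<delta>)^(-\<alpha>-1/2)\<close> and
  \<open>((\<delta> + y)/\<delta>)^(-\<beta>-1/2)\<close>, and all powers of \<open>\<delta>\<close>
  cancel except \<open>1/\<delta>\<close>. Geometrically \<open>\<delta>\<close> is comparable to
  \<open>t^2 + (\<theta> - \<phi>)^2\<close>, while \<open>\<delta> + x\<close> and
  \<open>\<delta> + y\<close> are comparable to the two weights of the theorem. The discs are as
  large as possible up to a constant: Cauchy's estimate then loses exactly
  \<open>(t^2 + (\<theta> - \<phi>)^2)^(-j/2)\<close>, and the weights at \<open>z\<close> still
  differ from those at \<open>\<theta>\<close> only by constants. The exceptional term
  \<open>n = 0\<close> is harmless for \<open>t \<le> 1\<close>: it changes the kernel by O(t), and
  the claimed bound for \<open>j = 0\<close> is at least a constant times t.\<close>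

lemma pochhammer_Gamma_real:
  fixes z :: real
  assumes "z > 0"
  shows "pochhammer z n = Gamma (z + real n) / Gamma z"
  using assms nonpos_Ints_nonpos[of z] by (intro pochhammer_Gamma) auto

text \<open>Both Gamma functions are compared with the same factorial through
  \<open>Gamma_series'\<close>. The quotient converges, and a convergent sequence is bounded, which
  covers all \<open>k\<close> at once.\<close>

lemma Gamma_ratio_bound:
  fixes \<alpha> :: real
  assumes "\<alpha> > -1"
  obtains C where "C > 0"
    "\<And>k::nat. Gamma (real k + 1/2) / Gamma (\<alpha> + real k + 1) \<le> C * (real k + 1) powr (- \<alpha> - 1/2)"
proof -
  have lim: "(\<lambda>n. fact (n - 1) * exp (z * ln (real n)) / Gamma (z + real n)) \<longlonglongrightarrow> 1" if "z > 0" for z :: real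
  proof -
    have "Gamma_series' z \<longlonglongrightarrow> Gamma z" by (rule Gamma_series'_LIMSEQ)
    hence "(\<lambda>n. Gamma_series' z n / Gamma z) \<longlonglongrightarrow> Gamma z / Gamma z"
      using Gamma_real_pos[OF that] by (intro tendsto_intros) linarith+
    moreover have "Gamma_series' z n / Gamma z = fact (n - 1) * exp (z * ln (real n)) / Gamma (z + real n)" for n
      using less_imp_neq[OF Gamma_real_pos[OF that]]
      by (simp add: Gamma_series'_def pochhammer_Gamma_real[OF that])
    moreover have "Gamma z \<noteq> 0" using Gamma_real_pos[OF that] by linarith
    ultimately show ?thesis by (simp only: divide_self simp_thms)
  qed
  define X where "X = (\<lambda>k::nat. Gamma (real k + 1/2) / Gamma (\<alpha> + real k + 1) * (real k + 1) powr (\<alpha> + 1/2))"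
  \<comment> \<open>The last factor replaces the power of \<open>n\<close> by the same power of
    \<open>n + 1\<close>; at \<open>n = 0\<close> the former would be 0, whatever the exponent, and
    the bound would be void.\<close>
  have "(\<lambda>n. (fact (n - 1) * exp ((\<alpha>+1) * ln (real n)) / Gamma ((\<alpha>+1) + real n)) /
             (fact (n - 1) * exp ((1/2) * ln (real n)) / Gamma ((1/2) + real n))
            * ((real n + 1) / real n) powr (\<alpha> + 1/2)) \<longlonglongrightarrow> 1 / 1 * 1"
    using assms by (intro tendsto_mult tendsto_divide lim; (simp; fail)?) real_asymp+
  moreover have "\<forall>\<^sub>F n in sequentially. (fact (n - 1) * exp ((\<alpha>+1) * ln (real n)) / Gamma ((\<alpha>+1) + real n)) /
             (fact (n - 1) * exp ((1/2) * ln (real n)) / Gamma ((1/2) + real n))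
            * ((real n + 1) / real n) powr (\<alpha> + 1/2) = X n"
    using eventually_gt_at_top[of 0]
  proof eventually_elim
    case (elim n)
    have "exp ((\<alpha>+1) * ln (real n)) / exp ((1/2) * ln (real n)) = real n powr (\<alpha> + 1/2)"
      using elim by (simp add: powr_def exp_diff[symmetric] algebra_simps)
    hence e: "exp ((\<alpha>+1) * ln (real n)) = real n powr (\<alpha> + 1/2) * exp ((1/2) * ln (real n))"
      by (simp add: field_simps)
    show ?case unfolding X_def e using elim
      by (simp add: powr_divide add_ac)
  qed
  ultimately have "X \<longlonglongrightarrow> 1" by (simp add: tendsto_cong)
  hence "Bseq X" using convergent_imp_Bseq convergentI by blast
  then obtain C where C: "C > 0" "\<And>n. norm (X n) \<le> C" by (auto simp: Bseq_def)
  show ?thesis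
  proof
    show "C > 0" by fact
    fix k :: nat
    define e where "e = \<alpha> + 1/2"
    have "X k \<le> C" using C(2)[of k] by simp
    hence "Gamma (real k + 1/2) / Gamma (\<alpha> + real k + 1) \<le> C / (real k + 1) powr e"
      unfolding X_def e_def[symmetric] by (simp add: pos_le_divide_eq)
    also have "\<dots> = C * (real k + 1) powr (- e)" by (simp add: powr_minus divide_inverse)
    finally show "Gamma (real k + 1/2) / Gamma (\<alpha> + real k + 1) \<le> C * (real k + 1) powr (- \<alpha> - 1/2)"
      by (simp add: e_def)
  qed
qed

lemma even_powers_le_exp:
  fixes z :: real assumes "z \<ge> 0"
  shows "summable (\<lambda>k. z ^ (2*k+m) / fact (2*k+m))" "(\<Sum>k. z ^ (2*k+m) / fact (2*k+m)) \<le> exp z"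
proof -
  have s: "(\<lambda>n. z ^ n / fact n) sums exp z" using exp_converges[of z] by (simp add: field_simps)
  have inj: "strict_mono (\<lambda>k::nat. 2*k+m)" by (auto simp: strict_mono_def)
  show "summable (\<lambda>k. z ^ (2*k+m) / fact (2*k+m))"
    using summable_reindex[of "\<lambda>n. z ^ n / fact n" "\<lambda>k. 2*k+m"] s assms strict_mono_imp_inj_on[OF inj]
    by (auto simp: sums_iff o_def)
  show "(\<Sum>k. z ^ (2*k+m) / fact (2*k+m)) \<le> exp z"
    using suminf_reindex_mono[of "\<lambda>n. z ^ n / fact n" "\<lambda>k. 2*k+m"] s assms strict_mono_imp_inj_on[OF inj]
    by (auto simp: sums_iff o_def)
qed

text \<open>The series with these coefficients in \<open>z ^ (2*k)\<close> is
  \<open>(z/2) powr (-\<alpha>)\<close> times the modified Bessel function of order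
  \<open>\<alpha>\<close>; splitting off the power leaves an even entire function.\<close>

definition bessel_coeff :: "real \<Rightarrow> nat \<Rightarrow> real" where
  "bessel_coeff \<alpha> k = 1 / (4 ^ k * fact k * Gamma (\<alpha> + real k + 1))"

lemma bessel_coeff_pos: "\<alpha> > -1 \<Longrightarrow> bessel_coeff \<alpha> k > 0"
  by (simp add: bessel_coeff_def Gamma_real_pos)

text \<open>By Legendre duplication, \<open>4 ^ k * fact k * Gamma (k + 1/2)\<close> is
  \<open>sqrt pi * fact (2*k)\<close>. Hence the coefficients are those of cosh up to a power of
  \<open>k + 1\<close>.\<close>

lemma bessel_coeff_le:
  assumes "\<alpha> > -1"
  obtains C where "C > 0" "\<And>k. bessel_coeff \<alpha> k \<le> C * (real k + 1) powr (- \<alpha> - 1/2) / fact (2*k)"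
proof -
  obtain C where C: "C > 0"
    "\<And>k::nat. Gamma (real k + 1/2) / Gamma (\<alpha> + real k + 1) \<le> C * (real k + 1) powr (- \<alpha> - 1/2)"
    using Gamma_ratio_bound[OF assms] by blast
  have dup: "4 ^ k * fact k * Gamma (real k + 1/2) = sqrt pi * fact (2*k)" for k :: nat
  proof -
    have "fact k * pochhammer (1/2) k * 4 ^ k = (fact (2*k) :: real)"
      using fact_double[of k, where ?'a = real] by (simp add: power_mult)
    moreover have "Gamma (1/2 + real k) = pochhammer (1/2) k * sqrt pi"
      by (simp add: pochhammer_Gamma_real Gamma_one_half_real)
    ultimately show ?thesis by (simp add: algebra_simps)
  qed
  show ?thesis
  proof
    show "C / sqrt pi > 0" using C by simp
    fix k
    have "bessel_coeff \<alpha> k = Gamma (real k + 1/2) / Gamma (\<alpha> + real k + 1) / (sqrt pi * fact (2*k))"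
      unfolding dup[symmetric] bessel_coeff_def
      using less_imp_neq[OF Gamma_real_pos[of "real k + 1/2"]] by (simp add: field_simps)
    also have "\<dots> \<le> C * (real k + 1) powr (- \<alpha> - 1/2) / (sqrt pi * fact (2*k))"
      using C(2)[of k] by (intro divide_right_mono) auto
    finally show "bessel_coeff \<alpha> k \<le> C / sqrt pi * (real k + 1) powr (- \<alpha> - 1/2) / fact (2*k)" by simp
  qed
qed

text \<open>A uniform version of the asymptotics \<open>e^z / sqrt (2 pi z)\<close> of the modified
  Bessel function. The terms of the cosh series concentrate where \<open>k\<close> is comparable to
  \<open>z\<close>, and there the power of \<open>k + 1\<close> is comparable to that of
  \<open>1 + z\<close>.\<close>

lemma bessel_series_bound:
  assumes "\<alpha> > -1"
  obtains C where "C > 0"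
    "\<And>z. z \<ge> 0 \<Longrightarrow> summable (\<lambda>k. bessel_coeff \<alpha> k * z ^ (2*k))"
    "\<And>z. z \<ge> 0 \<Longrightarrow> (\<Sum>k. bessel_coeff \<alpha> k * z ^ (2*k)) \<le> C * exp z * (1 + z) powr (- \<alpha> - 1/2)"
proof -
  obtain C where C: "C > 0" "\<And>k. bessel_coeff \<alpha> k \<le> C * (real k + 1) powr (- \<alpha> - 1/2) / fact (2*k)"
    using bessel_coeff_le[OF assms] by blast
  obtain m :: nat where m: "real m \<ge> \<alpha> + 1/2" using real_arch_simple by blast
  define D where "D = 2 + (real m + 2) ^ m * 2 ^ m"
  \<comment> \<open>With \<open>w = (k + 1) / (1 + z)\<close> we have \<open>w powr e \<le> 1 + w + w\<^sup>-\<^sup>m\<close>, as \<open>-m \<le> e \<le> 1\<close>; the factor \<open>(k + 1)\<^sup>-\<^sup>m\<close>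
      is traded for the shift from \<open>(2k)!\<close> to \<open>(2k + m)!\<close>.\<close>
  define e where "e = - \<alpha> - 1/2"
  have key: "((real k + 1) / (1 + z)) powr e * (z ^ (2*k) / fact (2*k)) \<le>
      z ^ (2*k) / fact (2*k) + (real k + 1) / (1 + z) * z ^ (2*k) / fact (2*k) +
      (1 + z) ^ m * (real m + 2) ^ m * (z ^ (2*k) / fact (2*k+m))" if z: "z \<ge> 0" for z k
  proof -
    define w where "w = (real k + 1) / (1 + z)"
    have w: "w > 0" using z by (simp add: w_def)
    have we: "w powr e \<le> 1 + w + (1/w) ^ m"
    proof (cases "w \<ge> 1")
      case True
      have "w powr e \<le> w powr 1" using True assms by (intro powr_mono) (auto simp: e_def)
      thus ?thesis using w by (simp add: add_increasing2)
    next
      case False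
      have "w powr e \<le> w powr (- real m)" using False w m by (intro powr_mono') (auto simp: e_def)
      also have "\<dots> = (1/w) ^ m" using w by (simp add: powr_minus powr_realpow field_simps power_one_over)
      finally show ?thesis using w by simp
    qed
    have "fact (2*k+m) \<le> (fact (2*k) * (real (2*k+m)) ^ m :: real)"
    proof -
      have "fact (2*k+m) = (fact (2*k) * pochhammer (real (2*k) + 1) m :: real)"
        by (metis pochhammer_fact pochhammer_product' add.commute of_nat_mult of_nat_numeral)
      also have "pochhammer (real (2*k) + 1) m \<le> (real (2*k+m)) ^ m"
        unfolding pochhammer_prod by (rule order_trans[OF prod_mono[of _ _ "\<lambda>_. real (2*k+m)"]]) auto
      finally show ?thesis by simp
    qed
    also have "\<dots> \<le> fact (2*k) * ((real m + 2) * (real k + 1)) ^ m"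
      by (intro mult_left_mono power_mono) (auto simp: algebra_simps)
    finally have "fact (2*k+m) \<le> fact (2*k) * ((real m + 2) ^ m * (real k + 1) ^ m)"
      by (simp only: power_mult_distrib)
    hence f: "1 / ((real k + 1) ^ m * fact (2*k)) \<le> (real m + 2) ^ m / fact (2*k+m)"
      by (simp add: divide_simps mult_ac)
    have "(1/w) ^ m * (z ^ (2*k) / fact (2*k)) = (1 + z) ^ m * z ^ (2*k) * (1 / ((real k + 1) ^ m * fact (2*k)))"
      by (simp add: w_def power_divide)
    also have "\<dots> \<le> (1 + z) ^ m * z ^ (2*k) * ((real m + 2) ^ m / fact (2*k+m))"
      using z by (intro mult_left_mono f) auto
    finally have "(1/w) ^ m * (z ^ (2*k) / fact (2*k)) \<le> (1 + z) ^ m * (real m + 2) ^ m * (z ^ (2*k) / fact (2*k+m))"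
      by (simp add: algebra_simps)
    moreover have "w powr e * (z ^ (2*k) / fact (2*k)) \<le> (1 + w + (1/w) ^ m) * (z ^ (2*k) / fact (2*k))"
      using z by (intro mult_right_mono we) auto
    ultimately show ?thesis unfolding w_def by (simp add: algebra_simps)
  qed
  have main: "summable (\<lambda>k. bessel_coeff \<alpha> k * z ^ (2*k)) \<and>
    (\<Sum>k. bessel_coeff \<alpha> k * z ^ (2*k)) \<le> (C * D) * exp z * (1 + z) powr (- \<alpha> - 1/2)" if z: "z \<ge> 0" for z
  proof -
    define S where "S = (\<lambda>k. z ^ (2*k) / fact (2*k) + (real k + 1) / (1 + z) * z ^ (2*k) / fact (2*k) +
      (1 + z) ^ m * (real m + 2) ^ m * (z ^ (2*k) / fact (2*k+m)))"
    have S1: "summable (\<lambda>k. z ^ (2*k) / fact (2*k))" "(\<Sum>k. z ^ (2*k) / fact (2*k)) \<le> exp z"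
      using even_powers_le_exp[OF z, of 0] by simp_all
    have S2: "summable (\<lambda>k. (real k + 1) / (1 + z) * z ^ (2*k) / fact (2*k)) \<and>
       (\<Sum>k. (real k + 1) / (1 + z) * z ^ (2*k) / fact (2*k)) \<le> exp z"
    proof -
      \<comment> \<open>Since \<open>(2k + 1) / (2k)! = 1/(2k)! + 1/(2k - 1)!\<close> for
        \<open>k > 0\<close>, the sum is at most \<open>(1 + z) * exp z\<close>. At
        \<open>k = 0\<close> truncated subtraction would add a spurious term, which the indicator
        removes.\<close>
      define T where "T = (\<lambda>k. z ^ (2*k) / fact (2*k) + z * (z ^ (2*k - 1) / fact (2*k - 1) * (if k = 0 then 0 else 1)))"
      have T1: "(\<lambda>k. z ^ (2*k - 1) / fact (2*k - 1) * (if k = 0 then 0 else 1)) sums (\<Sum>k. z ^ (2*k+1) / fact (2*k+1))"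
        using summable_sums[OF even_powers_le_exp(1)[OF z, of 1]]
        using sums_Suc[of "\<lambda>k. z ^ (2*k - 1) / fact (2*k - 1) * (if k = 0 then 0 else 1)"] by simp
      have "T sums ((\<Sum>k. z ^ (2*k) / fact (2*k)) + z * (\<Sum>k. z ^ (2*k+1) / fact (2*k+1)))"
        unfolding T_def by (intro sums_add summable_sums S1 sums_mult T1)
      moreover have "(real k + 1) / (1 + z) * z ^ (2*k) / fact (2*k) \<le> T k / (1 + z)" for k
      proof (cases "k = 0")
        case False
        then obtain j where j: "2*k = Suc j" by (cases "2*k") auto
        have "(real k + 1) * z ^ (2*k) / fact (2*k) \<le> (real (2*k) + 1) * z ^ (2*k) / fact (2*k)"
          using z by (intro divide_right_mono mult_right_mono) auto
        also have "\<dots> = T k" unfolding T_def j using False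
            by (simp add: distrib_right add_divide_distrib fact_Suc del: of_nat_Suc)
        finally have "(real k + 1) * z ^ (2*k) / fact (2*k) / (1 + z) \<le> T k / (1 + z)"
          using z by (intro divide_right_mono) auto
        thus ?thesis by (simp add: mult_ac)
      qed (use z in \<open>auto simp: T_def\<close>)
      moreover have "summable (\<lambda>k. T k / (1 + z))" "(\<Sum>k. T k / (1+z)) \<le> exp z"
      proof -
        have "(\<Sum>k. z ^ (2*k) / fact (2*k)) + z * (\<Sum>k. z ^ (2*k+1) / fact (2*k+1)) \<le> exp z + z * exp z"
          using S1 even_powers_le_exp(2)[OF z, of 1] z by (intro add_mono mult_left_mono) auto
        thus "(\<Sum>k. T k / (1+z)) \<le> exp z" "summable (\<lambda>k. T k / (1 + z))" using calculation(1) z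
          by (auto simp: sums_iff suminf_divide field_simps)
      qed
      moreover have "summable (\<lambda>k. (real k + 1) / (1 + z) * z ^ (2*k) / fact (2*k))"
        using calculation z by (intro summable_comparison_test'[OF calculation(3), of 0]) auto
      ultimately show ?thesis using suminf_le by (meson order_trans)
    qed
    have S3: "summable (\<lambda>k. (1 + z) ^ m * (real m + 2) ^ m * (z ^ (2*k) / fact (2*k+m)))"
      "(\<Sum>k. (1 + z) ^ m * (real m + 2) ^ m * (z ^ (2*k) / fact (2*k+m))) \<le> (real m + 2) ^ m * 2 ^ m * exp z"
    proof -
      have le1: "(z ^ (2*k) / fact (2*k+m)) \<le> z ^ (2*k) / fact (2*k)" for k
        using z by (intro divide_left_mono) (auto intro: fact_mono)
      show sm: "summable (\<lambda>k. (1 + z) ^ m * (real m + 2) ^ m * (z ^ (2*k) / fact (2*k+m)))"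
        using z le1 by (intro summable_mult summable_comparison_test'[OF S1(1), of 0]) auto
      have sm': "summable (\<lambda>k. z ^ (2*k) / fact (2*k+m))"
        using z le1 by (intro summable_comparison_test'[OF S1(1), of 0]) auto
      have "(1 + z) ^ m * (\<Sum>k. (z ^ (2*k) / fact (2*k+m))) \<le> 2 ^ m * exp z"
      \<comment> \<open>For \<open>z > 1\<close> the factor \<open>z ^ m\<close> is absorbed into
        the shifted powers \<open>z ^ (2*k+m)\<close> of the exponential series; for
        \<open>z \<le> 1\<close> the factor \<open>(1 + z) ^ m\<close> is bounded.\<close>
      proof (cases "z \<le> 1")
        case True
        have "(\<Sum>k. (z ^ (2*k) / fact (2*k+m))) \<le> exp z"
          using suminf_le[OF le1 sm' S1(1)] S1(2) by simp
        moreover have "(1+z)^m \<le> 2^m" using z True by (intro power_mono) auto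
        ultimately show ?thesis using z sm' by (intro mult_mono suminf_nonneg) auto
      next
        case False
        have "(1+z)^m \<le> (2*z)^m" using False by (intro power_mono) auto
        hence "(1 + z) ^ m * (\<Sum>k. (z ^ (2*k) / fact (2*k+m))) \<le> (2*z)^m * (\<Sum>k. (z ^ (2*k) / fact (2*k+m)))"
          using z sm' by (intro mult_right_mono suminf_nonneg) auto
        also have "\<dots> = 2^m * (\<Sum>k. z ^ (2*k+m) / fact (2*k+m))"
          using suminf_mult[OF sm', of "z^m"] by (simp add: power_mult_distrib power_add mult_ac)
        also have "\<dots> \<le> 2^m * exp z" using even_powers_le_exp(2)[OF z] by (intro mult_left_mono) auto
        finally show ?thesis .
      qed
      hence "(real m + 2) ^ m * ((1 + z) ^ m * (\<Sum>k. (z ^ (2*k) / fact (2*k+m)))) \<le> (real m + 2) ^ m * (2 ^ m * exp z)"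
        by (intro mult_left_mono) auto
      thus "(\<Sum>k. (1 + z) ^ m * (real m + 2) ^ m * (z ^ (2*k) / fact (2*k+m))) \<le> (real m + 2) ^ m * 2 ^ m * exp z"
        using suminf_mult[OF sm', of "(1 + z) ^ m * (real m + 2) ^ m"] by (simp add: mult_ac)
    qed
    have S: "summable S" "suminf S \<le> D * exp z"
    proof -
      show "summable S" unfolding S_def using S1 S2 S3 by (intro summable_add) auto
      have "suminf S = (\<Sum>k. z ^ (2*k) / fact (2*k)) + (\<Sum>k. (real k + 1) / (1 + z) * z ^ (2*k) / fact (2*k)) +
         (\<Sum>k. (1 + z) ^ m * (real m + 2) ^ m * (z ^ (2*k) / fact (2*k+m)))"
        unfolding S_def using S1 S2 S3 by (simp add: suminf_add summable_add)
      thus "suminf S \<le> D * exp z" using S1 S2 S3 unfolding D_def by (simp add: algebra_simps)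
    qed
    have le: "bessel_coeff \<alpha> k * z ^ (2*k) \<le> C * (1 + z) powr e * S k" for k
    proof -
      have "bessel_coeff \<alpha> k * z ^ (2*k) \<le> C * (real k + 1) powr e / fact (2*k) * z ^ (2*k)"
        using C(2)[of k] z by (intro mult_right_mono) (auto simp: e_def)
      also have "(real k + 1) powr e = (1 + z) powr e * ((real k + 1) / (1 + z)) powr e"
        using z by (simp add: powr_divide)
      finally have "bessel_coeff \<alpha> k * z ^ (2*k) \<le>
          C * (1 + z) powr e * (((real k + 1) / (1 + z)) powr e * (z ^ (2*k) / fact (2*k)))" by (simp add: mult_ac)
      also have "\<dots> \<le> C * (1 + z) powr e * S k"
        unfolding S_def using C(1) by (intro mult_left_mono key z) auto
      finally show ?thesis .
    qed
    have sb: "summable (\<lambda>k. bessel_coeff \<alpha> k * z ^ (2*k))"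
      using le z less_imp_le[OF bessel_coeff_pos[OF assms]]
      by (intro summable_comparison_test'[OF summable_mult[OF S(1), of "C * (1 + z) powr e"], of 0]) auto
    have "(\<Sum>k. bessel_coeff \<alpha> k * z ^ (2*k)) \<le> C * (1 + z) powr e * suminf S"
      using suminf_le[OF le sb summable_mult[OF S(1)]] S(1) by (simp add: suminf_mult)
    also have "\<dots> \<le> C * (1 + z) powr e * (D * exp z)" using C S by (intro mult_left_mono) auto
    finally show ?thesis using sb by (simp add: e_def mult_ac)
  qed
  show ?thesis
    by (rule that[of "C * D"]) (use main C in \<open>auto simp: D_def intro!: mult_pos_pos add_pos_nonneg\<close>)
qed

section \<open>The double power series\<close>

definition jk_coeff :: "real \<Rightarrow> real \<Rightarrow> nat \<Rightarrow> nat \<Rightarrow> real" where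
  "jk_coeff \<alpha> \<beta> k l = Gamma (\<alpha> + \<beta> + 2 + 2 * real (k + l)) * bessel_coeff \<alpha> k * bessel_coeff \<beta> l"

text \<open>Summed over \<open>N\<close>, this is a constant times Appell's function
  \<open>F4(s/2, (s+1)/2; \<alpha>+1, \<beta>+1; x^2, y^2)\<close>, whose domain of convergence is
  \<open>|x| + |y| < 1\<close>. The value type is generic because the complex values are compared
  with the same polynomial at the moduli.\<close>

definition jk_term :: "real \<Rightarrow> real \<Rightarrow> nat \<Rightarrow> 'a \<Rightarrow> 'a \<Rightarrow> 'a::real_normed_field" where
  "jk_term \<alpha> \<beta> N x y = (\<Sum>k\<le>N. of_real (jk_coeff \<alpha> \<beta> k (N - k)) * x ^ (2*k) * y ^ (2*(N-k)))"

lemma jk_coeff_pos: "\<alpha> > -1 \<Longrightarrow> \<beta> > -1 \<Longrightarrow> jk_coeff \<alpha> \<beta> k l > 0"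
  unfolding jk_coeff_def by (intro mult_pos_pos bessel_coeff_pos Gamma_real_pos) auto

lemma jk_term_nonneg: "\<alpha> > -1 \<Longrightarrow> \<beta> > -1 \<Longrightarrow> x \<ge> 0 \<Longrightarrow> y \<ge> 0 \<Longrightarrow> jk_term \<alpha> \<beta> N x (y::real) \<ge> 0"
  unfolding jk_term_def using less_imp_le[OF jk_coeff_pos] by (intro sum_nonneg mult_nonneg_nonneg) auto

text \<open>Separates \<open>w\<close> from the weight for either sign of \<open>e\<close>: the base
  \<open>\<delta> + w * x\<close> lies between \<open>\<delta> + x\<close> and
  \<open>(\<delta> + x) * w\<close>, so by monotonicity its power is at most the larger of the two
  end values.\<close>

lemma powr_add_mult_le:
  fixes \<delta> x w e :: real
  assumes "\<delta> > 0" "x \<ge> 0" "w > 0"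
  shows "(\<delta> + w * x) powr e \<le> (\<delta> + x) powr e * (1 + w powr e)"
proof -
  have *: "(\<delta> + x) powr e * w powr e = ((\<delta> + x) * w) powr e"
    using assms by (simp add: powr_mult)
  have "(\<delta> + w * x) powr e \<le> max ((\<delta> + x) powr e) (((\<delta> + x) * w) powr e)"
  proof (cases "(w \<ge> 1) = (e \<ge> 0)")
    case True
    have "(\<delta> + w * x) powr e \<le> ((\<delta> + x) * w) powr e"
    proof (cases "e \<ge> 0")
      case True' : True
      with True assms show ?thesis by (intro powr_mono2) (auto simp: algebra_simps)
    next
      case False
      with True assms show ?thesis
        by (intro powr_mono2') (auto simp: algebra_simps intro!: mult_pos_pos add_pos_nonneg)
    qed
    thus ?thesis by simp
  next
    case False
    have "(\<delta> + w * x) powr e \<le> (\<delta> + x) powr e"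
    proof (cases "e \<ge> 0")
      case True
      with False assms show ?thesis by (intro powr_mono2) (auto simp: mult_left_le_one_le)
    next
      case False' : False
      with False assms show ?thesis
        by (intro powr_mono2') (auto simp: mult_le_cancel_right1)
    qed
    thus ?thesis by simp
  qed
  also have "\<dots> \<le> (\<delta> + x) powr e + ((\<delta> + x) * w) powr e" by simp
  finally show ?thesis using * by (simp add: algebra_simps)
qed

text \<open>\<open>Gamma (s + 2N)\<close> is written as an Euler integral. By homogeneity its factor
  \<open>\<rho> ^ (2*N)\<close> scales both arguments, and the sum over \<open>N\<close> becomes the
  Cauchy product of two Bessel series. In \<open>ennreal\<close> the sum and the integral may be
  interchanged without knowing convergence, which is read off later from finiteness.\<close>

lemma jk_term_suminf_ennreal:
  assumes ab: "\<alpha> > -1" "\<beta> > -1" and xy: "x \<ge> 0" "y \<ge> 0"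
    and sa: "\<And>z. z \<ge> 0 \<Longrightarrow> summable (\<lambda>k. bessel_coeff \<alpha> k * z ^ (2*k))"
    and sb: "\<And>z. z \<ge> 0 \<Longrightarrow> summable (\<lambda>k. bessel_coeff \<beta> k * z ^ (2*k))"
  shows "(\<Sum>N. ennreal (jk_term \<alpha> \<beta> N x y)) =
    (\<integral>\<^sup>+\<rho>. ennreal (indicator {0..} \<rho> * \<rho> powr (\<alpha> + \<beta> + 1) / exp \<rho> *
       ((\<Sum>k. bessel_coeff \<alpha> k * (\<rho> * x) ^ (2*k)) * (\<Sum>k. bessel_coeff \<beta> k * (\<rho> * y) ^ (2*k)))) \<partial>lborel)"
proof -
  define s where "s = \<alpha> + \<beta> + 2"
  have s: "s > 0" using ab by (simp add: s_def)
  define c where "c = (\<lambda>N \<rho>. \<Sum>k\<le>N. (bessel_coeff \<alpha> k * (\<rho> * x) ^ (2*k)) * (bessel_coeff \<beta> (N-k) * (\<rho> * y) ^ (2*(N-k))))"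
  define w where "w = (\<lambda>\<rho>::real. indicator {0..} \<rho> * \<rho> powr (s - 1) / exp \<rho>)"
  have pos: "bessel_coeff \<alpha> k \<ge> 0" "bessel_coeff \<beta> k \<ge> 0" for k
    using bessel_coeff_pos ab less_imp_le by blast+
  have w0: "w \<rho> \<ge> 0" for \<rho> by (auto simp: w_def)
  have c0: "c N \<rho> \<ge> 0" if "\<rho> \<ge> 0" for N \<rho>
    unfolding c_def using that pos xy by (intro sum_nonneg mult_nonneg_nonneg) auto
  have t: "ennreal (jk_term \<alpha> \<beta> N x y) = (\<integral>\<^sup>+\<rho>. ennreal (w \<rho> * c N \<rho>) \<partial>lborel)" for N
  proof -
    have c1: "c N \<rho> = \<rho> ^ (2*N) * c N 1" for \<rho>
      unfolding c_def sum_distrib_left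
    proof (intro sum.cong refl)
      fix k assume "k \<in> {..N}"
      hence "2*N = 2*k + 2*(N-k)" by auto
      hence "\<rho> ^ (2*N) = \<rho> ^ (2*k) * \<rho> ^ (2*(N-k))" by (metis power_add)
      thus "bessel_coeff \<alpha> k * (\<rho> * x) ^ (2*k) * (bessel_coeff \<beta> (N-k) * (\<rho> * y) ^ (2*(N-k))) =
        \<rho> ^ (2*N) * (bessel_coeff \<alpha> k * (1 * x) ^ (2*k) * (bessel_coeff \<beta> (N-k) * (1 * y) ^ (2*(N-k))))"
        by (simp add: power_mult_distrib)
    qed
    have j: "jk_term \<alpha> \<beta> N x y = c N 1 * Gamma (s + 2 * real N)"
      unfolding jk_term_def c_def sum_distrib_right
      by (intro sum.cong) (auto simp: jk_coeff_def s_def mult_ac)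
    have "ennreal (jk_term \<alpha> \<beta> N x y) = ennreal (c N 1) * (\<integral>\<^sup>+\<rho>. ennreal (indicator {0..} \<rho> * \<rho> powr (s + 2 * real N - 1) / exp \<rho>) \<partial>lborel)"
      unfolding j using s c0[of 1 N] by (subst Gamma_conv_nn_integral_real[symmetric]) (auto simp: ennreal_mult' Gamma_real_nonneg)
    also have "\<dots> = (\<integral>\<^sup>+\<rho>. ennreal (c N 1) * ennreal (indicator {0..} \<rho> * \<rho> powr (s + 2 * real N - 1) / exp \<rho>) \<partial>lborel)"
      by (rule nn_integral_cmult[symmetric]) measurable
    also have "\<dots> = (\<integral>\<^sup>+\<rho>. ennreal (w \<rho> * c N \<rho>) \<partial>lborel)"
    proof (rule nn_integral_cong)
      fix \<rho> :: real
      have "\<rho> powr (s + 2 * real N - 1) = \<rho> powr (s - 1) * \<rho> ^ (2*N)" if "\<rho> > 0"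
        using powr_add[of \<rho> "s - 1" "real (2*N)"] powr_realpow[OF that, of "2*N"] by (simp add: add_ac diff_add_eq)
      \<comment> \<open>At \<open>\<rho> = 0\<close> both sides vanish, since
        \<open>0 powr e = 0\<close> for every \<open>e\<close>.\<close>
      hence "\<rho> powr (s + 2 * real N - 1) = \<rho> powr (s - 1) * \<rho> ^ (2*N)" if "\<rho> \<ge> 0"
        using that by (cases "\<rho> = 0") auto
      thus "ennreal (c N 1) * ennreal (indicator {0..} \<rho> * \<rho> powr (s + 2 * real N - 1) / exp \<rho>) = ennreal (w \<rho> * c N \<rho>)"
        unfolding c1[of \<rho>] w_def using c0[of 1 N]
        by (auto simp: indicator_def mult_ac simp flip: ennreal_mult')
    qed
    finally show ?thesis .
  qed
  have "(\<Sum>N. ennreal (jk_term \<alpha> \<beta> N x y)) = (\<integral>\<^sup>+\<rho>. (\<Sum>N. ennreal (w \<rho> * c N \<rho>)) \<partial>lborel)"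
    unfolding t by (rule nn_integral_suminf[symmetric]) (simp add: w_def c_def)
  also have "\<dots> = (\<integral>\<^sup>+\<rho>. ennreal (w \<rho> * ((\<Sum>k. bessel_coeff \<alpha> k * (\<rho> * x) ^ (2*k)) * (\<Sum>k. bessel_coeff \<beta> k * (\<rho> * y) ^ (2*k)))) \<partial>lborel)"
  proof (rule nn_integral_cong)
    fix \<rho> :: real
    show "(\<Sum>N. ennreal (w \<rho> * c N \<rho>)) = ennreal (w \<rho> * ((\<Sum>k. bessel_coeff \<alpha> k * (\<rho> * x) ^ (2*k)) * (\<Sum>k. bessel_coeff \<beta> k * (\<rho> * y) ^ (2*k))))"
    proof (cases "\<rho> \<ge> 0")
      case True
      have "(\<lambda>N. c N \<rho>) sums ((\<Sum>k. bessel_coeff \<alpha> k * (\<rho> * x) ^ (2*k)) * (\<Sum>k. bessel_coeff \<beta> k * (\<rho> * y) ^ (2*k)))"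
        unfolding c_def using True xy pos sa[of "\<rho>*x"] sb[of "\<rho>*y"]
        by (intro Cauchy_product_sums) (auto simp: power_even_abs)
      from sums_mult[OF this, of "w \<rho>"] show ?thesis
        using w0 c0[OF True] by (intro suminf_ennreal_eq) auto
    qed (auto simp: w_def)
  qed
  finally show ?thesis by (simp add: w_def s_def add_ac)
qed

lemma jk_majorant:
  assumes ab: "\<alpha> > -1" "\<beta> > -1"
  obtains C where "C > 0"
   "\<And>x y. x \<ge> 0 \<Longrightarrow> y \<ge> 0 \<Longrightarrow> x + y < 1 \<Longrightarrow> summable (\<lambda>N. jk_term \<alpha> \<beta> N x (y::real))"
   "\<And>x y. x \<ge> 0 \<Longrightarrow> y \<ge> 0 \<Longrightarrow> x + y < 1 \<Longrightarrow> (\<Sum>N. jk_term \<alpha> \<beta> N x (y::real)) \<le>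
      C / (1 - x - y) * (1 - x - y + x) powr (-\<alpha>-1/2) * (1 - x - y + y) powr (-\<beta>-1/2)"
proof -
  obtain A where A: "A > 0"
    "\<And>z. z \<ge> 0 \<Longrightarrow> summable (\<lambda>k. bessel_coeff \<alpha> k * z ^ (2*k))"
    "\<And>z. z \<ge> 0 \<Longrightarrow> (\<Sum>k. bessel_coeff \<alpha> k * z ^ (2*k)) \<le> A * exp z * (1 + z) powr (- \<alpha> - 1/2)"
    using bessel_series_bound[OF ab(1)] by blast
  obtain B where B: "B > 0"
    "\<And>z. z \<ge> 0 \<Longrightarrow> summable (\<lambda>k. bessel_coeff \<beta> k * z ^ (2*k))"
    "\<And>z. z \<ge> 0 \<Longrightarrow> (\<Sum>k. bessel_coeff \<beta> k * z ^ (2*k)) \<le> B * exp z * (1 + z) powr (- \<beta> - 1/2)"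
    using bessel_series_bound[OF ab(2)] by blast
  have bp: "bessel_coeff \<alpha> k \<ge> 0" "bessel_coeff \<beta> k \<ge> 0" for k
    using bessel_coeff_pos ab less_imp_le by blast+
  \<comment> \<open>The four Gamma integrals arise from multiplying out \<open>w powr
    (\<alpha>+\<beta>+1) * (1 + w powr (-\<alpha>-1/2)) * (1 + w powr (-\<beta>-1/2))\<close>; all
    four arguments are positive for \<open>\<alpha>, \<beta> > -1\<close>.\<close>
  define G where "G = Gamma (\<alpha>+\<beta>+2) + Gamma (\<beta>+3/2) + Gamma (\<alpha>+3/2) + Gamma 1"
  define g where "g = (\<lambda>a w::real. indicator {0..} w * w powr (a - 1) / exp w)"
  have Gp: "Gamma (\<alpha>+\<beta>+2) > 0" "Gamma (\<beta>+3/2) > 0" "Gamma (\<alpha>+3/2) > 0" using ab by (auto intro!: Gamma_real_pos)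
  have "G > 0" using Gp by (simp add: G_def)
  have main: "(\<Sum>N. ennreal (jk_term \<alpha> \<beta> N x y)) \<le> ennreal (A * B * G / (1 - x - y) * (1 - x - y + x) powr (-\<alpha>-1/2) * (1 - x - y + y) powr (-\<beta>-1/2))"
    if xy: "x \<ge> 0" "y \<ge> 0" "x + y < 1" for x y
  proof -
    define \<delta> where "\<delta> = 1 - x - y"
    have d: "\<delta> > 0" "\<delta> \<le> 1" using xy by (auto simp: \<delta>_def)
    define D where "D = A * B * (\<delta> + x) powr (-\<alpha>-1/2) * (\<delta> + y) powr (-\<beta>-1/2)"
    have D: "D \<ge> 0" using A B by (simp add: D_def)
    define f where "f = (\<lambda>\<rho>. indicator {0..} \<rho> * \<rho> powr (\<alpha> + \<beta> + 1) / exp \<rho> *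
       ((A * exp (\<rho>*x) * (1 + \<rho>*x) powr (- \<alpha> - 1/2)) * (B * exp (\<rho>*y) * (1 + \<rho>*y) powr (- \<beta> - 1/2))))"
    have eq: "(\<Sum>N. ennreal (jk_term \<alpha> \<beta> N x y)) =
      (\<integral>\<^sup>+\<rho>. ennreal (indicator {0..} \<rho> * \<rho> powr (\<alpha> + \<beta> + 1) / exp \<rho> *
         ((\<Sum>k. bessel_coeff \<alpha> k * (\<rho> * x) ^ (2*k)) * (\<Sum>k. bessel_coeff \<beta> k * (\<rho> * y) ^ (2*k)))) \<partial>lborel)"
      by (rule jk_term_suminf_ennreal) (use ab xy A(2) B(2) in auto)
    have "(\<Sum>N. ennreal (jk_term \<alpha> \<beta> N x y)) \<le> (\<integral>\<^sup>+\<rho>. ennreal (f \<rho>) \<partial>lborel)"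
      unfolding eq f_def
    proof (intro nn_integral_mono ennreal_leI)
      fix \<rho> :: real
      show "indicator {0..} \<rho> * \<rho> powr (\<alpha> + \<beta> + 1) / exp \<rho> *
         ((\<Sum>k. bessel_coeff \<alpha> k * (\<rho> * x) ^ (2 * k)) * (\<Sum>k. bessel_coeff \<beta> k * (\<rho> * y) ^ (2 * k)))
         \<le> indicator {0..} \<rho> * \<rho> powr (\<alpha> + \<beta> + 1) / exp \<rho> *
         (A * exp (\<rho> * x) * (1 + \<rho> * x) powr (- \<alpha> - 1 / 2) * (B * exp (\<rho> * y) * (1 + \<rho> * y) powr (- \<beta> - 1 / 2)))"
      proof (cases "\<rho> \<ge> 0")
        case True
        hence "\<rho> * x \<ge> 0" "\<rho> * y \<ge> 0" using xy by auto
        thus ?thesis using A(1) B(1) bp True xy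
          by (intro mult_left_mono mult_mono A(3) B(3) suminf_nonneg A(2) B(2) mult_nonneg_nonneg divide_nonneg_nonneg) simp_all
      qed auto
    qed
    \<comment> \<open>The substitution \<open>\<rho> = w/\<delta>\<close> is chosen so that the
      three exponentials combine to \<open>exp (-w)\<close>.\<close>
    also have "\<dots> = ennreal (1/\<delta>) * (\<integral>\<^sup>+w. ennreal (f (w/\<delta>)) \<partial>lborel)"
      using d by (subst nn_integral_real_affine[where c = "1/\<delta>" and t = 0]) (auto simp: f_def)
    also have "(\<integral>\<^sup>+w. ennreal (f (w/\<delta>)) \<partial>lborel) \<le> (\<integral>\<^sup>+w. ennreal D * (ennreal (g (\<alpha>+\<beta>+2) w) + ennreal (g (\<beta>+3/2) w) + ennreal (g (\<alpha>+3/2) w) + ennreal (g 1 w)) \<partial>lborel)"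
    proof (rule nn_integral_mono)
      fix w :: real
      have "f (w/\<delta>) \<le> D * (g (\<alpha>+\<beta>+2) w + g (\<beta>+3/2) w + g (\<alpha>+3/2) w + g 1 w)"
      proof (cases "w > 0")
        case w: True
        have e: "exp (w/\<delta>*x) * exp (w/\<delta>*y) / exp (w/\<delta>) = 1 / exp w"
        proof -
          have "w/\<delta>*x + w/\<delta>*y - w/\<delta> = w/\<delta> * (x + y - 1)" by (simp only: distrib_left right_diff_distrib mult_1_right)
          also have "x + y - 1 = -\<delta>" by (simp add: \<delta>_def)
          finally have "w/\<delta>*x + w/\<delta>*y - w/\<delta> = - (w/\<delta>*\<delta>)" by simp
          hence "exp (w/\<delta>*x + w/\<delta>*y - w/\<delta>) = exp (-w)" using d by simp
          thus ?thesis by (simp add: exp_add exp_diff exp_minus inverse_eq_divide)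
        qed
        have p: "(1 + w/\<delta>*u) powr a = (\<delta> + w*u) powr a / \<delta> powr a" if "u \<ge> 0" for u a
        proof -
          have "1 + w/\<delta>*u = (\<delta> + w*u)/\<delta>" using d by (simp add: field_simps)
          thus ?thesis using d w that by (simp add: powr_divide)
        qed
        \<comment> \<open>The exponents balance because
          \<open>\<alpha> + \<beta> + 1 = (\<alpha> + 1/2) + (\<beta> + 1/2)\<close>; only the
          Jacobian \<open>1/\<delta>\<close> survives.\<close>
        have q: "(w/\<delta>) powr (\<alpha>+\<beta>+1) / \<delta> powr (-\<alpha>-1/2) / \<delta> powr (-\<beta>-1/2) = w powr (\<alpha>+\<beta>+1)"
        proof -
          have "\<delta> powr (\<alpha>+\<beta>+1) * \<delta> powr (-\<alpha>-1/2) * \<delta> powr (-\<beta>-1/2) = 1"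
            using d by (simp add: powr_add[symmetric])
          thus ?thesis using d w by (simp add: powr_divide)
        qed
        have "f (w/\<delta>) = (w/\<delta>) powr (\<alpha> + \<beta> + 1) * A * B * (exp (w/\<delta>*x) * exp (w/\<delta>*y) / exp (w/\<delta>)) *
             ((1 + w/\<delta>*x) powr (- \<alpha> - 1/2) * (1 + w/\<delta>*y) powr (- \<beta> - 1/2))"
          using w d by (simp add: f_def field_simps)
        also have "\<dots> = ((w/\<delta>) powr (\<alpha>+\<beta>+1) / \<delta> powr (-\<alpha>-1/2) / \<delta> powr (-\<beta>-1/2)) / exp w * A * B *
            ((\<delta> + w*x) powr (-\<alpha>-1/2) * (\<delta> + w*y) powr (-\<beta>-1/2))"
          unfolding e p[OF xy(1)] p[OF xy(2)] by simp
        also have "\<dots> = w powr (\<alpha>+\<beta>+1) / exp w * A * B * ((\<delta> + w*x) powr (-\<alpha>-1/2) * (\<delta> + w*y) powr (-\<beta>-1/2))"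
          unfolding q ..
        also have "\<dots> \<le> w powr (\<alpha>+\<beta>+1) / exp w * A * B * (((\<delta> + x) powr (-\<alpha>-1/2) * (1 + w powr (-\<alpha>-1/2))) *
              ((\<delta> + y) powr (-\<beta>-1/2) * (1 + w powr (-\<beta>-1/2))))"
          using A B w d xy by (intro mult_left_mono mult_mono powr_add_mult_le) auto
        also have "\<dots> = D * ((w powr (\<alpha>+\<beta>+1) * (1 + w powr (-\<alpha>-1/2)) * (1 + w powr (-\<beta>-1/2))) / exp w)"
          by (simp add: D_def)
        also have "w powr (\<alpha>+\<beta>+1) * (1 + w powr (-\<alpha>-1/2)) * (1 + w powr (-\<beta>-1/2)) =
            w powr (\<alpha>+\<beta>+1) + w powr (\<beta>+1/2) + w powr (\<alpha>+1/2) + 1"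
          using w by (simp add: distrib_left distrib_right powr_add[symmetric])
        finally show ?thesis using w by (simp add: g_def add_divide_distrib algebra_simps)
      next
        case False
        hence "w < 0 \<or> w = 0" by auto
        thus ?thesis using D d by (auto simp: f_def g_def indicator_def zero_le_divide_iff)
      qed
      moreover have "g a w \<ge> 0" for a by (simp add: g_def)
      ultimately show "ennreal (f (w/\<delta>)) \<le> ennreal D * (ennreal (g (\<alpha>+\<beta>+2) w) + ennreal (g (\<beta>+3/2) w) + ennreal (g (\<alpha>+3/2) w) + ennreal (g 1 w))"
        using D by (simp flip: ennreal_plus ennreal_mult' add: ennreal_leI)
    qed
    also have "\<dots> = ennreal (D * G)"
    proof -
      have [measurable]: "g a \<in> borel_measurable borel" for a unfolding g_def by measurable
      have gg: "(\<integral>\<^sup>+w. ennreal (g a w) \<partial>lborel) = ennreal (Gamma a)" if "a > 0" for a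
        unfolding g_def using Gamma_conv_nn_integral_real[OF that] by simp
      show ?thesis using ab Gp D by (simp add: nn_integral_cmult nn_integral_add gg G_def ennreal_mult')
    qed
    finally have "(\<Sum>N. ennreal (jk_term \<alpha> \<beta> N x y)) \<le> ennreal (1/\<delta>) * ennreal (D * G)"
      by (simp add: mult_left_mono)
    also have "\<dots> = ennreal (A * B * G / \<delta> * (\<delta> + x) powr (-\<alpha>-1/2) * (\<delta> + y) powr (-\<beta>-1/2))"
      using D \<open>G > 0\<close> d by (simp flip: ennreal_mult' add: D_def field_simps)
    finally show ?thesis by (simp add: \<delta>_def)
  qed
  have nn: "x \<ge> 0 \<Longrightarrow> y \<ge> 0 \<Longrightarrow> jk_term \<alpha> \<beta> N x y \<ge> 0" for N and x y :: real using jk_term_nonneg ab by blast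
  have sm: "summable (\<lambda>N. jk_term \<alpha> \<beta> N x y)" if xy: "x \<ge> 0" "y \<ge> 0" "x + y < 1" for x y :: real
    using main[OF that] nn[OF xy(1,2)] by (intro summable_suminf_not_top) (auto simp: top_unique)
  show ?thesis
  proof
    show "A * B * G > 0" using A B \<open>G > 0\<close> by simp
    show "summable (\<lambda>N. jk_term \<alpha> \<beta> N x y)" if xy: "x \<ge> 0" "y \<ge> 0" "x + y < 1" for x y :: real using sm that .
    show "(\<Sum>N. jk_term \<alpha> \<beta> N x y) \<le> A * B * G / (1 - x - y) * (1 - x - y + x) powr (-\<alpha>-1/2) * (1 - x - y + y) powr (-\<beta>-1/2)"
      if xy: "x \<ge> 0" "y \<ge> 0" "x + y < 1" for x y :: real
      using main[OF that] sm[OF that] nn[OF xy(1,2)] A B \<open>G > 0\<close> xy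
      by (subst (asm) suminf_ennreal2) (auto simp: ennreal_le_iff)
  qed
qed

section \<open>Binomial identities\<close>

text \<open>The left side is an n-th finite difference in \<open>x\<close>. Each difference lowers
  the order by one: \<open>pochhammer x k - pochhammer (x + 1) k = - k * pochhammer (x + 1) (k -
  1)\<close>.\<close>

lemma alternating_binomial_pochhammer:
  fixes x :: "'a::comm_ring_1"
  shows "(\<Sum>i\<le>n. (-1) ^ i * of_nat (n choose i) * pochhammer (x + of_nat i) k) =
    (if k < n then 0 else (-1) ^ n * of_nat (fact k div fact (k - n)) * pochhammer (x + of_nat n) (k - n))"
proof (induction n arbitrary: x k)
  case (Suc n)
  have "(\<Sum>i\<le>Suc n. (-1) ^ i * of_nat (Suc n choose i) * pochhammer (x + of_nat i) k) =
    (\<Sum>i\<le>n. (-1) ^ i * of_nat (n choose i) * pochhammer (x + of_nat i) k)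
     - (\<Sum>i\<le>n. (-1) ^ i * of_nat (n choose i) * pochhammer (x + 1 + of_nat i) k)"
  proof -
    have "(\<Sum>i\<le>Suc n. (-1) ^ i * of_nat (Suc n choose i) * pochhammer (x + of_nat i) k) =
      pochhammer x k + (\<Sum>i\<le>n. - ((-1) ^ i * of_nat (n choose i) * pochhammer (x + 1 + of_nat i) k)
          - (-1) ^ i * of_nat (n choose Suc i) * pochhammer (x + of_nat (Suc i)) k)"
      by (subst sum.atMost_Suc_shift) (simp add: algebra_simps)
    moreover have "(\<Sum>i\<le>n. (-1) ^ i * of_nat (n choose i) * pochhammer (x + of_nat i) k) =
      pochhammer x k - (\<Sum>i\<le>n. (-1) ^ i * of_nat (n choose Suc i) * pochhammer (x + of_nat (Suc i)) k)"
    proof -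
      have "(\<Sum>i\<le>n. (-1) ^ i * of_nat (n choose i) * pochhammer (x + of_nat i) k) =
        (\<Sum>i\<le>Suc n. (-1) ^ i * of_nat (n choose i) * pochhammer (x + of_nat i) k)"
        by (simp add: binomial_eq_0 del: binomial_Suc_n)
      also have "\<dots> = pochhammer x k - (\<Sum>i\<le>n. (-1) ^ i * of_nat (n choose Suc i) * pochhammer (x + of_nat (Suc i)) k)"
        by (subst sum.atMost_Suc_shift) (simp add: sum_negf)
      finally show ?thesis .
    qed
    ultimately show ?thesis by (simp add: sum_subtractf sum_negf)
  qed
  also have "\<dots> = (\<Sum>i\<le>n. (-1) ^ i * of_nat (n choose i) * (pochhammer (x + of_nat i) k - pochhammer (x + of_nat i + 1) k))"
    by (simp add: sum_subtractf[symmetric] algebra_simps)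
  also have "\<dots> = (\<Sum>i\<le>n. (-1) ^ i * of_nat (n choose i) * (- of_nat k * pochhammer (x + 1 + of_nat i) (k - 1)))"
  proof (intro sum.cong refl arg_cong2[of _ _ _ _ "(*)"])
    fix i
    show "pochhammer (x + of_nat i) k - pochhammer (x + of_nat i + 1) k = - of_nat k * pochhammer (x + 1 + of_nat i) (k - 1)"
    proof (cases k)
      case (Suc l)
      show ?thesis unfolding Suc pochhammer_rec[of "x + of_nat i"] pochhammer_Suc[of "x + of_nat i + 1"]
        by (simp add: algebra_simps)
    qed auto
  qed
  also have "\<dots> = - of_nat k * (\<Sum>i\<le>n. (-1) ^ i * of_nat (n choose i) * pochhammer (x + 1 + of_nat i) (k - 1))"
    by (simp add: sum_distrib_left mult_ac)
  also have "\<dots> = (if k < Suc n then 0 else (-1) ^ Suc n * of_nat (fact k div fact (k - Suc n)) * pochhammer (x + of_nat (Suc n)) (k - Suc n))"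
  proof (cases "k < Suc n")
    case True
    thus ?thesis unfolding Suc.IH by (cases k) auto
  next
    case False
    then obtain l where l: "k = Suc l" "n \<le> l" by (cases k) auto
    have "fact k div fact (k - Suc n) = k * (fact l div fact (l - n) :: nat)"
      unfolding l using fact_dvd[of "l-n" l, where ?'a=nat] by (simp add: div_mult_swap del: mult_Suc)
    thus ?thesis unfolding Suc.IH using l by (simp add: algebra_simps)
  qed
  finally show ?case .
qed auto

text \<open>The hypotheses say that \<open>f\<close> and \<open>g\<close> are binomial transforms of
  \<open>F\<close> and \<open>G\<close>. On exponential generating functions the transform is
  multiplication by \<open>exp x\<close>, or by \<open>exp (-x)\<close> for the alternating
  sequence, and the two exponentials cancel.\<close>

lemma alternating_binomial_convolution:
  fixes f g F G :: "nat \<Rightarrow> real"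
  assumes f: "\<And>i. f i = (\<Sum>p\<le>i. real (i choose p) * F p)"
    and g: "\<And>i. g i = (\<Sum>p\<le>i. real (i choose p) * G p)"
  shows "(\<Sum>i\<le>n. (-1) ^ i * real (n choose i) * f i * g (n - i)) =
         (\<Sum>p\<le>n. (-1) ^ p * real (n choose p) * F p * G (n - p))"
proof -
  have egf: "Abs_fps (\<lambda>i. c ^ i * f i / fact i) = fps_exp c * Abs_fps (\<lambda>p. c ^ p * F p / fact p)"
    if "\<And>i. f i = (\<Sum>p\<le>i. real (i choose p) * F p)" for c :: real and f F
  proof (rule fps_ext)
    fix n
    show "fps_nth (Abs_fps (\<lambda>i. c ^ i * f i / fact i)) n = fps_nth (fps_exp c * Abs_fps (\<lambda>p. c ^ p * F p / fact p)) n"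
      unfolding fps_mult_nth fps_nth_Abs_fps fps_exp_nth that sum_distrib_left sum_divide_distrib atLeast0AtMost
      by (rule sum.reindex_bij_witness[of _ "\<lambda>i. n - i" "\<lambda>i. n - i"])
         (auto simp: binomial_fact field_simps simp flip: power_add)
  qed
  have conv: "fps_nth (Abs_fps (\<lambda>i. (-1) ^ i * f i / fact i) * Abs_fps (\<lambda>i. 1 ^ i * g i / fact i)) n
    = (\<Sum>i\<le>n. (-1) ^ i * real (n choose i) * f i * g (n - i)) / fact n" for f g :: "nat \<Rightarrow> real"
    unfolding fps_mult_nth fps_nth_Abs_fps sum_divide_distrib atLeast0AtMost
    by (intro sum.cong) (auto simp: binomial_fact field_simps)
  have "Abs_fps (\<lambda>i. (-1) ^ i * f i / fact i) * Abs_fps (\<lambda>i. 1 ^ i * g i / fact i) =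
    fps_exp (-1) * Abs_fps (\<lambda>p. (-1) ^ p * F p / fact p) * (fps_exp 1 * Abs_fps (\<lambda>p. 1 ^ p * G p / fact p))"
    by (simp only: egf[of f F, OF f] egf[of g G, OF g])
  also have "\<dots> = (fps_exp (-1) * fps_exp 1) * (Abs_fps (\<lambda>p. (-1) ^ p * F p / fact p) * Abs_fps (\<lambda>p. 1 ^ p * G p / fact p))"
    by (simp only: mult_ac)
  also have "fps_exp (-1) * fps_exp (1::real) = 1"
    by (simp flip: fps_exp_add_mult)
  finally have "Abs_fps (\<lambda>i. (-1) ^ i * f i / fact i) * Abs_fps (\<lambda>i. 1 ^ i * g i / fact i) =
     Abs_fps (\<lambda>p. (-1) ^ p * F p / fact p) * Abs_fps (\<lambda>p. 1 ^ p * G p / fact p)" by simp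
  from arg_cong[OF this, of "\<lambda>h. fps_nth h n"] show ?thesis unfolding conv by simp
qed

text \<open>The Chu-Vandermonde identity, shaped as a binomial transform in \<open>i\<close> to feed
  the preceding lemma. Pascal's rule splits the sum for \<open>Suc i\<close> into the sum for
  \<open>(a, k)\<close> and \<open>k\<close> times the sum for
  \<open>(a + 1, k - 1)\<close>.\<close>

lemma Gamma_Vandermonde:
  fixes a :: real
  assumes "a > -1"
  shows "Gamma (a + real i + real k + 1) / (Gamma (a + real k + 1) * Gamma (a + real i + 1)) =
    (\<Sum>p\<le>i. real (i choose p) * (fact p * real (k choose p) / Gamma (a + real p + 1)))"
  using assms
proof (induction i arbitrary: a k)
  case 0
  thus ?case using less_imp_neq[OF Gamma_real_pos[of "a + real k + 1"]] by simp
next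
  case (Suc i)
  have a: "a + real k + 1 > 0" "a + real i + 1 > 0" "a + real i + real k + 1 > 0" using Suc.prems by auto
  have IH2: "real k * (Gamma (a + real i + real k + 1) / (Gamma (a + real k + 1) * Gamma (a + real i + 2))) =
    (\<Sum>p\<le>i. real (i choose p) * (fact (Suc p) * real (k choose Suc p) / Gamma (a + real (Suc p) + 1)))"
  proof (cases k)
    case (Suc l)
    have "fact (Suc p) * real (k choose Suc p) = real k * (fact p * real (l choose p))" for p
    proof -
      have "real (Suc p) * real (Suc l choose Suc p) = real (Suc l) * real (l choose p)"
        using Suc_times_binomial[of p l] by (simp only: flip: of_nat_mult)
      thus ?thesis unfolding Suc fact_Suc by (simp only: mult.assoc mult.left_commute)
    qed
    thus ?thesis using Suc.IH[of "a + 1" l] Suc.prems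
      by (simp add: Suc sum_distrib_left add_ac mult_ac)
  qed auto
  have "(\<Sum>p\<le>Suc i. real (Suc i choose p) * (fact p * real (k choose p) / Gamma (a + real p + 1))) =
     (\<Sum>p\<le>i. real (i choose p) * (fact p * real (k choose p) / Gamma (a + real p + 1))) +
     (\<Sum>p\<le>i. real (i choose p) * (fact (Suc p) * real (k choose Suc p) / Gamma (a + real (Suc p) + 1)))"
  proof -
    have "(\<Sum>p\<le>i. real (i choose p) * (fact p * real (k choose p) / Gamma (a + real p + 1))) =
      (\<Sum>p\<le>Suc i. real (i choose p) * (fact p * real (k choose p) / Gamma (a + real p + 1)))"
      by (simp add: binomial_eq_0 del: binomial_Suc_n)
    thus ?thesis by (simp only: sum.atMost_Suc_shift binomial_Suc_Suc of_nat_add distrib_right sum.distrib) simp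
  qed
  also have "\<dots> = Gamma (a + real i + real k + 1) / (Gamma (a + real k + 1) * Gamma (a + real i + 1)) +
      real k * (Gamma (a + real i + real k + 1) / (Gamma (a + real k + 1) * Gamma (a + real i + 2)))"
    using Suc.IH[of a k] Suc.prems IH2 by simp
  also have "\<dots> = Gamma (a + real (Suc i) + real k + 1) / (Gamma (a + real k + 1) * Gamma (a + real (Suc i) + 1))"
  proof -
    define u v w where "u = Gamma (a + real i + real k + 1)" and "v = Gamma (a + real k + 1)" and "w = Gamma (a + real i + 1)"
    have nz: "v \<noteq> 0" "w \<noteq> 0" using Gamma_real_pos[OF a(1)] Gamma_real_pos[OF a(2)] by (auto simp: v_def w_def)
    have 1: "Gamma (a + real i + 2) = (a + real i + 1) * w" "Gamma (a + real (Suc i) + 1) = (a + real i + 1) * w"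
      using Gamma_plus1[of "a + real i + 1"] a nonpos_Ints_nonpos[of "a + real i + 1"] by (auto simp: w_def add_ac)
    have 2: "Gamma (a + real (Suc i) + real k + 1) = (a + real i + real k + 1) * u"
      using Gamma_plus1[of "a + real i + real k + 1"] a nonpos_Ints_nonpos[of "a + real i + real k + 1"] by (auto simp: u_def add_ac)
    show ?thesis unfolding 1 2 u_def[symmetric] v_def[symmetric] w_def[symmetric]
    proof -
      have "u / (v * w) + e * (u / (v * (d * w))) = (d + e) * u / (v * (d * w))" if "d \<noteq> 0" for d e :: real
        using nz that by (simp add: field_simps)
      from this[of "a + real i + 1" "real k"] a(2)
      show "u / (v * w) + real k * (u / (v * ((a + real i + 1) * w))) =
            (a + real i + real k + 1) * u / (v * ((a + real i + 1) * w))"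
        by (simp add: add_ac)
    qed
  qed
  finally show ?case by simp
qed

section \<open>A generalised binomial series\<close>

lemma cosh_real_ge: "1 + x\<^sup>2 / 2 \<le> cosh (x::real)"
proof -
  have "(\<lambda>n. if even n then x ^ n / fact n else 0) sums cosh x"
    using cosh_converges[of x] by (simp add: if_distrib divide_inverse mult_ac cong: if_cong)
  moreover have "(\<Sum>n\<in>{0,2::nat}. if even n then x ^ n / fact n else 0) \<le> (\<Sum>n. if even n then x ^ n / fact n else 0)"
    using calculation by (intro sum_le_suminf) (auto simp: sums_iff zero_le_even_power)
  ultimately show ?thesis by (simp add: sums_iff)
qed

lemma cos_real_ge: "1 - x\<^sup>2 / 2 \<le> cos (x::real)"
proof -
  have "cos x = 1 - 2 * (sin (x/2))\<^sup>2" using cos_double_sin[of "x/2"] by simp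
  moreover have "(sin (x/2))\<^sup>2 \<le> (x/2)\<^sup>2"
    using abs_sin_x_le_abs_x[of "x/2"] by (metis abs_le_square_iff)
  ultimately show ?thesis by (simp add: power_divide)
qed

text \<open>These are the coefficients \<open>(\<sigma> + 2i - 1 choose i)\<close> of \<open>B(z)\<^sup>\<sigma>\<^sup>-\<^sup>1 / (1 - 4z)\<^sup>1\<^sup>/\<^sup>2\<close>, where \<open>B = 1 + z B\<^sup>2\<close>.\<close>

definition gbin_coeff :: "real \<Rightarrow> nat \<Rightarrow> real" where
  "gbin_coeff \<sigma> i = Gamma (\<sigma> + 2 * real i) / (Gamma (\<sigma> + real i) * fact i)"

lemma gbin_coeff_pos: "\<sigma> > 0 \<Longrightarrow> gbin_coeff \<sigma> i > 0"
  by (simp add: gbin_coeff_def Gamma_real_pos add_pos_nonneg)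

text \<open>This compares the coefficients of \<open>r^n\<close> in \<open>\<Sum>i. gbin_coeff
  \<sigma> i * r^i * (1 + r)^(-\<sigma>-2i) = 1/(1 - r)\<close>. In Pochhammer form it is the n-th
  difference of a monic polynomial of degree \<open>n\<close> in \<open>i\<close>, hence a
  constant.\<close>

lemma gbin_coeff_sum:
  assumes "\<sigma> > 0"
  shows "(\<Sum>i\<le>n. gbin_coeff \<sigma> i * ((- \<sigma> - 2 * real i) gchoose (n - i))) = 1"
proof -
  have "gbin_coeff \<sigma> i * ((- \<sigma> - 2 * real i) gchoose (n - i)) =
     (-1) ^ n / fact n * ((-1) ^ i * real (n choose i) * pochhammer (\<sigma> + real i) n)" if "i \<le> n" for i
  proof -
    have pos: "\<sigma> + real i > 0" "\<sigma> + 2 * real i > 0" using assms by auto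
    have g: "Gamma (\<sigma> + 2 * real i) \<noteq> 0" "Gamma (\<sigma> + real i) \<noteq> 0" using Gamma_real_pos[OF pos(1)] Gamma_real_pos[OF pos(2)] by linarith+
    have np: "\<sigma> + real i \<notin> \<int>\<^sub>\<le>\<^sub>0" "\<sigma> + 2 * real i \<notin> \<int>\<^sub>\<le>\<^sub>0" using pos by (auto elim!: nonpos_Ints_cases)
    have 1: "pochhammer (\<sigma> + 2 * real i) (n - i) = Gamma (\<sigma> + real i + real n) / Gamma (\<sigma> + 2 * real i)"
      using pochhammer_Gamma[OF np(2), of "n - i"] that by (simp add: of_nat_diff algebra_simps)
    have 2: "pochhammer (\<sigma> + real i) n = Gamma (\<sigma> + real i + real n) / Gamma (\<sigma> + real i)"
      using pochhammer_Gamma[OF np(1), of n] by simp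
    have 3: "(- \<sigma> - 2 * real i) gchoose (n - i) = (-1) ^ (n - i) * pochhammer (\<sigma> + 2 * real i) (n - i) / fact (n - i)"
      by (simp add: gbinomial_pochhammer add.commute)
    have 4: "(-1) ^ (n - i) = ((-1) ^ n * (-1) ^ i :: real)"
      using that by (simp add: minus_one_power_iff)
    show ?thesis unfolding 1 2 3 4 gbin_coeff_def binomial_fact[OF that] using g by simp
  qed
  hence "(\<Sum>i\<le>n. gbin_coeff \<sigma> i * ((- \<sigma> - 2 * real i) gchoose (n - i))) =
     (-1) ^ n / fact n * (\<Sum>i\<le>n. (-1) ^ i * real (n choose i) * pochhammer (\<sigma> + real i) n)"
    unfolding sum_distrib_left by (intro sum.cong) auto
  also have "\<dots> = 1" unfolding alternating_binomial_pochhammer by (simp flip: power_mult_distrib)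
  finally show ?thesis .
qed

text \<open>The series \<open>Z ^ i\<close> starts at order \<open>i\<close>, so the composition can
  be truncated at \<open>i \<le> n\<close> before multiplying by \<open>G\<close>.\<close>

lemma fps_compose_mult_nth:
  fixes F Z G :: "'a::comm_ring_1 fps"
  assumes "fps_nth Z 0 = 0"
  shows "fps_nth ((F oo Z) * G) n = (\<Sum>i\<le>n. fps_nth F i * fps_nth (Z ^ i * G) n)"
proof -
  have "fps_nth (F oo Z) j = (\<Sum>i\<le>n. fps_nth F i * fps_nth (Z ^ i) j)" if "j \<le> n" for j
    unfolding fps_compose_nth using that startsby_zero_power_prefix[OF assms]
    by (intro sum.mono_neutral_left) auto
  hence "fps_nth ((F oo Z) * G) n = (\<Sum>j\<le>n. \<Sum>i\<le>n. fps_nth F i * fps_nth (Z ^ i) j * fps_nth G (n - j))"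
    unfolding fps_mult_nth atLeast0AtMost by (intro sum.cong) (auto simp: sum_distrib_right)
  also have "\<dots> = (\<Sum>i\<le>n. fps_nth F i * fps_nth (Z ^ i * G) n)"
    by (subst sum.swap) (simp add: fps_mult_nth atLeast0AtMost sum_distrib_left mult.assoc)
  finally show ?thesis .
qed

text \<open>The radius is exactly the supremum of \<open>r / (1 + r)^2\<close> over
  \<open>0 < r < 1\<close>, so every such \<open>r\<close> falls inside the disc of
  convergence.\<close>

lemma gbin_coeff_radius:
  assumes "\<sigma> > 0"
  shows "conv_radius (\<lambda>i. complex_of_real (gbin_coeff \<sigma> i)) = ereal (1/4)"
proof (rule conv_radius_ratio_limit_nonzero)
  have "(\<lambda>i. (\<sigma> + real i) * (real i + 1) / ((\<sigma> + 2 * real i) * (\<sigma> + 2 * real i + 1))) \<longlonglongrightarrow> 1/4"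
    by real_asymp
  moreover have "norm (complex_of_real (gbin_coeff \<sigma> i)) / norm (complex_of_real (gbin_coeff \<sigma> (Suc i))) =
     (\<sigma> + real i) * (real i + 1) / ((\<sigma> + 2 * real i) * (\<sigma> + 2 * real i + 1))" for i
  proof -
    have pos: "\<sigma> + real i > 0" "\<sigma> + 2 * real i > 0" "\<sigma> + 2 * real i + 1 > 0" using assms by auto
    have np: "\<sigma> + real i \<notin> \<int>\<^sub>\<le>\<^sub>0" "\<sigma> + 2 * real i \<notin> \<int>\<^sub>\<le>\<^sub>0" "\<sigma> + 2 * real i + 1 \<notin> \<int>\<^sub>\<le>\<^sub>0"
      using pos by (auto elim!: nonpos_Ints_cases)
    have g: "Gamma (\<sigma> + 2 * real i) \<noteq> 0" "Gamma (\<sigma> + real i) \<noteq> 0"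
      using Gamma_real_pos[OF pos(1)] Gamma_real_pos[OF pos(2)] by linarith+
    have "Gamma (\<sigma> + 2 * real (Suc i)) = (\<sigma> + 2 * real i + 1) * ((\<sigma> + 2 * real i) * Gamma (\<sigma> + 2 * real i))"
      using Gamma_plus1[OF np(3)] Gamma_plus1[OF np(2)] by (simp add: add_ac)
    moreover have "Gamma (\<sigma> + real (Suc i)) = (\<sigma> + real i) * Gamma (\<sigma> + real i)"
      using Gamma_plus1[OF np(1)] by (simp add: add_ac)
    moreover have n: "norm (complex_of_real (gbin_coeff \<sigma> i)) = gbin_coeff \<sigma> i" for i
      using gbin_coeff_pos[OF assms, of i] by (simp only: norm_of_real)
    ultimately show ?thesis unfolding n using g pos by (simp add: gbin_coeff_def divide_simps del: of_nat_Suc)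
  qed
  ultimately show "(\<lambda>i. norm (complex_of_real (gbin_coeff \<sigma> i)) / norm (complex_of_real (gbin_coeff \<sigma> (Suc i)))) \<longlonglongrightarrow> 1/4"
    by simp
qed auto

lemma of_real_gbinomial':
  "of_real (a gchoose n) = (of_real a gchoose n :: 'a::{real_div_algebra,field_char_0})"
  by (simp add: gbinomial_prod_rev)

text \<open>Formally, \<open>Z = X (1 + X)^(-2)\<close> and \<open>G = (1 + X)^(-\<sigma>)\<close>
  satisfy \<open>(F oo Z) * G = 1/(1 - X)\<close> by \<open>gbin_coeff_sum\<close>. Passing to
  functions costs the restriction to a neighbourhood of 0.\<close>

lemma gbin_eval_fps_near_0:
  assumes "\<sigma> > 0"
  defines "F \<equiv> Abs_fps (\<lambda>i. complex_of_real (gbin_coeff \<sigma> i))"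
  shows "eventually (\<lambda>z. eval_fps F (z * (1 + z) powr (-2)) * (1 + z) powr (- of_real \<sigma>) * (1 - z) = 1) (nhds 0)"
proof -
  define Z where "Z = fps_X * fps_binomial (-2::complex)"
  define G where "G = fps_binomial (- complex_of_real \<sigma>)"
  have FF: "eval_fps F has_fps_expansion F"
    using gbin_coeff_radius[OF assms(1)] by (simp add: has_fps_expansion_def fps_conv_radius_def F_def)
  have ZG: "fps_nth (Z ^ i * G) n = (if i \<le> n then of_real ((- \<sigma> - 2 * real i) gchoose (n - i)) else 0)" for i n
  proof -
    have "Z ^ i * G = fps_X ^ i * fps_binomial (of_nat i * (-2) + (- complex_of_real \<sigma>))"
      by (simp only: Z_def G_def power_mult_distrib fps_binomial_power fps_binomial_add_mult mult.assoc)
    moreover have "of_nat i * (-2) + (- complex_of_real \<sigma>) = of_real (- \<sigma> - 2 * real i)" by simp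
    ultimately show ?thesis by (simp only: fps_X_power_mult_nth fps_binomial_nth of_real_gbinomial') auto
  qed
  have "((F oo Z) * G) = Abs_fps (\<lambda>_. 1)"
  proof (rule fps_ext)
    fix n
    have "fps_nth ((F oo Z) * G) n = (\<Sum>i\<le>n. fps_nth F i * fps_nth (Z ^ i * G) n)"
      by (rule fps_compose_mult_nth) (simp add: Z_def)
    also have "\<dots> = of_real (\<Sum>i\<le>n. gbin_coeff \<sigma> i * ((- \<sigma> - 2 * real i) gchoose (n - i)))"
      unfolding ZG of_real_sum by (intro sum.cong) (auto simp: F_def)
    also have "\<dots> = 1" unfolding gbin_coeff_sum[OF assms(1)] by simp
    finally show "fps_nth ((F oo Z) * G) n = fps_nth (Abs_fps (\<lambda>_. 1)) n" by simp
  qed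
  hence one: "(F oo Z) * G * (1 - fps_X) = 1"
    by (auto simp: fps_eq_iff algebra_simps)
  have "(\<lambda>z. (eval_fps F \<circ> (\<lambda>z. z * (1 + z) powr (-2))) z * (1 + z) powr (- of_real \<sigma>) * (1 - z)) has_fps_expansion
     (F oo Z) * G * (1 - fps_X)"
    unfolding G_def
    by (intro has_fps_expansion_mult has_fps_expansion_compose FF has_fps_expansion_binomial_complex fps_expansion_intros)
       (auto simp: Z_def intro!: has_fps_expansion_mult has_fps_expansion_binomial_complex fps_expansion_intros)
  hence "eventually (\<lambda>z. eval_fps 1 z = (eval_fps F \<circ> (\<lambda>z. z * (1 + z) powr (-2))) z * (1 + z) powr (- of_real \<sigma>) * (1 - z)) (nhds 0)"
    unfolding one has_fps_expansion_def by blast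
  thus ?thesis by eventually_elim simp
qed

text \<open>The expansion in powers of \<open>r\<close> proves the identity for small \<open>r\<close> only. With \<open>r = exp (-w)\<close> both sides
  are holomorphic in the convex cone \<open>Re w > \<bar>Im w\<bar>\<close>, because there \<open>\<bar>cosh (w/2)\<bar> > 1\<close>.\<close>

lemma gbin_sums:
  assumes "\<sigma> > 0" "0 < r" "r < 1"
  shows "(\<lambda>i. gbin_coeff \<sigma> i * (r / (1 + r)\<^sup>2) ^ i) sums ((1 + r) powr \<sigma> / (1 - r))"
proof -
  define F where "F = Abs_fps (\<lambda>i. complex_of_real (gbin_coeff \<sigma> i))"
  define S where "S = {w. Re w > \<bar>Im w\<bar>}"
  define q where "q = (\<lambda>w::complex. exp (-w) / (1 + exp (-w))\<^sup>2)"
  define f where "f = (\<lambda>w. eval_fps F (q w) * (1 + exp (-w)) powr (- of_real \<sigma>) * (1 - exp (-w)) - 1)"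
  have rad: "fps_conv_radius F = ereal (1/4)"
    using gbin_coeff_radius[OF assms(1)] by (simp add: fps_conv_radius_def F_def)
  have S: "open S" "convex S"
  proof -
    have S': "S = {w. Re w > Im w} \<inter> {w. Re w > - Im w}" by (auto simp: S_def)
    show "open S" unfolding S' by (intro open_Int open_Collect_less continuous_intros)
    have "S = {w. inner (Complex (-1) 1) w < 0} \<inter> {w. inner (Complex (-1) (-1)) w < 0}"
      unfolding S' by (auto simp: inner_complex_def)
    thus "convex S" by (simp add: convex_Int convex_halfspace_lt)
  qed
  have Re1: "Re (1 + exp (-w)) > 0" if "w \<in> S" for w
  proof -
    have "norm (exp (-w)) < 1" using that by (auto simp: S_def)
    hence "\<bar>Re (exp (-w))\<bar> < 1" using abs_Re_le_cmod[of "exp (-w)"] by linarith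
    thus ?thesis by simp
  qed
  \<comment> \<open>Here \<open>q w = 1 / (4 cosh (w/2)^2)\<close>, and for
    \<open>w = a + ib\<close> one has \<open>4 |cosh (w/2)|^2 = 2 cosh a + 2 cos b\<close>. Since
    \<open>cosh a + cos b \<ge> 2 + (a^2 - b^2)/2\<close>, the cone \<open>|b| < a\<close> suffices.
    In the full disc of \<open>r = exp (-w)\<close> the bound would fail near
    \<open>r = -1\<close>.\<close>
  have qlt: "norm (q w) < 1/4" if "w \<in> S" for w
  proof -
    obtain a b where w: "w = Complex a b" by (cases w)
    have ab: "\<bar>b\<bar> < a" using that by (simp add: S_def w)
    have "2 < cosh a + cos b"
    proof -
      have "b\<^sup>2 < a\<^sup>2" using ab by (metis abs_less_iff abs_of_pos abs_ge_zero le_less_trans power2_abs power2_less_imp_less power_strict_mono zero_less_numeral pos2)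
      thus ?thesis using cosh_real_ge[of a] cos_real_ge[of b] by linarith
    qed
    hence "4 * exp (-a) < exp (-a) * (2 * cosh a + 2 * cos b)" by simp
    also have "\<dots> = (1 + exp (-a) * cos b)\<^sup>2 + (exp (-a) * sin b)\<^sup>2"
    proof -
      have "(1 + exp (-a) * cos b)\<^sup>2 + (exp (-a) * sin b)\<^sup>2 = 1 + 2 * exp (-a) * cos b + (exp (-a))\<^sup>2 * ((cos b)\<^sup>2 + (sin b)\<^sup>2)"
        by (simp only: power2_sum power_mult_distrib distrib_left) simp
      moreover have "exp (-a) * (2 * cosh a) = 1 + (exp (-a))\<^sup>2"
        by (simp add: cosh_def algebra_simps power2_eq_square flip: exp_add)
      ultimately show ?thesis by (simp add: algebra_simps)
    qed
    also have "\<dots> = (norm (1 + exp (-w)))\<^sup>2"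
      unfolding cmod_power2 by (simp add: w Re_exp Im_exp)
    finally have "4 * norm (exp (-w)) < (norm (1 + exp (-w)))\<^sup>2" by (simp add: w)
    moreover from this have "(norm (1 + exp (-w)))\<^sup>2 > 0" by (meson norm_ge_zero le_less_trans mult_nonneg_nonneg zero_le_numeral)
    ultimately show ?thesis by (simp add: q_def norm_divide norm_power divide_simps)
  qed
  have ne: "1 + exp (-w) \<noteq> 0" if "w \<in> S" for w
    using Re1[OF that] by (metis less_irrefl zero_complex.simps(1))
  have h1: "(\<lambda>w. eval_fps F (q w)) holomorphic_on S"
  proof -
    have "eval_fps F holomorphic_on ball 0 (1/4)"
    proof (rule holomorphic_on_eval_fps, rule subsetI)
      fix z :: complex assume "z \<in> ball 0 (1/4)"
      hence "norm z < 1/4" by simp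
      thus "z \<in> eball 0 (fps_conv_radius F)"
        unfolding rad eball_def mem_Collect_eq by (simp only: less_ereal.simps(1) dist_0_norm)
    qed
    moreover have "q holomorphic_on S"
      unfolding q_def using ne by (intro holomorphic_intros) auto
    moreover have "q ` S \<subseteq> ball 0 (1/4)" using qlt by auto
    ultimately show ?thesis
      using holomorphic_on_compose_gen[of q S "eval_fps F" "ball 0 (1/4)"] by (simp add: o_def)
  qed
  have h2: "(\<lambda>w. (1 + exp (-w)) powr (- of_real \<sigma>)) holomorphic_on S"
  proof (intro holomorphic_on_powr holomorphic_on_add holomorphic_on_const holomorphic_on_exp' holomorphic_on_minus holomorphic_on_ident)
    fix z assume "z \<in> S"
    show "1 + exp (- z) \<notin> \<real>\<^sub>\<le>\<^sub>0"
    proof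
      assume "1 + exp (- z) \<in> \<real>\<^sub>\<le>\<^sub>0"
      hence "Re (1 + exp (-z)) \<le> 0" by (simp only: complex_nonpos_Reals_iff)
      thus False using Re1[OF \<open>z \<in> S\<close>] by linarith
    qed
  qed
  have hol: "f holomorphic_on S"
    unfolding f_def by (intro holomorphic_on_diff holomorphic_on_mult h1 h2 holomorphic_on_const holomorphic_on_exp' holomorphic_on_minus holomorphic_on_ident)
  from gbin_eval_fps_near_0[OF assms(1)] obtain e where e: "e > 0" and
    near: "\<And>z. norm z < e \<Longrightarrow> eval_fps F (z * (1 + z) powr (-2)) * (1 + z) powr (- of_real \<sigma>) * (1 - z) = 1"
    by (auto simp: eventually_nhds_metric F_def)
  \<comment> \<open>The far end of the cone, where \<open>r\<close> is small enough for the local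
    identity; this open set supplies the limit point for analytic continuation.\<close>
  define U where "U = {w\<in>S. norm (exp (-w)) < e}"
  have U0: "f w = 0" if "w \<in> U" for w
  proof -
    have w: "w \<in> S" "norm (exp (-w)) < e" using that by (auto simp: U_def)
    have "1 + exp (-w) \<noteq> 0" using ne[OF w(1)] .
    hence "(1 + exp (-w)) powr (-2) = inverse ((1 + exp (-w))\<^sup>2)"
      by (simp add: powr_minus)
    thus ?thesis using near[OF w(2)] by (simp add: f_def q_def divide_inverse)
  qed
  have fz: "f w = 0" if "w \<in> S" for w
  proof -
    have oU: "open U"
    proof -
      have "open {w::complex. norm (exp (-w)) < e}" by (intro open_Collect_less continuous_intros)
      moreover have "U = S \<inter> {w. norm (exp (-w)) < e}" by (auto simp: U_def)
      ultimately show ?thesis using S(1) by auto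
    qed
    obtain x :: real where x: "x > 0" "exp (-x) < e"
    proof
      show "max 1 (1 - ln e) > 0" by simp
      have "exp (- max 1 (1 - ln e)) \<le> exp (ln e - 1)" by (subst exp_le_cancel_iff) linarith
      also have "\<dots> < exp (ln e)" by (subst exp_less_cancel_iff) linarith
      finally show "exp (- max 1 (1 - ln e)) < e" using e by simp
    qed
    have "of_real x \<in> U" using x by (auto simp: U_def S_def)
    hence "of_real x islimpt U" using oU interior_limit_point interior_open by blast
    thus ?thesis using analytic_continuation[OF hol S(1) convex_connected[OF S(2)], of U "of_real x" w] U0 that \<open>of_real x \<in> U\<close>
      by (auto simp: U_def)
  qed
  define t where "t = - ln r"
  have t: "t > 0" "exp (-t) = r" using assms by (auto simp: t_def ln_less_zero)
  define z where "z = r / (1 + r)\<^sup>2"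
  have tS: "of_real t \<in> S" using t by (simp add: S_def)
  have er: "exp (- complex_of_real t) = of_real r" using t(2) exp_of_real[of "-t", where ?'a=complex] by simp
  have qz: "q (of_real t) = of_real z"
    unfolding q_def z_def er by simp
  have "norm (complex_of_real z) < 1/4" using qlt[OF tS] by (simp add: qz)
  hence sm: "(\<lambda>i. fps_nth F i * of_real z ^ i) sums eval_fps F (of_real z)"
    by (intro sums_eval_fps) (simp only: rad less_ereal.simps(1))
  have "(1 + complex_of_real r) powr (- of_real \<sigma>) = of_real ((1 + r) powr (- \<sigma>))"
    using assms powr_of_real[of "1 + r" "- \<sigma>"] by simp
  hence "eval_fps F (of_real z) * of_real ((1 + r) powr (- \<sigma>) * (1 - r)) = 1"
    using fz[OF tS] by (simp add: f_def qz er mult.assoc)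
  hence "eval_fps F (of_real z) = inverse (of_real ((1 + r) powr (- \<sigma>) * (1 - r)))"
    by (simp only: inverse_unique mult.commute)
  also have "\<dots> = of_real ((1 + r) powr \<sigma> / (1 - r))"
    unfolding powr_minus by (simp add: divide_inverse)
  finally have "(\<lambda>i. complex_of_real (gbin_coeff \<sigma> i * z ^ i)) sums of_real ((1 + r) powr \<sigma> / (1 - r))"
    using sm by (simp add: F_def)
  thus ?thesis unfolding sums_of_real_iff z_def .
qed

section \<open>Jacobi polynomials\<close>

text \<open>The substitution \<open>y = (1 - cos \<theta>)/2 = sin^2 (\<theta>/2)\<close> turns the
  measure into \<open>y^\<alpha> (1 - y)^\<beta> dy\<close> on (0, 1), with no power of 2 left
  over.\<close>

lemma jacobi_measure_moment:
  assumes ab: "\<alpha> > -1" "\<beta> > -1"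
  shows "has_bochner_integral (jacobi_measure \<alpha> \<beta>)
    (\<lambda>\<theta>. ((1 - cos \<theta>)/2) ^ k * (1 - (1 - cos \<theta>)/2) ^ l) (Beta (\<alpha> + real k + 1) (\<beta> + real l + 1))"
proof -
  define g where "g = (\<lambda>\<theta>::real. (1 - cos \<theta>) / 2)"
  define f where "f = (\<lambda>y::real. y powr (\<alpha> + real k) * (1 - y) powr (\<beta> + real l))"
  define w where "w = (\<lambda>\<theta>. sin (\<theta>/2) powr (2 * \<alpha> + 1) * cos (\<theta>/2) powr (2 * \<beta> + 1))"
  have half: "g \<theta> = (sin (\<theta>/2))\<^sup>2" "1 - g \<theta> = (cos (\<theta>/2))\<^sup>2" "sin \<theta> / 2 = sin (\<theta>/2) * cos (\<theta>/2)" for \<theta>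
    using cos_double_sin[of "\<theta>/2"] cos_double_cos[of "\<theta>/2"] sin_double[of "\<theta>/2"] by (simp_all add: g_def field_simps)
  have M: "(\<integral>\<^sup>+\<theta>. ennreal (g \<theta> ^ k * (1 - g \<theta>) ^ l) \<partial>jacobi_measure \<alpha> \<beta>) = ennreal (Beta (\<alpha> + real k + 1) (\<beta> + real l + 1))"
  proof -
    have "(\<integral>\<^sup>+\<theta>. ennreal (g \<theta> ^ k * (1 - g \<theta>) ^ l) \<partial>jacobi_measure \<alpha> \<beta>) =
       (\<integral>\<^sup>+\<theta>. ennreal (w \<theta>) * ennreal (g \<theta> ^ k * (1 - g \<theta>) ^ l) \<partial>restrict_space lborel {0<..<pi})"
      unfolding jacobi_measure_def w_def
      by (rule nn_integral_density) (auto simp: g_def intro!: measurable_restrict_space1)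
    also have "\<dots> = (\<integral>\<^sup>+\<theta>. ennreal (w \<theta>) * ennreal (g \<theta> ^ k * (1 - g \<theta>) ^ l) * indicator {0<..<pi} \<theta> \<partial>lborel)"
      by (rule nn_integral_restrict_space) simp
    also have "\<dots> = (\<integral>\<^sup>+\<theta>. ennreal (f (g \<theta>) * (sin \<theta> / 2) * indicator {0..pi} \<theta>) \<partial>lborel)"
    proof (rule nn_integral_cong)
      fix \<theta> :: real
      show "ennreal (w \<theta>) * ennreal (g \<theta> ^ k * (1 - g \<theta>) ^ l) * indicator {0<..<pi} \<theta> = ennreal (f (g \<theta>) * (sin \<theta> / 2) * indicator {0..pi} \<theta>)"
      proof (cases "\<theta> \<in> {0<..<pi}")
        case True
        have p: "sin (\<theta>/2) > 0" "cos (\<theta>/2) > 0" using True by (auto intro!: sin_gt_zero cos_gt_zero)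
        have q: "x powr (2 * a + 1) * (x\<^sup>2) ^ m = (x\<^sup>2) powr (a + real m) * x" if "x > 0" for x a :: real and m
        proof -
          have "(x\<^sup>2) powr (a + real m) = x powr (2 * a + 2 * real m)"
            using that powr_powr[of x 2 "a + real m"] by (simp add: algebra_simps)
          moreover have "(x\<^sup>2) ^ m = x powr (2 * real m)" using that powr_realpow[of x "2*m"] by (simp add: power_mult)
          moreover have "x = x powr 1" using that by simp
          ultimately show ?thesis by (metis (no_types, opaque_lifting) powr_add add.assoc add.commute)
        qed
        have "w \<theta> * (g \<theta> ^ k * (1 - g \<theta>) ^ l) =
          (sin (\<theta>/2) powr (2 * \<alpha> + 1) * ((sin (\<theta>/2))\<^sup>2) ^ k) * (cos (\<theta>/2) powr (2 * \<beta> + 1) * ((cos (\<theta>/2))\<^sup>2) ^ l)"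
          unfolding w_def half(2) unfolding half(1) by (simp only: mult_ac)
        also have "\<dots> = f (g \<theta>) * (sin \<theta> / 2)"
          unfolding q[OF p(1)] q[OF p(2)] f_def half(2) unfolding half(1,3) by (simp only: mult_ac)
        finally have eq: "w \<theta> * (g \<theta> ^ k * (1 - g \<theta>) ^ l) = f (g \<theta>) * (sin \<theta> / 2)" .
        have m: "ennreal (w \<theta>) * ennreal (g \<theta> ^ k * (1 - g \<theta>) ^ l) = ennreal (w \<theta> * (g \<theta> ^ k * (1 - g \<theta>) ^ l))"
          by (rule ennreal_mult'[symmetric]) (simp add: w_def)
        show ?thesis unfolding m eq using True by simp
      next
        case False
        hence "\<theta> = 0 \<or> \<theta> = pi \<or> \<theta> \<notin> {0..pi}" by force
        thus ?thesis using False by auto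
      qed
    qed
    also have "\<dots> = (\<integral>\<^sup>+y. ennreal (f y * indicator {g 0..g pi} y) \<partial>lborel)"
    proof (rule nn_integral_substitution[symmetric])
      show "set_borel_measurable borel {g 0..g pi} f" by (simp add: set_borel_measurable_def f_def)
      show "(g has_real_derivative sin x / 2) (at x)" for x
        unfolding g_def by (auto intro!: derivative_eq_intros)
      show "continuous_on {0..pi} (\<lambda>x. sin x / 2)" by (intro continuous_intros) auto
    qed (auto simp: sin_ge_zero)
    also have "\<dots> = (\<integral>\<^sup>+y. ennreal (f y) * indicator {0..1} y \<partial>lborel)"
      by (intro nn_integral_cong) (auto simp: g_def indicator_def)
    also have "\<dots> = ennreal (Beta (\<alpha> + real k + 1) (\<beta> + real l + 1))"
    proof (rule nn_integral_has_integral_lebesgue')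
      show "(f has_integral Beta (\<alpha> + real k + 1) (\<beta> + real l + 1)) {0..1}"
        using has_integral_Beta_real[of "\<alpha> + real k + 1" "\<beta> + real l + 1"] ab by (simp add: f_def)
    qed (simp add: f_def)
    finally show ?thesis .
  qed
  have "has_bochner_integral (jacobi_measure \<alpha> \<beta>) (\<lambda>\<theta>. g \<theta> ^ k * (1 - g \<theta>) ^ l) (Beta (\<alpha> + real k + 1) (\<beta> + real l + 1))"
  proof (rule has_bochner_integral_nn_integral)
    show "(\<lambda>\<theta>. g \<theta> ^ k * (1 - g \<theta>) ^ l) \<in> borel_measurable (jacobi_measure \<alpha> \<beta>)"
      by (simp add: jacobi_measure_def g_def measurable_restrict_space1)
    show "AE \<theta> in jacobi_measure \<alpha> \<beta>. 0 \<le> g \<theta> ^ k * (1 - g \<theta>) ^ l" unfolding half(2) unfolding half(1) by simp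
    show "0 \<le> Beta (\<alpha> + real k + 1) (\<beta> + real l + 1)" using ab by (auto simp: Beta_def intro!: divide_nonneg_nonneg mult_nonneg_nonneg Gamma_real_nonneg)
  qed (rule M)
  thus ?thesis by (simp only: g_def)
qed

text \<open>A polynomial in \<open>y = (1 - x)/2\<close> rather than in \<open>x\<close>, so that
  every summand integrates to a Beta value; the sign comes from
  \<open>(x - 1)/2 = -y\<close>.\<close>

definition jacobi_poly :: "real \<Rightarrow> real \<Rightarrow> nat \<Rightarrow> real poly" where
  "jacobi_poly \<alpha> \<beta> n = (\<Sum>k\<le>n. smult (((real n + \<alpha>) gchoose (n - k)) * ((real n + \<beta>) gchoose k) * (-1) ^ k)
     ([:0, 1:] ^ k * [:1, -1:] ^ (n - k)))"

lemma jacobi_P_eq_poly: "jacobi_P \<alpha> \<beta> n x = poly (jacobi_poly \<alpha> \<beta> n) ((1 - x) / 2)"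
proof -
  have neg: "((x - 1) / 2) ^ k = (-1) ^ k * ((1 - x) / 2) ^ k" for k
    by (simp flip: power_mult_distrib)
  have p: "poly [:0, 1:] ((1 - x) / 2) = (1 - x) / 2" "poly [:1, -1:] ((1 - x) / 2) = (x + 1) / 2"
    by (simp_all add: field_simps)
  show ?thesis
    by (simp only: jacobi_P_def jacobi_poly_def poly_sum poly_smult poly_mult poly_power p neg mult_ac)
qed

lemma degree_jacobi_poly_le: "degree (jacobi_poly \<alpha> \<beta> n) \<le> n"
  unfolding jacobi_poly_def
proof (intro degree_sum_le)
  fix k assume "k \<in> {..n}"
  have "degree ([:0, 1::real:] ^ k * [:1, -1:] ^ (n - k)) \<le> degree ([:0, 1::real:] ^ k) + degree ([:1, -1::real:] ^ (n - k))"
    by (rule degree_mult_le)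
  also have "\<dots> = n" using \<open>k \<in> {..n}\<close> by (simp add: degree_power_eq)
  finally show "degree (smult (((real n + \<alpha>) gchoose (n - k)) * ((real n + \<beta>) gchoose k) * (-1) ^ k)
     ([:0, 1:] ^ k * [:1, -1:] ^ (n - k))) \<le> n" using degree_smult_le order_trans by blast
qed auto

text \<open>Every summand has leading sign \<open>(-1) ^ n\<close>, so nothing cancels and
  Vandermonde's convolution adds up the binomials.\<close>

lemma coeff_jacobi_poly: "coeff (jacobi_poly \<alpha> \<beta> n) n = (-1) ^ n * ((2 * real n + \<alpha> + \<beta>) gchoose n)"
proof -
  have "coeff ([:0, 1::real:] ^ k * [:1, -1:] ^ (n - k)) n = (-1) ^ (n - k)" if "k \<le> n" for k
  proof -
    have "degree ([:0, 1::real:] ^ k * [:1, -1:] ^ (n - k)) = n" using that by (simp add: degree_mult_eq degree_power_eq)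
    moreover have "lead_coeff ([:0, 1::real:] ^ k * [:1, -1:] ^ (n - k)) = (-1) ^ (n - k)"
      by (simp add: lead_coeff_mult lead_coeff_power)
    ultimately show ?thesis by simp
  qed
  hence "coeff (jacobi_poly \<alpha> \<beta> n) n = (\<Sum>k\<le>n. ((real n + \<alpha>) gchoose (n - k)) * ((real n + \<beta>) gchoose k) * ((-1) ^ k * (-1) ^ (n - k)))"
    unfolding jacobi_poly_def coeff_sum by (intro sum.cong) (auto simp: mult_ac)
  also have "\<dots> = (\<Sum>k\<le>n. (-1) ^ n * (((real n + \<beta>) gchoose k) * ((real n + \<alpha>) gchoose (n - k))))"
    by (intro sum.cong refl) (auto simp flip: power_add)
  also have "\<dots> = (-1) ^ n * ((2 * real n + \<alpha> + \<beta>) gchoose n)"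
    unfolding sum_distrib_left[symmetric] atLeast0AtMost[symmetric] gbinomial_Vandermonde by (simp add: algebra_simps)
  finally show ?thesis .
qed

text \<open>For \<open>n > 0\<close> the smallest factor of the falling product is
  \<open>n + 1 + \<alpha> + \<beta>\<close>, which exceeds \<open>n - 1\<close>.\<close>

lemma coeff_jacobi_poly_pos:
  assumes "\<alpha> > -1" "\<beta> > -1"
  shows "(2 * real n + \<alpha> + \<beta>) gchoose n > 0"
  unfolding gbinomial_prod_rev using assms
  by (intro divide_pos_pos prod_pos) auto

section \<open>Orthogonality and expansion in Jacobi polynomials\<close>

locale jacobi_params =
  fixes \<alpha> \<beta> :: real
  assumes \<alpha>: "\<alpha> > -1" and \<beta>: "\<beta> > -1"
begin

definition L :: "real poly \<Rightarrow> real" where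
  "L p = (LINT \<theta>|jacobi_measure \<alpha> \<beta>. poly p ((1 - cos \<theta>) / 2))"

lemma integrable_poly: "integrable (jacobi_measure \<alpha> \<beta>) (\<lambda>\<theta>. poly p ((1 - cos \<theta>) / 2))"
proof -
  have "integrable (jacobi_measure \<alpha> \<beta>) (\<lambda>\<theta>. \<Sum>i\<le>degree p. coeff p i * ((1 - cos \<theta>) / 2) ^ i)"
    using jacobi_measure_moment[OF \<alpha> \<beta>, of _ 0]
    by (intro Bochner_Integration.integrable_sum integrable_mult_right) (auto simp: has_bochner_integral_iff)
  thus ?thesis by (simp add: poly_altdef)
qed

lemma L_add: "L (p + q) = L p + L q"
  unfolding L_def by (simp add: integrable_poly)

lemma L_smult: "L (smult c p) = c * L p"
  unfolding L_def by simp

lemma L_0 [simp]: "L 0 = 0" by (simp add: L_def)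

lemma L_diff: "L (p - q) = L p - L q"
  unfolding L_def by (simp add: integrable_poly)

lemma L_sum: "L (\<Sum>i\<in>A. f i) = (\<Sum>i\<in>A. L (f i))"
  by (induction A rule: infinite_finite_induct) (auto simp: L_add)

lemma L_monom: "L ([:0, 1:] ^ k * [:1, -1:] ^ l) = Beta (\<alpha> + real k + 1) (\<beta> + real l + 1)"
  using jacobi_measure_moment[OF \<alpha> \<beta>, of k l]
  by (simp add: L_def has_bochner_integral_iff)

abbreviation ga :: "nat \<Rightarrow> real" where "ga k \<equiv> Gamma (\<alpha> + real k + 1)"
abbreviation gb :: "nat \<Rightarrow> real" where "gb k \<equiv> Gamma (\<beta> + real k + 1)"
abbreviation s :: real where "s \<equiv> \<alpha> + \<beta> + 2"

lemma ga_pos: "ga k > 0" using \<alpha> by (intro Gamma_real_pos) auto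
lemma gb_pos: "gb k > 0" using \<beta> by (intro Gamma_real_pos) auto
lemma ga_nz [simp]: "ga k \<noteq> 0" and gb_nz [simp]: "gb k \<noteq> 0" using ga_pos[of k] gb_pos[of k] by linarith+
lemma gs_pos: "Gamma (s + real k) > 0" using \<alpha> \<beta> by (intro Gamma_real_pos) auto

lemma gbinomial_Gamma_shift:
  assumes "a > -1" "k \<le> n"
  shows "((real n + a) gchoose (n - k)) = Gamma (a + real n + 1) / (Gamma (a + real k + 1) * fact (n - k))"
proof -
  have "a + real k + 1 > 0" using assms by auto
  have "((real n + a) gchoose (n - k)) = pochhammer (a + real k + 1) (n - k) / fact (n - k)"
    unfolding gbinomial_pochhammer' using assms by (simp add: of_nat_diff algebra_simps)
  also have "pochhammer (a + real k + 1) (n - k) = Gamma (a + real n + 1) / Gamma (a + real k + 1)"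
    using pochhammer_Gamma_real[OF \<open>a + real k + 1 > 0\<close>, of "n - k"] assms by (simp add: of_nat_diff algebra_simps)
  finally show ?thesis by simp
qed

lemma jacobi_coeff:
  assumes "i \<le> n"
  shows "((real n + \<alpha>) gchoose (n - i)) * ((real n + \<beta>) gchoose i) =
     ga n * gb n / (ga i * gb (n - i) * fact i * fact (n - i))"
  using gbinomial_Gamma_shift[OF \<alpha> assms] gbinomial_Gamma_shift[OF \<beta>, of "n - i" n] assms by simp

text \<open>Expanding the Jacobi polynomial gives an alternating sum of Beta values over
  \<open>i\<close>. The binomial convolution trades it for a sum over \<open>p\<close> with factors
  \<open>k choose p\<close> and \<open>l choose (n - p)\<close>, from which both the vanishing and
  the values can be read.\<close>

lemma L_monom_jacobi:
  "L ([:0, 1:] ^ k * [:1, -1:] ^ l * jacobi_poly \<alpha> \<beta> n) =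
     ga n * gb n * ga k * gb l / Gamma (s + real (k + l + n)) *
     (\<Sum>p\<le>n. (-1) ^ p * real (k choose p) * real (l choose (n - p)) / (ga p * gb (n - p)))"
proof -
  have "L ([:0, 1:] ^ k * [:1, -1:] ^ l * jacobi_poly \<alpha> \<beta> n) =
    (\<Sum>i\<le>n. ((real n + \<alpha>) gchoose (n - i)) * ((real n + \<beta>) gchoose i) * (-1) ^ i *
       L ([:0, 1:] ^ (k + i) * [:1, -1:] ^ (l + (n - i))))"
    unfolding jacobi_poly_def sum_distrib_left L_sum mult_smult_right L_smult
    by (intro sum.cong refl) (simp only: power_add mult_ac)
  also have "\<dots> = (\<Sum>i\<le>n. ga n * gb n * ga k * gb l / (fact n * Gamma (s + real (k + l + n))) *
     ((-1) ^ i * real (n choose i) * (Gamma (\<alpha> + real i + real k + 1) / (ga k * ga i)) *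
       (Gamma (\<beta> + real (n - i) + real l + 1) / (gb l * gb (n - i)))))"
  proof (intro sum.cong refl)
    fix i assume "i \<in> {..n}"
    hence i: "i \<le> n" by simp
    have e: "\<alpha> + real i + real k + 1 + (\<beta> + real (n - i) + real l + 1) = s + real (k + l + n)"
      using i by (simp add: of_nat_diff)
    have f: "\<alpha> + real (k + i) + 1 = \<alpha> + real i + real k + 1" "\<beta> + real (l + (n - i)) + 1 = \<beta> + real (n - i) + real l + 1" by simp_all
    show "((real n + \<alpha>) gchoose (n - i)) * ((real n + \<beta>) gchoose i) * (-1) ^ i *
       L ([:0, 1:] ^ (k + i) * [:1, -1:] ^ (l + (n - i))) =
      ga n * gb n * ga k * gb l / (fact n * Gamma (s + real (k + l + n))) *
     ((-1) ^ i * real (n choose i) * (Gamma (\<alpha> + real i + real k + 1) / (ga k * ga i)) *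
       (Gamma (\<beta> + real (n - i) + real l + 1) / (gb l * gb (n - i))))"
      unfolding L_monom jacobi_coeff[OF i] Beta_def f e binomial_fact[OF i] by (simp add: mult_ac)
  qed
  also have "\<dots> = ga n * gb n * ga k * gb l / (fact n * Gamma (s + real (k + l + n))) *
     (\<Sum>i\<le>n. (-1) ^ i * real (n choose i) * (Gamma (\<alpha> + real i + real k + 1) / (ga k * ga i)) *
       (Gamma (\<beta> + real (n - i) + real l + 1) / (gb l * gb (n - i))))"
    by (simp only: sum_distrib_left)
  also have "(\<Sum>i\<le>n. (-1) ^ i * real (n choose i) * (Gamma (\<alpha> + real i + real k + 1) / (ga k * ga i)) *
       (Gamma (\<beta> + real (n - i) + real l + 1) / (gb l * gb (n - i)))) =
     (\<Sum>p\<le>n. (-1) ^ p * real (n choose p) * (fact p * real (k choose p) / ga p) *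
       (fact (n - p) * real (l choose (n - p)) / gb (n - p)))"
    by (rule alternating_binomial_convolution[where f = "\<lambda>i. Gamma (\<alpha> + real i + real k + 1) / (ga k * ga i)"
        and g = "\<lambda>i. Gamma (\<beta> + real i + real l + 1) / (gb l * gb i)"
        and F = "\<lambda>p. fact p * real (k choose p) / ga p" and G = "\<lambda>p. fact p * real (l choose p) / gb p"])
       (use Gamma_Vandermonde \<alpha> \<beta> in auto)
  also have "\<dots> = (\<Sum>p\<le>n. fact n * ((-1) ^ p * real (k choose p) * real (l choose (n - p)) / (ga p * gb (n - p))))"
    by (intro sum.cong refl) (simp add: binomial_fact)
  also have "\<dots> = fact n * (\<Sum>p\<le>n. (-1) ^ p * real (k choose p) * real (l choose (n - p)) / (ga p * gb (n - p)))"
    by (simp only: sum_distrib_left)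
  finally show ?thesis by simp
qed

text \<open>For \<open>l = 0\<close> the factor \<open>0 choose (n - p)\<close> leaves only
  \<open>p = n\<close>, and then \<open>k choose n\<close> kills all monomials of degree below
  \<open>n\<close>.\<close>

lemma L_degree_le:
  assumes "degree q \<le> n"
  shows "L (q * jacobi_poly \<alpha> \<beta> n) = coeff q n * ((-1) ^ n * ga n * gb n / Gamma (s + 2 * real n))"
proof -
  have mon: "L ([:0, 1:] ^ k * jacobi_poly \<alpha> \<beta> n) = (if k = n then (-1) ^ n * ga n * gb n / Gamma (s + 2 * real n) else 0)"
    if "k \<le> n" for k
  proof -
    have "(\<Sum>p\<le>n. (-1) ^ p * real (k choose p) * real (0 choose (n - p)) / (ga p * gb (n - p))) =
      (\<Sum>p\<le>n. if p = n then (-1) ^ n * real (k choose n) / (ga n * gb 0) else 0)"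
      by (intro sum.cong refl) auto
    also have "\<dots> = (if k = n then (-1) ^ n / (ga n * gb 0) else 0)"
      using that by (simp add: binomial_eq_0)
    finally have S: "(\<Sum>p\<le>n. (-1) ^ p * real (k choose p) * real (0 choose (n - p)) / (ga p * gb (n - p))) =
       (if k = n then (-1) ^ n / (ga n * gb 0) else 0)" .
    show ?thesis
      using L_monom_jacobi[of k 0 n] gb_nz[of 0] ga_nz[of n] unfolding S by (simp add: mult_ac)
  qed
  have "q = (\<Sum>i\<le>n. smult (coeff q i) ([:0, 1:] ^ i))"
    using poly_as_sum_of_monoms'[OF assms] by (simp add: monom_altdef)
  hence "L (q * jacobi_poly \<alpha> \<beta> n) = L ((\<Sum>i\<le>n. smult (coeff q i) ([:0, 1:] ^ i)) * jacobi_poly \<alpha> \<beta> n)"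
    by simp
  also have "\<dots> = (\<Sum>i\<le>n. coeff q i * L ([:0, 1:] ^ i * jacobi_poly \<alpha> \<beta> n))"
    by (simp add: sum_distrib_right L_sum L_smult)
  also have "\<dots> = (\<Sum>i\<le>n. if i = n then coeff q n * ((-1) ^ n * ga n * gb n / Gamma (s + 2 * real n)) else 0)"
    by (intro sum.cong refl) (simp add: mon)
  finally show ?thesis by simp
qed

definition h :: "nat \<Rightarrow> real" where "h n = L (jacobi_poly \<alpha> \<beta> n * jacobi_poly \<alpha> \<beta> n)"

text \<open>The leading coefficient of the polynomial and its pairing with the n-th power both have
  sign \<open>(-1) ^ n\<close>.\<close>

lemma h_pos: "h n > 0"
proof -
  have "h n = (((-1) ^ n * (-1) ^ n) * ((2 * real n + \<alpha> + \<beta>) gchoose n)) * (ga n * gb n / Gamma (s + 2 * real n))"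
    unfolding h_def L_degree_le[OF degree_jacobi_poly_le] coeff_jacobi_poly by simp
  also have "(-1) ^ n * (-1) ^ n = (1::real)" by (simp flip: power_mult_distrib)
  finally show ?thesis
    using coeff_jacobi_poly_pos[OF \<alpha> \<beta>, of n] ga_pos[of n] gb_pos[of n] gs_pos[of "2*n"] by simp
qed

lemma L_orthogonal: "m \<noteq> n \<Longrightarrow> L (jacobi_poly \<alpha> \<beta> m * jacobi_poly \<alpha> \<beta> n) = 0"
proof (induction m n rule: linorder_wlog)
  case (le m n)
  hence "degree (jacobi_poly \<alpha> \<beta> m) < n" using degree_jacobi_poly_le[of \<alpha> \<beta> m] by linarith
  thus ?case using L_degree_le[of "jacobi_poly \<alpha> \<beta> m" n] by (simp add: coeff_eq_0)
qed (simp add: mult.commute)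

text \<open>The remainder \<open>d\<close> pairs to 0 with every Jacobi polynomial up to
  \<open>N\<close>. Pairing with the one whose index is the degree of \<open>d\<close> returns a
  nonzero multiple of the leading coefficient, so \<open>d = 0\<close>.\<close>

lemma jacobi_expansion:
  assumes "degree q \<le> N"
  shows "q = (\<Sum>n\<le>N. smult (L (q * jacobi_poly \<alpha> \<beta> n) / h n) (jacobi_poly \<alpha> \<beta> n))"
proof -
  define d where "d = q - (\<Sum>n\<le>N. smult (L (q * jacobi_poly \<alpha> \<beta> n) / h n) (jacobi_poly \<alpha> \<beta> n))"
  have deg: "degree d \<le> N"
    unfolding d_def using degree_jacobi_poly_le[of \<alpha> \<beta>]
    by (intro degree_diff_le assms degree_sum_le) (auto intro: order_trans)
  have "L (d * jacobi_poly \<alpha> \<beta> m) = 0" if "m \<le> N" for m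
  proof -
    have "L (d * jacobi_poly \<alpha> \<beta> m) = L (q * jacobi_poly \<alpha> \<beta> m) -
      (\<Sum>n\<le>N. L (q * jacobi_poly \<alpha> \<beta> n) / h n * L (jacobi_poly \<alpha> \<beta> n * jacobi_poly \<alpha> \<beta> m))"
      by (simp add: d_def left_diff_distrib L_diff sum_distrib_right L_sum L_smult)
    also have "(\<Sum>n\<le>N. L (q * jacobi_poly \<alpha> \<beta> n) / h n * L (jacobi_poly \<alpha> \<beta> n * jacobi_poly \<alpha> \<beta> m)) =
      (\<Sum>n\<le>N. if n = m then L (q * jacobi_poly \<alpha> \<beta> m) else 0)"
    proof (intro sum.cong refl)
      fix n
      show "L (q * jacobi_poly \<alpha> \<beta> n) / h n * L (jacobi_poly \<alpha> \<beta> n * jacobi_poly \<alpha> \<beta> m) = (if n = m then L (q * jacobi_poly \<alpha> \<beta> m) else 0)"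
        using h_pos[of m] by (cases "n = m") (auto simp: L_orthogonal h_def)
    qed
    finally show ?thesis using that by simp
  qed
  from this[OF deg] have "lead_coeff d * ((-1) ^ degree d * ga (degree d) * gb (degree d) / Gamma (s + 2 * real (degree d))) = 0"
    by (simp add: L_degree_le)
  hence "d = 0"
    using gs_pos[of "2 * degree d"] by auto
  thus ?thesis by (simp add: d_def)
qed

text \<open>Up to normalisation this is Bateman's polynomial \<open>(x + y)\<^sup>N P\<^sub>N((1 + x y) / (x + y))\<close> at \<open>x = 1 - 2X\<close>,
  \<open>y = 1 - 2Y\<close>.\<close>

definition bivar :: "nat \<Rightarrow> real \<Rightarrow> real \<Rightarrow> real" where
  "bivar N X Y = (\<Sum>k\<le>N. (X * Y) ^ k * ((1 - X) * (1 - Y)) ^ (N - k) /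
     (ga k * fact k * gb (N - k) * fact (N - k)))"

end

text \<open>Apply \<open>x^p y^q / (p! q!)\<close> times the p-th derivative in \<open>x\<close> and
  the q-th in \<open>y\<close> to \<open>(x + y)^N / N!\<close>.\<close>

lemma binomial_weighted_sum:
  fixes x y :: real
  assumes "p + q \<le> N"
  shows "(\<Sum>k\<le>N. real (k choose p) * real ((N - k) choose q) / (fact k * fact (N - k)) * x ^ k * y ^ (N - k)) =
    x ^ p * y ^ q * (x + y) ^ (N - p - q) / (fact p * fact q * fact (N - p - q))"
proof -
  define m where "m = N - p - q"
  have N: "N = p + q + m" using assms by (simp add: m_def)
  have "(\<Sum>k\<le>N. real (k choose p) * real ((N - k) choose q) / (fact k * fact (N - k)) * x ^ k * y ^ (N - k)) =
    (\<Sum>k\<in>{p..p+m}. real (k choose p) * real ((N - k) choose q) / (fact k * fact (N - k)) * x ^ k * y ^ (N - k))"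
    by (rule sum.mono_neutral_right) (auto simp: N binomial_eq_0_iff not_le)
  also have "\<dots> = (\<Sum>j\<le>m. x ^ p * y ^ q / (fact p * fact q * fact m) * (real (m choose j) * x ^ j * y ^ (m - j)))"
  proof (rule sum.reindex_bij_witness[of _ "\<lambda>j. j + p" "\<lambda>k. k - p"])
    fix k assume k: "k \<in> {p..p+m}"
    then obtain j where j: "k = p + j" "j \<le> m" by (auto simp: le_iff_add)
    hence Nk: "N - k = q + (m - j)" by (simp add: N)
    show "x ^ p * y ^ q / (fact p * fact q * fact m) * (real (m choose (k - p)) * x ^ (k - p) * y ^ (m - (k - p))) =
       real (k choose p) * real ((N - k) choose q) / (fact k * fact (N - k)) * x ^ k * y ^ (N - k)"
    proof -
      have m: "m - (k - p) = m - j" "k - p = j" using j by auto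
      have b: "real (k choose p) = fact k / (fact p * fact j)" "real ((N - k) choose q) = fact (N - k) / (fact q * fact (m - j))"
        unfolding Nk using j binomial_fact[of p k, where ?'a=real] binomial_fact[of q "q + (m - j)", where ?'a=real] by simp_all
      have w: "y ^ (N - k) = y ^ q * y ^ (m - j)" unfolding Nk by (rule power_add)
      have w': "x ^ k = x ^ p * x ^ j" unfolding j(1) by (rule power_add)
      show ?thesis unfolding m b w w' using j by (simp add: binomial_fact mult_ac)
    qed
  qed auto
  also have "\<dots> = x ^ p * y ^ q / (fact p * fact q * fact m) * (x + y) ^ m"
    by (simp only: sum_distrib_left[symmetric] binomial_ring)
  finally show ?thesis by (simp add: m_def)
qed

context jacobi_params begin

text \<open>For fixed \<open>X\<close> the Jacobi coefficients in \<open>Y\<close> are computed. The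
  sum over \<open>k\<close> collapses by the preceding lemma, because
  \<open>X + (1 - X) = 1\<close>, and what remains over \<open>p\<close> is the defining sum of the
  Jacobi polynomial at \<open>X\<close>.\<close>

lemma bivar_expansion:
  "bivar N X Y = (\<Sum>n\<le>N. 1 / (Gamma (s + real (N + n)) * fact (N - n)) *
     (poly (jacobi_poly \<alpha> \<beta> n) X * poly (jacobi_poly \<alpha> \<beta> n) Y / h n))"
proof -
  define q where "q = (\<Sum>k\<le>N. smult (X ^ k * (1 - X) ^ (N - k) / (ga k * fact k * gb (N - k) * fact (N - k)))
     ([:0, 1:] ^ k * [:1, -1:] ^ (N - k)))"
  have q: "poly q Y = bivar N X Y"
    by (simp add: q_def bivar_def poly_sum power_mult_distrib mult_ac)
  have deg: "degree q \<le> N"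
    unfolding q_def
  proof (intro degree_sum_le order_trans[OF degree_smult_le])
    fix k assume "k \<in> {..N}"
    thus "degree ([:0, 1::real:] ^ k * [:1, -1:] ^ (N - k)) \<le> N"
      using degree_mult_le[of "[:0, 1::real:] ^ k" "[:1, -1:] ^ (N - k)"] by (simp add: degree_power_eq)
  qed auto
  have L: "L (q * jacobi_poly \<alpha> \<beta> n) = poly (jacobi_poly \<alpha> \<beta> n) X / (Gamma (s + real (N + n)) * fact (N - n))"
    if n: "n \<le> N" for n
  proof -
    have "L (q * jacobi_poly \<alpha> \<beta> n) = (\<Sum>k\<le>N. X ^ k * (1 - X) ^ (N - k) / (ga k * fact k * gb (N - k) * fact (N - k)) *
       L ([:0, 1:] ^ k * [:1, -1:] ^ (N - k) * jacobi_poly \<alpha> \<beta> n))"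
      by (simp only: q_def sum_distrib_right L_sum mult_smult_left L_smult)
    also have "\<dots> = (\<Sum>k\<le>N. \<Sum>p\<le>n. ga n * gb n / Gamma (s + real (N + n)) * ((-1) ^ p / (ga p * gb (n - p))) *
       (real (k choose p) * real ((N - k) choose (n - p)) / (fact k * fact (N - k)) * X ^ k * (1 - X) ^ (N - k)))"
    proof (intro sum.cong refl)
      fix k assume "k \<in> {..N}"
      hence e: "k + (N - k) + n = N + n" by simp
      show "X ^ k * (1 - X) ^ (N - k) / (ga k * fact k * gb (N - k) * fact (N - k)) *
         L ([:0, 1:] ^ k * [:1, -1:] ^ (N - k) * jacobi_poly \<alpha> \<beta> n) =
         (\<Sum>p\<le>n. ga n * gb n / Gamma (s + real (N + n)) * ((-1) ^ p / (ga p * gb (n - p))) *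
       (real (k choose p) * real ((N - k) choose (n - p)) / (fact k * fact (N - k)) * X ^ k * (1 - X) ^ (N - k)))"
        unfolding L_monom_jacobi e sum_distrib_left by (intro sum.cong refl) (simp add: mult_ac)
    qed
    also have "\<dots> = (\<Sum>p\<le>n. ga n * gb n / Gamma (s + real (N + n)) * ((-1) ^ p / (ga p * gb (n - p))) *
       (\<Sum>k\<le>N. real (k choose p) * real ((N - k) choose (n - p)) / (fact k * fact (N - k)) * X ^ k * (1 - X) ^ (N - k)))"
      by (subst sum.swap) (simp only: sum_distrib_left)
    also have "\<dots> = (\<Sum>p\<le>n. ga n * gb n / Gamma (s + real (N + n)) * ((-1) ^ p / (ga p * gb (n - p))) *
       (X ^ p * (1 - X) ^ (n - p) / (fact p * fact (n - p) * fact (N - n))))"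
    proof (intro sum.cong refl arg_cong2[of _ _ _ _ "(*)"])
      fix p assume "p \<in> {..n}"
      hence "p + (n - p) \<le> N" "N - p - (n - p) = N - n" using n by auto
      thus "(\<Sum>k\<le>N. real (k choose p) * real ((N - k) choose (n - p)) / (fact k * fact (N - k)) * X ^ k * (1 - X) ^ (N - k)) =
        X ^ p * (1 - X) ^ (n - p) / (fact p * fact (n - p) * fact (N - n))"
        using binomial_weighted_sum[of p "n - p" N X "1 - X"] by simp
    qed
    also have "\<dots> = 1 / (Gamma (s + real (N + n)) * fact (N - n)) *
       (\<Sum>p\<le>n. ga n * gb n / (ga p * gb (n - p) * fact p * fact (n - p)) * (-1) ^ p * (X ^ p * (1 - X) ^ (n - p)))"
      unfolding sum_distrib_left by (intro sum.cong refl) (simp add: mult_ac)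
    also have "(\<Sum>p\<le>n. ga n * gb n / (ga p * gb (n - p) * fact p * fact (n - p)) * (-1) ^ p * (X ^ p * (1 - X) ^ (n - p))) =
       poly (jacobi_poly \<alpha> \<beta> n) X"
      unfolding jacobi_poly_def poly_sum poly_smult
      by (intro sum.cong refl) (simp add: jacobi_coeff)
    finally show ?thesis by simp
  qed
  have "poly q Y = (\<Sum>n\<le>N. L (q * jacobi_poly \<alpha> \<beta> n) / h n * poly (jacobi_poly \<alpha> \<beta> n) Y)"
    by (subst jacobi_expansion[OF deg]) (simp add: poly_sum)
  thus ?thesis unfolding q by (simp add: L)
qed

lemma jacobi_fun_mult:
  "jacobi_fun \<alpha> \<beta> n \<theta> * jacobi_fun \<alpha> \<beta> n \<phi> =
    poly (jacobi_poly \<alpha> \<beta> n) ((1 - cos \<theta>) / 2) * poly (jacobi_poly \<alpha> \<beta> n) ((1 - cos \<phi>) / 2) / h n"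
proof -
  have "jacobi_c \<alpha> \<beta> n = 1 / sqrt (h n)"
    by (simp add: jacobi_c_def h_def L_def jacobi_P_eq_poly power2_eq_square)
  moreover have "sqrt (h n) * sqrt (h n) = h n" using h_pos[of n] by simp
  ultimately show ?thesis by (simp add: jacobi_fun_def jacobi_P_eq_poly)
qed

lemma jk_term_bivar:
  assumes "K > 0"
  shows "jk_term \<alpha> \<beta> N (sin (\<theta>/2) * sin (\<phi>/2) / K) (cos (\<theta>/2) * cos (\<phi>/2) / K) =
    Gamma (s + 2 * real N) / (4 * K\<^sup>2) ^ N * bivar N ((1 - cos \<theta>) / 2) ((1 - cos \<phi>) / 2)"
proof -
  have half: "(1 - cos x) / 2 = (sin (x/2))\<^sup>2" "1 - (sin (x/2))\<^sup>2 = (cos (x/2))\<^sup>2" for x :: real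
    using cos_double_sin[of "x/2"] by (simp_all add: cos_squared_eq)
  show ?thesis
    unfolding jk_term_def bivar_def sum_distrib_left half
  proof (intro sum.cong refl)
    fix k assume "k \<in> {..N}"
    then obtain l where N: "N = k + l" by (auto simp: le_iff_add)
    show "of_real (jk_coeff \<alpha> \<beta> k (N - k)) * (sin (\<theta>/2) * sin (\<phi>/2) / K) ^ (2 * k) * (cos (\<theta>/2) * cos (\<phi>/2) / K) ^ (2 * (N - k)) =
       Gamma (s + 2 * real N) / (4 * K\<^sup>2) ^ N * (((sin (\<theta>/2))\<^sup>2 * (sin (\<phi>/2))\<^sup>2) ^ k * ((cos (\<theta>/2))\<^sup>2 * (cos (\<phi>/2))\<^sup>2) ^ (N - k) /
         (ga k * fact k * gb (N - k) * fact (N - k)))"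
      unfolding N jk_coeff_def bessel_coeff_def power_mult[of _ 2]
      by (simp add: power_mult_distrib power_divide power_add mult_ac)
  qed
qed

end

section \<open>The closed form of the kernel\<close>

text \<open>Dominates an off-diagonal term by the two diagonal ones.\<close>

lemma abs_mult_le_squares: "\<bar>a * b\<bar> \<le> a * a + b * (b::real)"
proof -
  have "2 * (\<bar>a\<bar> * \<bar>b\<bar>) \<le> a * a + b * b"
    using sum_squares_bound[of "\<bar>a\<bar>" "\<bar>b\<bar>"] by (simp add: power2_eq_square)
  moreover have "0 \<le> \<bar>a\<bar> * \<bar>b\<bar>" by simp
  ultimately show ?thesis unfolding abs_mult by linarith
qed

lemma half_angle_products:
  fixes \<theta> \<phi> :: real
  assumes "\<theta> \<in> {0<..<pi}" "\<phi> \<in> {0<..<pi}"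
  shows "sin (\<theta>/2) > 0" "cos (\<theta>/2) > 0" "sin (\<theta>/2) * sin (\<phi>/2) \<ge> 0" "cos (\<theta>/2) * cos (\<phi>/2) \<ge> 0"
    "sin (\<theta>/2) * sin (\<phi>/2) + cos (\<theta>/2) * cos (\<phi>/2) \<le> 1"
proof -
  have p: "sin (x/2) > 0" "cos (x/2) > 0" if "x \<in> {0<..<pi}" for x
    using that by (auto intro!: sin_gt_zero cos_gt_zero)
  show "sin (\<theta>/2) > 0" "cos (\<theta>/2) > 0" using p assms by auto
  show "sin (\<theta>/2) * sin (\<phi>/2) \<ge> 0" "cos (\<theta>/2) * cos (\<phi>/2) \<ge> 0"
    using p[OF assms(1)] p[OF assms(2)] by auto
  have "sin (\<theta>/2) * sin (\<phi>/2) + cos (\<theta>/2) * cos (\<phi>/2) = cos (\<theta>/2 - \<phi>/2)"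
    by (simp add: cos_diff)
  thus "sin (\<theta>/2) * sin (\<phi>/2) + cos (\<theta>/2) * cos (\<phi>/2) \<le> 1" by simp
qed

context jacobi_params begin

text \<open>The double family behind the closed form: summing over \<open>n\<close> gives the \<open>N\<close>-th homogeneous part of the
  double power series, summing over \<open>N\<close> gives the \<open>n\<close>-th term of the orthogonal expansion.\<close>

definition jterm :: "real \<Rightarrow> nat \<Rightarrow> real \<Rightarrow> real \<Rightarrow> nat \<Rightarrow> real" where
  "jterm t N \<theta> \<phi> n = (if n \<le> N then
     2 * sinh (t/2) * (2 * cosh (t/2)) powr (-s) * (Gamma (s + 2 * real N) / (4 * (cosh (t/2))\<^sup>2) ^ N) /
       (Gamma (s + real (N + n)) * fact (N - n)) * (jacobi_fun \<alpha> \<beta> n \<theta> * jacobi_fun \<alpha> \<beta> n \<phi>) else 0)"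

definition kernel_term :: "real \<Rightarrow> real \<Rightarrow> real \<Rightarrow> nat \<Rightarrow> real" where
  "kernel_term t \<theta> \<phi> N = jk_term \<alpha> \<beta> N (sin (\<theta>/2) * sin (\<phi>/2) / cosh (t/2)) (cos (\<theta>/2) * cos (\<phi>/2) / cosh (t/2))"

lemma jterm_eq_0: "N < n \<Longrightarrow> jterm t N \<theta> \<phi> n = 0"
  by (simp add: jterm_def)

lemma jterm_sum_n:
  "((\<lambda>n. jterm t N \<theta> \<phi> n) has_sum (2 * sinh (t/2) * (2 * cosh (t/2)) powr (-s) * kernel_term t \<theta> \<phi> N)) UNIV"
proof -
  have "((\<lambda>n. jterm t N \<theta> \<phi> n) has_sum (\<Sum>n\<le>N. jterm t N \<theta> \<phi> n)) {..N}" by simp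
  hence "((\<lambda>n. jterm t N \<theta> \<phi> n) has_sum (\<Sum>n\<le>N. jterm t N \<theta> \<phi> n)) UNIV"
    by (subst has_sum_cong_neutral[where S = UNIV and T = "{..N}" and g = "jterm t N \<theta> \<phi>"]) (auto simp: jterm_eq_0)
  moreover have "(\<Sum>n\<le>N. jterm t N \<theta> \<phi> n) = 2 * sinh (t/2) * (2 * cosh (t/2)) powr (-s) * kernel_term t \<theta> \<phi> N"
    unfolding kernel_term_def jk_term_bivar[OF cosh_real_pos] bivar_expansion jacobi_fun_mult[symmetric] sum_distrib_left
    by (intro sum.cong refl) (simp add: jterm_def mult_ac)
  ultimately show ?thesis by simp
qed

text \<open>With \<open>r = exp (-t)\<close> one has
  \<open>1 / (4 cosh (t/2)^2) = r / (1 + r)^2\<close>, so for \<open>N = n + i\<close> this is the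
  generalised binomial series with \<open>\<sigma> = s + 2n\<close>. The remaining powers of
  \<open>r\<close> give the exponent \<open>n + \<tau>\<close>, because
  \<open>\<tau> = (s - 1)/2\<close>.\<close>

lemma jterm_sum_N:
  assumes t: "t > 0"
  shows "((\<lambda>N. jterm t N \<theta> \<phi> n) has_sum
     (exp (- t * (real n + jacobi_tau \<alpha> \<beta>)) * (jacobi_fun \<alpha> \<beta> n \<theta> * jacobi_fun \<alpha> \<beta> n \<phi>))) UNIV"
proof -
  define r where "r = exp (-t)"
  have r: "0 < r" "r < 1" using t by (auto simp: r_def)
  define z where "z = r / (1 + r)\<^sup>2"
  define Q where "Q = jacobi_fun \<alpha> \<beta> n \<theta> * jacobi_fun \<alpha> \<beta> n \<phi>"
  define A where "A = 2 * sinh (t/2) * (2 * cosh (t/2)) powr (-s)"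
  have eh: "exp (t/2) * r = exp (-t/2)" by (simp add: r_def flip: exp_add)
  have sh: "2 * sinh (t/2) = exp (t/2) * (1 - r)" using eh by (simp add: sinh_def right_diff_distrib)
  have ch: "2 * cosh (t/2) = exp (t/2) * (1 + r)" using eh by (simp add: cosh_def distrib_left)
  have z: "1 / (4 * (cosh (t/2))\<^sup>2) = z"
  proof -
    have "4 * (cosh (t/2))\<^sup>2 = (2 * cosh (t/2))\<^sup>2" by (simp add: power_mult_distrib)
    also have "\<dots> = (exp (t/2))\<^sup>2 * (1 + r)\<^sup>2" unfolding ch by (simp add: power_mult_distrib)
    also have "(exp (t/2))\<^sup>2 = exp t" by (simp add: power2_eq_square flip: exp_add)
    also have "exp t = 1 / r" by (simp add: r_def exp_minus divide_inverse)
    finally show ?thesis by (simp add: z_def)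
  qed
  have sp: "s + 2 * real n > 0" using \<alpha> \<beta> by simp
  have "(\<lambda>i. gbin_coeff (s + 2 * real n) i * z ^ i) sums ((1 + r) powr (s + 2 * real n) / (1 - r))"
    unfolding z_def by (rule gbin_sums[OF sp r])
  moreover have "gbin_coeff (s + 2 * real n) i * z ^ i \<ge> 0" for i
    using less_imp_le[OF gbin_coeff_pos[OF sp]] r by (simp add: z_def)
  ultimately have "((\<lambda>i. gbin_coeff (s + 2 * real n) i * z ^ i) has_sum ((1 + r) powr (s + 2 * real n) / (1 - r))) UNIV"
    by (rule sums_nonneg_imp_has_sum)
  hence "((\<lambda>i. A * z ^ n * Q * (gbin_coeff (s + 2 * real n) i * z ^ i)) has_sum (A * z ^ n * Q * ((1 + r) powr (s + 2 * real n) / (1 - r)))) UNIV"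
    by (rule has_sum_cmult_right)
  also have "(\<lambda>i. A * z ^ n * Q * (gbin_coeff (s + 2 * real n) i * z ^ i)) = (\<lambda>i. jterm t (n + i) \<theta> \<phi> n)"
  proof
    fix i
    have e: "s + 2 * real n + 2 * real i = s + 2 * real (n + i)" "s + 2 * real n + real i = s + real (n + i + n)" by simp_all
    have d: "n \<le> n + i" "n + i - n = i" by simp_all
    have p: "x / (4 * (cosh (t/2))\<^sup>2) ^ (n + i) = x * (z ^ n * z ^ i)" for x
      unfolding z[symmetric] power_add[symmetric] by (simp add: power_one_over)
    show "A * z ^ n * Q * (gbin_coeff (s + 2 * real n) i * z ^ i) = jterm t (n + i) \<theta> \<phi> n"
      unfolding jterm_def A_def[symmetric] Q_def[symmetric] gbin_coeff_def e p d if_P[OF d(1)] by simp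
  qed
  also have "A * z ^ n * Q * ((1 + r) powr (s + 2 * real n) / (1 - r)) = exp (- t * (real n + jacobi_tau \<alpha> \<beta>)) * Q"
  proof -
    have 1: "(1 + r) powr (s + 2 * real n) = (1 + r) powr s * (1 + r) ^ (2 * n)"
      using r powr_realpow[of "1 + r" "2 * n"] by (simp add: powr_add)
    have 2: "z ^ n * (1 + r) ^ (2 * n) = exp (- t * real n)"
    proof -
      have "z ^ n * (1 + r) ^ (2 * n) = (z * (1 + r)\<^sup>2) ^ n" by (simp add: power_mult_distrib power_mult)
      also have "z * (1 + r)\<^sup>2 = r" using r by (simp add: z_def)
      finally show ?thesis by (simp add: r_def mult.commute flip: exp_of_nat_mult)
    qed
    have 3: "A * (1 + r) powr s / (1 - r) = exp (- t * jacobi_tau \<alpha> \<beta>)"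
    proof -
      have "(2 * cosh (t/2)) powr (-s) = exp (t/2) powr (-s) * (1 + r) powr (-s)"
        unfolding ch using r by (simp add: powr_mult)
      moreover have "exp (t/2) powr (-s) = exp (- (t/2) * s)" by (simp add: powr_def algebra_simps)
      ultimately have "A * (1 + r) powr s / (1 - r) = exp (t/2) * exp (- (t/2) * s) * ((1 + r) powr (-s) * (1 + r) powr s) * ((1 - r) / (1 - r))"
        unfolding A_def sh by simp
      also have "(1 + r) powr (-s) * (1 + r) powr s = 1" using r by (simp flip: powr_add)
      also have "(1 - r) / (1 - r) = 1" using r by simp
      also have "exp (t/2) * exp (- (t/2) * s) * 1 * 1 = exp (- t * jacobi_tau \<alpha> \<beta>)"
      proof -
        have "t/2 + - (t/2) * s = - t * jacobi_tau \<alpha> \<beta>" by (simp add: jacobi_tau_def algebra_simps)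
        thus ?thesis by (simp only: mult_1_right exp_add[symmetric])
      qed
      finally show ?thesis .
    qed
    have "A * z ^ n * Q * ((1 + r) powr (s + 2 * real n) / (1 - r)) = (z ^ n * (1 + r) ^ (2 * n)) * (A * (1 + r) powr s / (1 - r)) * Q"
      unfolding 1 by (simp only: times_divide_eq_left times_divide_eq_right mult_ac)
    also have "\<dots> = exp (- t * (real n + jacobi_tau \<alpha> \<beta>)) * Q"
      unfolding 2 3 by (simp only: distrib_left exp_add)
    finally show ?thesis .
  qed
  finally have "((\<lambda>i. jterm t (n + i) \<theta> \<phi> n) has_sum exp (- t * (real n + jacobi_tau \<alpha> \<beta>)) * Q) UNIV" .
  hence "((\<lambda>N. jterm t N \<theta> \<phi> n) has_sum exp (- t * (real n + jacobi_tau \<alpha> \<beta>)) * Q) {n..}"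
    by (subst (asm) has_sum_reindex_bij_witness[where j = "\<lambda>i. n + i" and i = "\<lambda>N. N - n" and T = "{n..}"
        and h = "\<lambda>N. jterm t N \<theta> \<phi> n"]) auto
  thus ?thesis unfolding Q_def[symmetric]
    by (subst has_sum_cong_neutral[where S = UNIV and T = "{n..}" and g = "\<lambda>N. jterm t N \<theta> \<phi> n"]) (auto simp: jterm_eq_0)
qed

lemma kernel_term_summable:
  assumes "t > 0" "\<theta> \<in> {0<..<pi}" "\<phi> \<in> {0<..<pi}"
  shows "summable (kernel_term t \<theta> \<phi>)" "\<And>N. kernel_term t \<theta> \<phi> N \<ge> 0"
proof -
  obtain C where C: "\<And>x y. x \<ge> 0 \<Longrightarrow> y \<ge> 0 \<Longrightarrow> x + y < 1 \<Longrightarrow> summable (\<lambda>N. jk_term \<alpha> \<beta> N x (y::real))"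
    using jk_majorant[OF \<alpha> \<beta>] by metis
  note h = half_angle_products[OF assms(2,3)]
  have c: "cosh (t/2) > 1" using assms(1) cosh_real_ge[of "t/2"] zero_less_power2[of "t/2"] by linarith
  have "sin (\<theta>/2) * sin (\<phi>/2) / cosh (t/2) + cos (\<theta>/2) * cos (\<phi>/2) / cosh (t/2) < 1"
    using h(5) c by (simp add: add_divide_distrib[symmetric])
  thus "summable (kernel_term t \<theta> \<phi>)" unfolding kernel_term_def using h c by (intro C) auto
  show "kernel_term t \<theta> \<phi> N \<ge> 0" for N
    unfolding kernel_term_def using h c by (intro jk_term_nonneg \<alpha> \<beta>) auto
qed

lemma jterm_diag_nonneg:
  assumes "t > 0"
  shows "jterm t N \<theta> \<theta> n \<ge> 0"
  unfolding jterm_def using assms gs_pos[of "2*N"] gs_pos[of "N+n"] by (auto intro!: mult_nonneg_nonneg divide_nonneg_nonneg)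

theorem kernel_closed_form:
  assumes t: "t > 0" and th: "\<theta> \<in> {0<..<pi}" "\<phi> \<in> {0<..<pi}"
  shows "(\<lambda>n. exp (- t * (real n + jacobi_tau \<alpha> \<beta>)) * (jacobi_fun \<alpha> \<beta> n \<theta> * jacobi_fun \<alpha> \<beta> n \<phi>)) sums
     (2 * sinh (t/2) * (2 * cosh (t/2)) powr (-s) * (\<Sum>N. kernel_term t \<theta> \<phi> N))"
proof -
  define A where "A = 2 * sinh (t/2) * (2 * cosh (t/2)) powr (-s)"
  have A: "A \<ge> 0" using t by (simp add: A_def)
  \<comment> \<open>On the diagonal all terms are non-negative, so convergence of one iterated sum,
    over \<open>n\<close> and then over \<open>N\<close>, already gives summability over
    pairs.\<close>
  have diag: "(\<lambda>p. jterm t (fst p) x x (snd p)) summable_on UNIV" if x: "x \<in> {0<..<pi}" for x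
  proof -
    have "(\<lambda>N. A * kernel_term t x x N) summable_on UNIV"
      using kernel_term_summable[OF t x x] A by (subst summable_on_UNIV_nonneg_real_iff) auto
    hence "(\<lambda>(N,n). jterm t N x x n) summable_on (UNIV \<times> UNIV)"
      using jterm_sum_n[of t _ x x] jterm_diag_nonneg[OF t]
      by (intro summable_on_SigmaI[where g = "\<lambda>N. A * kernel_term t x x N"]) (auto simp: A_def)
    thus ?thesis by (simp add: case_prod_unfold)
  qed
  have "(\<lambda>p. jterm t (fst p) \<theta> \<theta> (snd p) + jterm t (fst p) \<phi> \<phi> (snd p)) summable_on UNIV"
    using th by (intro summable_on_add diag)
  hence "(\<lambda>p. norm (jterm t (fst p) \<theta> \<phi> (snd p))) summable_on UNIV"
  proof (rule summable_on_comparison_test)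
    fix p :: "nat \<times> nat"
    define N n where "N = fst p" and "n = snd p"
    define c where "c = 2 * sinh (t/2) * (2 * cosh (t/2)) powr (-s) * (Gamma (s + 2 * real N) / (4 * (cosh (t/2))\<^sup>2) ^ N) / (Gamma (s + real (N + n)) * fact (N - n))"
    have c: "c \<ge> 0" unfolding c_def using t gs_pos[of "2*N"] gs_pos[of "N+n"] by (auto intro!: mult_nonneg_nonneg divide_nonneg_nonneg)
    have "c * \<bar>jacobi_fun \<alpha> \<beta> n \<theta> * jacobi_fun \<alpha> \<beta> n \<phi>\<bar> \<le> c * (jacobi_fun \<alpha> \<beta> n \<theta> * jacobi_fun \<alpha> \<beta> n \<theta> + jacobi_fun \<alpha> \<beta> n \<phi> * jacobi_fun \<alpha> \<beta> n \<phi>)"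
      using c by (intro mult_left_mono abs_mult_le_squares)
    hence "\<bar>jterm t N \<theta> \<phi> n\<bar> \<le> jterm t N \<theta> \<theta> n + jterm t N \<phi> \<phi> n"
      unfolding jterm_def c_def[symmetric] using c by (auto simp: abs_mult distrib_left)
    thus "norm (jterm t (fst p) \<theta> \<phi> (snd p)) \<le> jterm t (fst p) \<theta> \<theta> (snd p) + jterm t (fst p) \<phi> \<phi> (snd p)"
      by (simp add: N_def n_def)
  qed auto
  hence "(\<lambda>p. jterm t (fst p) \<theta> \<phi> (snd p)) summable_on UNIV" by (rule abs_summable_summable)
  hence sm: "(\<lambda>(N,n). jterm t N \<theta> \<phi> n) summable_on UNIV" by (simp add: case_prod_unfold)
  then obtain T where T: "((\<lambda>(N,n). jterm t N \<theta> \<phi> n) has_sum T) (UNIV \<times> UNIV)"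
    by (auto simp: summable_on_def)
  have "((\<lambda>N. A * kernel_term t \<theta> \<phi> N) has_sum T) UNIV"
    using has_sum_SigmaD[OF T] jterm_sum_n[of t _ \<theta> \<phi>] by (simp add: A_def)
  hence "(\<lambda>N. A * kernel_term t \<theta> \<phi> N) sums T" by (rule has_sum_imp_sums)
  moreover have "(\<lambda>N. A * kernel_term t \<theta> \<phi> N) sums (A * (\<Sum>N. kernel_term t \<theta> \<phi> N))"
    by (intro sums_mult summable_sums kernel_term_summable assms)
  ultimately have "T = A * (\<Sum>N. kernel_term t \<theta> \<phi> N)" by (rule sums_unique2)
  moreover have "((\<lambda>(n,N). jterm t N \<theta> \<phi> n) has_sum T) (UNIV \<times> UNIV)"
    using T by (subst (asm) has_sum_swap) simp
  hence "((\<lambda>n. exp (- t * (real n + jacobi_tau \<alpha> \<beta>)) * (jacobi_fun \<alpha> \<beta> n \<theta> * jacobi_fun \<alpha> \<beta> n \<phi>)) has_sum T) UNIV"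
    by (rule has_sum_SigmaD) (use jterm_sum_N[OF t] in auto)
  ultimately show ?thesis unfolding A_def by (auto dest: has_sum_imp_sums)
qed

end

section \<open>Complex extension\<close>

text \<open>Real differentiability of each \<open>(deriv ^^ j) g\<close> has to be proved along the
  way. By induction the j-th complex derivative is real on the interval, so its derivative along the
  real axis has imaginary part 0.\<close>

lemma higher_deriv_of_real:
  assumes F: "F holomorphic_on S" "open S" and I: "open I" "\<And>x. x \<in> I \<Longrightarrow> of_real x \<in> S"
    and eq: "\<And>x. x \<in> I \<Longrightarrow> F (of_real x) = of_real (g x)" and x: "x \<in> I"
  shows "(deriv ^^ j) F (of_real x) = of_real ((deriv ^^ j) g x)"
  using x
proof (induction j arbitrary: x)
  case (Suc j)
  define D where "D = (deriv ^^ j) F"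
  have "D holomorphic_on S" unfolding D_def by (intro holomorphic_higher_deriv F)
  hence "(D has_field_derivative deriv D (of_real x)) (at (of_real x))"
    using F I(2)[OF Suc.prems] by (auto intro: holomorphic_derivI)
  hence "((\<lambda>x. D (of_real x)) has_vector_derivative deriv D (of_real x)) (at x)"
    by (rule has_vector_derivative_real_field)
  hence v: "((\<lambda>x. of_real ((deriv ^^ j) g x)) has_vector_derivative deriv D (of_real x)) (at x)"
    by (rule has_vector_derivative_transform_within_open[OF _ I(1) Suc.prems]) (auto simp: D_def Suc.IH)
  have re: "((deriv ^^ j) g has_real_derivative Re (deriv D (of_real x))) (at x)"
    using has_field_derivative_Re[OF v] by simp
  have "((\<lambda>_. 0::real) has_real_derivative Im (deriv D (of_real x))) (at x)"
    using has_field_derivative_Im[OF v] by simp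
  hence "Im (deriv D (of_real x)) = 0" using DERIV_const DERIV_unique by blast
  moreover have "deriv ((deriv ^^ j) g) x = Re (deriv D (of_real x))" using re by (rule DERIV_imp_deriv)
  ultimately show ?case by (simp add: D_def complex_eq_iff)
qed (use eq in auto)

lemma jk_term_norm_le:
  assumes "\<alpha> > -1" "\<beta> > -1"
  shows "norm (jk_term \<alpha> \<beta> N x y) \<le> jk_term \<alpha> \<beta> N (norm x) (norm y)"
  unfolding jk_term_def
proof (intro sum_norm_le)
  fix k
  show "norm (of_real (jk_coeff \<alpha> \<beta> k (N - k)) * x ^ (2 * k) * y ^ (2 * (N - k))) \<le>
     of_real (jk_coeff \<alpha> \<beta> k (N - k)) * norm x ^ (2 * k) * norm y ^ (2 * (N - k))"
    using jk_coeff_pos[OF assms, of k "N - k"] by (simp add: norm_mult norm_power)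
qed

lemma jk_term_mono:
  fixes x y x' y' :: real
  assumes "\<alpha> > -1" "\<beta> > -1" "0 \<le> x" "x \<le> x'" "0 \<le> y" "y \<le> y'"
  shows "jk_term \<alpha> \<beta> N x y \<le> jk_term \<alpha> \<beta> N x' y'"
  unfolding jk_term_def using assms less_imp_le[OF jk_coeff_pos[OF assms(1,2)]]
  by (intro sum_mono mult_mono power_mono mult_left_mono mult_nonneg_nonneg) auto

lemma jk_term_of_real: "jk_term \<alpha> \<beta> N (of_real x) (of_real y) = of_real (jk_term \<alpha> \<beta> N x y)"
  by (simp add: jk_term_def)

text \<open>Homogeneity lets the kernel at large \<open>t\<close> be compared with the series at
  \<open>t = 1\<close>, each term with \<open>N > 0\<close> gaining at least a factor
  \<open>c^2\<close> when \<open>0 < c \<le> 1\<close>.\<close>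

lemma jk_term_scale: "jk_term \<alpha> \<beta> N (c * x) (c * y) = c ^ (2 * N) * jk_term \<alpha> \<beta> N x y"
  unfolding jk_term_def sum_distrib_left
proof (intro sum.cong refl)
  fix k assume "k \<in> {..N}"
  hence "2 * N = 2 * k + 2 * (N - k)" by auto
  hence "c ^ (2 * N) = c ^ (2 * k) * c ^ (2 * (N - k))" by (metis power_add)
  thus "of_real (jk_coeff \<alpha> \<beta> k (N - k)) * (c * x) ^ (2 * k) * (c * y) ^ (2 * (N - k)) =
     c ^ (2 * N) * (of_real (jk_coeff \<alpha> \<beta> k (N - k)) * x ^ (2 * k) * y ^ (2 * (N - k)))"
    by (simp add: power_mult_distrib)
qed

lemma jk_summable_real:
  assumes "\<alpha> > -1" "\<beta> > -1" "x \<ge> 0" "y \<ge> 0" "x + y < 1"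
  shows "summable (\<lambda>N. jk_term \<alpha> \<beta> N x (y::real))"
  using jk_majorant[OF assms(1,2)] assms(3-) by metis

lemma jk_norm_summable:
  fixes x y :: "'a :: {real_normed_field, banach}"
  assumes "\<alpha> > -1" "\<beta> > -1" "norm x + norm y < 1"
  shows "summable (\<lambda>N. norm (jk_term \<alpha> \<beta> N x y))"
  by (rule summable_comparison_test'[OF jk_summable_real[of \<alpha> \<beta> "norm x" "norm y"], of 0])
     (use assms jk_term_norm_le in auto)

lemma jk_holomorphic:
  assumes ab: "\<alpha> > -1" "\<beta> > -1" and S: "open S" "f holomorphic_on S" "g holomorphic_on S"
    and lt: "\<And>z. z \<in> S \<Longrightarrow> norm (f z) + norm (g z) < 1"
  shows "(\<lambda>z. \<Sum>N. jk_term \<alpha> \<beta> N (f z) (g z)) holomorphic_on S"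
proof (rule holomorphic_uniform_sequence[OF S(1), where f = "\<lambda>n z. \<Sum>N<n. jk_term \<alpha> \<beta> N (f z) (g z)"])
  show "(\<lambda>z. \<Sum>N<n. jk_term \<alpha> \<beta> N (f z) (g z)) holomorphic_on S" for n
    unfolding jk_term_def by (intro holomorphic_on_sum holomorphic_on_mult holomorphic_on_power holomorphic_on_const S)
  fix z assume z: "z \<in> S"
  \<comment> \<open>A third of the gap: enlarging both moduli by \<open>e\<close> leaves their sum
    at \<open>1 - e\<close>, so the series at the enlarged moduli is a convergent majorant near
    \<open>z\<close>.\<close>
  define e where "e = (1 - norm (f z) - norm (g z)) / 3"
  have e: "e > 0" "norm (f z) + e + (norm (g z) + e) < 1" using lt[OF z] by (auto simp: e_def field_simps)
  define U where "U = (S \<inter> (\<lambda>w. norm (f w)) -` {..<norm (f z) + e}) \<inter> (S \<inter> (\<lambda>w. norm (g w)) -` {..<norm (g z) + e})"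
  have "continuous_on S f" "continuous_on S g" using S holomorphic_on_imp_continuous_on by auto
  hence "open U" unfolding U_def using S(1)
    by (intro open_Int[OF continuous_open_preimage continuous_open_preimage] continuous_on_norm open_lessThan)
  moreover have "z \<in> U" using e z by (simp add: U_def)
  ultimately obtain d where d: "d > 0" "cball z d \<subseteq> U" using open_contains_cball by blast
  have "uniform_limit (cball z d) (\<lambda>n z. \<Sum>N<n. jk_term \<alpha> \<beta> N (f z) (g z)) (\<lambda>z. \<Sum>N. jk_term \<alpha> \<beta> N (f z) (g z)) sequentially"
  proof (rule Weierstrass_m_test)
    show "summable (\<lambda>N. jk_term \<alpha> \<beta> N (norm (f z) + e) (norm (g z) + e))"
      using e by (intro jk_summable_real ab) auto
    fix N w assume "w \<in> cball z d"
    hence "norm (f w) < norm (f z) + e" "norm (g w) < norm (g z) + e" using d by (auto simp: U_def)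
    thus "norm (jk_term \<alpha> \<beta> N (f w) (g w)) \<le> jk_term \<alpha> \<beta> N (norm (f z) + e) (norm (g z) + e)"
      using jk_term_norm_le[OF ab, of N "f w" "g w"] jk_term_mono[OF ab, of "norm (f w)" "norm (f z) + e" "norm (g w)" "norm (g z) + e" N]
      by auto
  qed
  thus "\<exists>d>0. cball z d \<subseteq> S \<and> uniform_limit (cball z d) (\<lambda>n z. \<Sum>N<n. jk_term \<alpha> \<beta> N (f z) (g z)) (\<lambda>z. \<Sum>N. jk_term \<alpha> \<beta> N (f z) (g z)) sequentially"
    using d by (intro exI[of _ d]) (auto simp: U_def)
qed

context jacobi_params begin

section \<open>The kernel as a holomorphic function of its first angle\<close>

definition prefac :: "real \<Rightarrow> real" where
  "prefac t = 2 * sinh (t/2) * (2 * cosh (t/2)) powr (-s)"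

lemma prefac_nonneg: "t > 0 \<Longrightarrow> prefac t \<ge> 0"
  by (simp add: prefac_def)

definition arg1 :: "real \<Rightarrow> real \<Rightarrow> complex \<Rightarrow> complex" where
  "arg1 t \<phi> z = sin (z/2) * of_real (sin (\<phi>/2) / cosh (t/2))"
definition arg2 :: "real \<Rightarrow> real \<Rightarrow> complex \<Rightarrow> complex" where
  "arg2 t \<phi> z = cos (z/2) * of_real (cos (\<phi>/2) / cosh (t/2))"

definition region :: "real \<Rightarrow> real \<Rightarrow> complex set" where
  "region t \<phi> = {z. norm (arg1 t \<phi> z) + norm (arg2 t \<phi> z) < 1}"

definition kernel :: "real \<Rightarrow> real \<Rightarrow> complex \<Rightarrow> complex" where
  "kernel t \<phi> z = of_real (prefac t) * (\<Sum>N. jk_term \<alpha> \<beta> N (arg1 t \<phi> z) (arg2 t \<phi> z))"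

lemma open_region: "open (region t \<phi>)"
  unfolding region_def arg1_def arg2_def
  by (intro open_Collect_less continuous_intros) auto

lemma kernel_holomorphic: "kernel t \<phi> holomorphic_on region t \<phi>"
  unfolding kernel_def
proof (intro holomorphic_on_mult holomorphic_on_const jk_holomorphic \<alpha> \<beta> open_region)
  show "arg1 t \<phi> holomorphic_on region t \<phi>" "arg2 t \<phi> holomorphic_on region t \<phi>"
    unfolding arg1_def arg2_def by (intro holomorphic_intros; simp)+
qed (auto simp: region_def)

lemma norm_args:
  assumes "\<phi> \<in> {0<..<pi}"
  shows "norm (arg1 t \<phi> z) = norm (sin (z/2)) * sin (\<phi>/2) / cosh (t/2)"
        "norm (arg2 t \<phi> z) = norm (cos (z/2)) * cos (\<phi>/2) / cosh (t/2)"
proof -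
  have "sin (\<phi>/2) > 0" "cos (\<phi>/2) > 0" using half_angle_products[OF assms assms] by auto
  thus "norm (arg1 t \<phi> z) = norm (sin (z/2)) * sin (\<phi>/2) / cosh (t/2)"
        "norm (arg2 t \<phi> z) = norm (cos (z/2)) * cos (\<phi>/2) / cosh (t/2)"
    unfolding arg1_def arg2_def norm_mult norm_of_real by (simp_all add: abs_divide)
qed

lemma kernel_real:
  assumes t: "t > 0" and th: "\<theta> \<in> {0<..<pi}" "\<phi> \<in> {0<..<pi}"
  shows "of_real \<theta> \<in> region t \<phi>"
    "kernel t \<phi> (of_real \<theta>) = of_real (prefac t * (\<Sum>N. kernel_term t \<theta> \<phi> N))"
proof -
  have a: "arg1 t \<phi> (of_real \<theta>) = of_real (sin (\<theta>/2) * sin (\<phi>/2) / cosh (t/2))"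
          "arg2 t \<phi> (of_real \<theta>) = of_real (cos (\<theta>/2) * cos (\<phi>/2) / cosh (t/2))"
    unfolding arg1_def arg2_def using sin_of_real[of "\<theta>/2", where ?'a=complex] cos_of_real[of "\<theta>/2", where ?'a=complex] by simp_all
  note h = half_angle_products[OF th]
  have c: "cosh (t/2) > 1" using t cosh_real_ge[of "t/2"] zero_less_power2[of "t/2"] by linarith
  have "sin (\<theta>/2) * sin (\<phi>/2) / cosh (t/2) + cos (\<theta>/2) * cos (\<phi>/2) / cosh (t/2) < 1"
    using h(5) c by (simp add: add_divide_distrib[symmetric])
  moreover have "sin (\<theta>/2) * sin (\<phi>/2) / cosh (t/2) \<ge> 0" "cos (\<theta>/2) * cos (\<phi>/2) / cosh (t/2) \<ge> 0"
    using h c by auto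
  ultimately show "of_real \<theta> \<in> region t \<phi>" unfolding region_def a mem_Collect_eq norm_of_real by linarith
  have "(\<Sum>N. complex_of_real (kernel_term t \<theta> \<phi> N)) = of_real (\<Sum>N. kernel_term t \<theta> \<phi> N)"
    by (rule suminf_of_real[OF kernel_term_summable(1)[OF assms], symmetric])
  thus "kernel t \<phi> (of_real \<theta>) = of_real (prefac t * (\<Sum>N. kernel_term t \<theta> \<phi> N))"
    unfolding kernel_def a jk_term_of_real kernel_term_def[symmetric] by simp
qed

lemma tau_gt: "jacobi_tau \<alpha> \<beta> > -1/2"
  using \<alpha> \<beta> by (simp add: jacobi_tau_def)

text \<open>Nonzero only for \<open>\<tau> < 0\<close>, when \<open>\<bar>n + \<tau>\<bar> \<noteq> n + \<tau>\<close> at \<open>n = 0\<close>.\<close>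

definition corr :: "real \<Rightarrow> real" where
  "corr t = (exp (- t * \<bar>jacobi_tau \<alpha> \<beta>\<bar>) - exp (- t * jacobi_tau \<alpha> \<beta>)) * (jacobi_c \<alpha> \<beta> 0)\<^sup>2"

lemma jacobi_fun_0: "jacobi_fun \<alpha> \<beta> 0 \<theta> = jacobi_c \<alpha> \<beta> 0"
  by (simp add: jacobi_fun_def jacobi_P_def)

lemma jacobi_poisson_sums:
  assumes t: "t > 0" and th: "\<theta> \<in> {0<..<pi}" "\<phi> \<in> {0<..<pi}"
  shows "(\<lambda>n. exp (- t * \<bar>real n + jacobi_tau \<alpha> \<beta>\<bar>) * jacobi_fun \<alpha> \<beta> n \<theta> * jacobi_fun \<alpha> \<beta> n \<phi>) sums
      (prefac t * (\<Sum>N. kernel_term t \<theta> \<phi> N) + corr t)"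
proof -
  have "(\<lambda>n. exp (- t * (real n + jacobi_tau \<alpha> \<beta>)) * (jacobi_fun \<alpha> \<beta> n \<theta> * jacobi_fun \<alpha> \<beta> n \<phi>) + (if n = 0 then corr t else 0))
     sums (prefac t * (\<Sum>N. kernel_term t \<theta> \<phi> N) + corr t)"
    using kernel_closed_form[OF assms] sums_single[of 0 "\<lambda>_. corr t"] unfolding prefac_def
    by (intro sums_add) auto
  also have "(\<lambda>n. exp (- t * (real n + jacobi_tau \<alpha> \<beta>)) * (jacobi_fun \<alpha> \<beta> n \<theta> * jacobi_fun \<alpha> \<beta> n \<phi>) + (if n = 0 then corr t else 0)) =
     (\<lambda>n. exp (- t * \<bar>real n + jacobi_tau \<alpha> \<beta>\<bar>) * jacobi_fun \<alpha> \<beta> n \<theta> * jacobi_fun \<alpha> \<beta> n \<phi>)"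
  proof
    fix n
    show "exp (- t * (real n + jacobi_tau \<alpha> \<beta>)) * (jacobi_fun \<alpha> \<beta> n \<theta> * jacobi_fun \<alpha> \<beta> n \<phi>) + (if n = 0 then corr t else 0) =
     exp (- t * \<bar>real n + jacobi_tau \<alpha> \<beta>\<bar>) * jacobi_fun \<alpha> \<beta> n \<theta> * jacobi_fun \<alpha> \<beta> n \<phi>"
    proof (cases "n = 0")
      case True
      thus ?thesis by (simp add: corr_def jacobi_fun_0 power2_eq_square algebra_simps)
    next
      case False
      hence "\<bar>real n + jacobi_tau \<alpha> \<beta>\<bar> = real n + jacobi_tau \<alpha> \<beta>" using tau_gt by simp
      thus ?thesis using False by simp
    qed
  qed
  finally show ?thesis .
qed

lemma jacobi_poisson_eq_kernel:
  assumes "t > 0" "\<theta> \<in> {0<..<pi}" "\<phi> \<in> {0<..<pi}"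
  shows "of_real (jacobi_poisson \<alpha> \<beta> t \<theta> \<phi>) = kernel t \<phi> (of_real \<theta>) + of_real (corr t)"
  using jacobi_poisson_sums[OF assms] kernel_real(2)[OF assms] by (simp add: jacobi_poisson_def sums_iff)

text \<open>The constant \<open>c\<close> lets one statement serve the compensated kernel too: the
  polynomial of degree 0 is constant, so the two kernels differ by a quantity independent of both
  angles.\<close>

lemma higher_deriv_jacobi_poisson:
  assumes t: "t > 0" and th: "\<theta> \<in> {0<..<pi}" "\<phi> \<in> {0<..<pi}"
    and g: "\<And>x. x \<in> {0<..<pi} \<Longrightarrow> g x = jacobi_poisson \<alpha> \<beta> t x \<phi> + c"
  shows "\<bar>(deriv ^^ j) g \<theta>\<bar> = norm ((deriv ^^ j) (\<lambda>z. kernel t \<phi> z + of_real (corr t + c)) (of_real \<theta>))"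
proof -
  have "(deriv ^^ j) (\<lambda>z. kernel t \<phi> z + of_real (corr t + c)) (of_real \<theta>) = of_real ((deriv ^^ j) g \<theta>)"
  proof (rule higher_deriv_of_real[where S = "region t \<phi>" and I = "{0<..<pi}"])
    show "(\<lambda>z. kernel t \<phi> z + complex_of_real (corr t + c)) holomorphic_on region t \<phi>"
      by (intro holomorphic_on_add kernel_holomorphic holomorphic_on_const)
    show "complex_of_real x \<in> region t \<phi>" if "x \<in> {0<..<pi}" for x using kernel_real(1)[OF t that th(2)] .
    show "kernel t \<phi> (complex_of_real x) + complex_of_real (corr t + c) = complex_of_real (g x)" if "x \<in> {0<..<pi}" for x
      using jacobi_poisson_eq_kernel[OF t that th(2)] g[OF that] by simp
  qed (use th open_region in auto)
  thus ?thesis by simp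
qed

end

section \<open>Geometry of the discs\<close>

lemma cosh_real_le:
  assumes "\<bar>x::real\<bar> \<le> 1"
  shows "cosh x \<le> 1 + x\<^sup>2"
proof -
  have *: "cosh y \<le> 1 + y\<^sup>2" if "0 \<le> y" "y \<le> 1" for y :: real
  proof -
    \<comment> \<open>The product is \<open>1 + y^4/4\<close>; it converts the Taylor lower bound
      for \<open>exp y\<close> into an upper bound for \<open>exp (-y)\<close>.\<close>
    have "1 \<le> (1 + y + y\<^sup>2/2) * (1 - y + y\<^sup>2/2)"
      using that by (simp add: power2_eq_square algebra_simps)
    also have "\<dots> \<le> exp y * (1 - y + y\<^sup>2/2)"
    proof (rule mult_right_mono)
      show "1 + y + y\<^sup>2/2 \<le> exp y" using exp_lower_Taylor_quadratic[OF that(1)] by simp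
      show "0 \<le> 1 - y + y\<^sup>2/2" using that by simp
    qed
    finally have "exp (-y) \<le> 1 - y + y\<^sup>2/2"
      by (simp add: exp_minus field_simps)
    moreover have "exp y \<le> 1 + y + y\<^sup>2" using exp_bound[OF that] .
    ultimately have "exp y + exp (-y) \<le> 2 + 2 * y\<^sup>2" using zero_le_power2[of y] by linarith
    thus ?thesis by (simp add: cosh_field_def)
  qed
  show ?thesis using *[of "\<bar>x\<bar>"] assms by (cases "x \<ge> 0") auto
qed

lemma sinh_real_le:
  assumes "0 \<le> x" "x \<le> 1"
  shows "sinh x \<le> 2 * (x::real)"
proof -
  have "exp x \<le> 1 + x + x\<^sup>2" using exp_bound[OF assms] .
  moreover have "1 - x \<le> exp (-x)" using exp_ge_add_one_self[of "-x"] by simp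
  moreover have "x\<^sup>2 \<le> x" using assms by (simp add: power2_eq_square mult_left_le_one_le)
  ultimately have "exp x - exp (-x) \<le> 4 * x" using assms(1) by linarith
  thus ?thesis by (simp add: sinh_field_def)
qed

lemma sin_ge_half:
  assumes "0 \<le> x" "x \<le> pi / 2"
  shows "x / 2 \<le> sin x"
proof -
  have "\<bar>sin x - (\<Sum>m<3. sin_coeff m * x ^ m)\<bar> \<le> inverse (fact 3) * \<bar>x\<bar> ^ 3"
    by (rule Maclaurin_sin_bound)
  hence "\<bar>sin x - x\<bar> \<le> x ^ 3 / 6"
    using assms by (simp add: numeral_3_eq_3 sin_coeff_def fact_numeral)
  moreover have "x ^ 3 / 6 \<le> x / 2"
  proof -
    \<comment> \<open>A rational bound above \<open>pi/2\<close> whose square, 2.89, is below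
      3.\<close>
    have "x \<le> 17/10" using assms pi_less_4 pi_approx by simp
    hence "x\<^sup>2 \<le> (17/10)\<^sup>2" using assms by (intro power_mono) auto
    hence "x * x\<^sup>2 \<le> x * 3" using assms by (intro mult_left_mono) (auto simp: power2_eq_square)
    thus ?thesis by (simp add: power3_eq_cube power2_eq_square)
  qed
  ultimately show ?thesis by linarith
qed

section \<open>Complex sine and cosine near the real axis\<close>

lemma norm_sin_cos_squared: "(norm (sin z))\<^sup>2 + (norm (cos z))\<^sup>2 = cosh (2 * Im z)"
proof -
  have "(exp (Im z) - inverse (exp (Im z)))\<^sup>2 = exp (2 * Im z) + inverse (exp (2 * Im z)) - 2"
    by (simp add: power2_diff exp_double power_inverse)
  thus ?thesis
    unfolding norm_sin_squared norm_cos_squared cosh_field_def exp_minus cos_double_cos by (simp add: add_divide_distrib diff_divide_distrib)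
qed

lemma norm_sin_cos_le:
  assumes "\<bar>Im z\<bar> \<le> 1/2"
  shows "norm (sin z) \<le> 2" "norm (cos z) \<le> 2"
proof -
  have "\<bar>2 * Im z\<bar> \<le> 1" using assms by simp
  hence "(2 * Im z)\<^sup>2 \<le> 1" by (simp only: abs_square_le_1)
  hence "cosh (2 * Im z) \<le> 4" using cosh_real_le[OF \<open>\<bar>2 * Im z\<bar> \<le> 1\<close>] by linarith
  hence "(norm (sin z))\<^sup>2 \<le> 4" "(norm (cos z))\<^sup>2 \<le> 4"
    using norm_sin_cos_squared[of z] zero_le_power2[of "norm (sin z)"] zero_le_power2[of "norm (cos z)"] by linarith+
  hence "(norm (sin z))\<^sup>2 \<le> 2\<^sup>2" "(norm (cos z))\<^sup>2 \<le> 2\<^sup>2" by simp_all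
  thus "norm (sin z) \<le> 2" "norm (cos z) \<le> 2" by (auto intro: power2_le_imp_le)
qed

text \<open>On the convex strip of half-width 1/2 the derivatives of sine and cosine are bounded by
  2, which the halved argument compensates.\<close>

lemma sin_cos_lipschitz:
  fixes z :: complex and \<theta> p :: real
  assumes "norm (z - of_real \<theta>) \<le> p" "p \<le> 1"
  shows "\<bar>norm (sin (z/2)) - \<bar>sin (\<theta>/2)\<bar>\<bar> \<le> p" "\<bar>norm (cos (z/2)) - \<bar>cos (\<theta>/2)\<bar>\<bar> \<le> p"
proof -
  define S where "S = {w. Im w \<le> 1/2} \<inter> {w. Im w \<ge> -1/2}"
  have cS: "convex S" unfolding S_def by (intro convex_Int convex_halfspace_Im_le convex_halfspace_Im_ge)
  have "\<bar>Im z\<bar> \<le> p" using abs_Im_le_cmod[of "z - of_real \<theta>"] assms by simp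
  hence zS: "z/2 \<in> S" "of_real (\<theta>/2) \<in> S" using assms by (auto simp: S_def)
  have d: "norm (z/2 - of_real (\<theta>/2)) \<le> p / 2"
  proof -
    have "z/2 - of_real (\<theta>/2) = (z - of_real \<theta>) / 2" by (simp add: diff_divide_distrib)
    hence "norm (z/2 - of_real (\<theta>/2)) = norm (z - of_real \<theta>) / 2" by (simp only: norm_divide norm_numeral)
    thus ?thesis using assms by simp
  qed
  have "norm (sin (z/2) - sin (of_real (\<theta>/2))) \<le> 2 * norm (z/2 - of_real (\<theta>/2))"
    by (rule field_differentiable_bound[OF cS, where f' = cos])
       (use zS in \<open>auto intro!: derivative_eq_intros norm_sin_cos_le simp: S_def abs_le_iff\<close>)
  hence "norm (sin (z/2) - of_real (sin (\<theta>/2))) \<le> p" using d unfolding sin_of_real by linarith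
  thus "\<bar>norm (sin (z/2)) - \<bar>sin (\<theta>/2)\<bar>\<bar> \<le> p"
    using norm_triangle_ineq3[of "sin (z/2)" "of_real (sin (\<theta>/2))"] unfolding norm_of_real by linarith
  have "norm (cos (z/2) - cos (of_real (\<theta>/2))) \<le> 2 * norm (z/2 - of_real (\<theta>/2))"
    by (rule field_differentiable_bound[OF cS, where f' = "\<lambda>w. - sin w"])
       (use zS in \<open>auto intro!: derivative_eq_intros norm_sin_cos_le simp: S_def abs_le_iff\<close>)
  hence "norm (cos (z/2) - of_real (cos (\<theta>/2))) \<le> p" using d unfolding cos_of_real by linarith
  thus "\<bar>norm (cos (z/2)) - \<bar>cos (\<theta>/2)\<bar>\<bar> \<le> p"
    using norm_triangle_ineq3[of "cos (z/2)" "of_real (cos (\<theta>/2))"] unfolding norm_of_real by linarith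
qed

text \<open>Used once with sines and once with cosines, the angles then being measured from
  \<open>pi\<close>. The point is that \<open>a * S'\<close> is comparable to
  \<open>\<theta> * \<phi>\<close> up to errors of size \<open>q2\<close>, and
  \<open>S^2 + S'^2 = (S - S')^2 + 2 S S'\<close> recovers the squares. The constant 10000 is a
  generous round number.\<close>

lemma weight_comparison:
  fixes S S' a p q2 \<theta> \<phi> t \<delta> K :: real
  assumes S: "\<theta>/4 \<le> S" "S \<le> \<theta>/2" "\<phi>/4 \<le> S'" "S' \<le> \<phi>/2" "0 \<le> \<theta>" "0 \<le> \<phi>"
    and a: "\<bar>a - S\<bar> \<le> p" "0 \<le> a" and dS: "(S - S')\<^sup>2 \<le> (\<theta> - \<phi>)\<^sup>2/4"
    and q2: "q2 = t\<^sup>2 + (\<theta> - \<phi>)\<^sup>2" and p: "p\<^sup>2 \<le> q2/256" "0 \<le> p"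
    and d: "q2/256 \<le> \<delta>" "\<delta> \<le> q2" and K: "1 \<le> K" "K \<le> 2"
  shows "\<delta> + a * S' / K \<le> 10000 * (t\<^sup>2 + \<theta>\<^sup>2 + \<phi>\<^sup>2)" "t\<^sup>2 + \<theta>\<^sup>2 + \<phi>\<^sup>2 \<le> 10000 * (\<delta> + a * S' / K)"
proof -
  have S0: "0 \<le> S" "0 \<le> S'" using S by auto
  have sq: "S\<^sup>2 \<le> (\<theta>/2)\<^sup>2" "S'\<^sup>2 \<le> (\<phi>/2)\<^sup>2" "(\<theta>/4)\<^sup>2 \<le> S\<^sup>2" "(\<phi>/4)\<^sup>2 \<le> S'\<^sup>2"
    using S S0 by (auto intro!: power_mono)
  have q0: "q2 \<ge> 0" unfolding q2 by simp
  have qle: "q2 \<le> t\<^sup>2 + 2 * \<theta>\<^sup>2 + 2 * \<phi>\<^sup>2"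
    using sum_squares_bound[of \<theta> \<phi>] zero_le_power2[of "\<theta> + \<phi>"] unfolding q2 by (simp add: power2_eq_square algebra_simps)
  have aS0: "a * S' \<ge> 0" using a S0 by simp
  have up: "a * S' \<le> S\<^sup>2 + S'\<^sup>2 + p\<^sup>2"
  proof -
    have "a * S' \<le> (S + p) * S'" using a S0 by (intro mult_right_mono) auto
    moreover have "(S + p) * S' = S * S' + p * S'" by (simp add: algebra_simps)
    ultimately show ?thesis using sum_squares_bound[of S S'] sum_squares_bound[of p S'] zero_le_power2[of S] zero_le_power2[of p] by linarith
  qed
  have K1: "a * S' / K \<le> a * S'" "a * S' \<le> 2 * (a * S' / K)"
    using K aS0 mult_right_mono[OF K(1) aS0] mult_right_mono[OF K(2) aS0] by (auto simp: field_simps)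
  show "\<delta> + a * S' / K \<le> 10000 * (t\<^sup>2 + \<theta>\<^sup>2 + \<phi>\<^sup>2)"
  proof -
    have "4 * S\<^sup>2 \<le> \<theta>\<^sup>2" "4 * S'\<^sup>2 \<le> \<phi>\<^sup>2" using sq(1,2) by (simp_all add: power_divide)
    thus ?thesis
      using K1 up qle p d q0 zero_le_power2[of \<theta>] zero_le_power2[of \<phi>] zero_le_power2[of t] unfolding distrib_left by linarith
  qed
  have "S\<^sup>2 + S'\<^sup>2 = (S - S')\<^sup>2 + 2 * (S * S')" by (simp add: power2_eq_square algebra_simps)
  moreover have "S * S' \<le> a * S' + p * S'"
  proof -
    have "S * S' \<le> (a + p) * S'" using a S0 by (intro mult_right_mono) auto
    thus ?thesis by (simp add: algebra_simps)
  qed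
  moreover have "2 * (p * S') \<le> 2 * p\<^sup>2 + S'\<^sup>2/2"
    using zero_le_power2[of "2 * p - S'"] by (simp add: power2_eq_square algebra_simps)
  ultimately have "S\<^sup>2 + S'\<^sup>2 \<le> (\<theta> - \<phi>)\<^sup>2/2 + 4 * p\<^sup>2 + 4 * (a * S')"
    using dS zero_le_power2[of S] by linarith
  moreover have "(\<theta> - \<phi>)\<^sup>2 \<le> q2" "t\<^sup>2 \<le> q2" unfolding q2 by auto
  ultimately have "S\<^sup>2 + S'\<^sup>2 \<le> 2 * q2 + 4 * (a * S')" using p q0 by linarith
  moreover have "\<theta>\<^sup>2 \<le> 16 * S\<^sup>2" "\<phi>\<^sup>2 \<le> 16 * S'\<^sup>2" using sq(3,4) by (simp_all add: power_divide)
  ultimately show "t\<^sup>2 + \<theta>\<^sup>2 + \<phi>\<^sup>2 \<le> 10000 * (\<delta> + a * S' / K)"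
    using \<open>t\<^sup>2 \<le> q2\<close> d K1 aS0 unfolding distrib_left by linarith
qed

text \<open>Comparability in both directions is assumed because the exponents
  \<open>-\<alpha>-1/2\<close> and \<open>-\<beta>-1/2\<close> may have either sign.\<close>

lemma powr_comparable:
  fixes A B M e :: real
  assumes "0 < A" "0 < B" "A \<le> M * B" "B \<le> M * A" "M \<ge> 1"
  shows "A powr e \<le> M powr \<bar>e\<bar> * B powr e"
proof (cases "e \<ge> 0")
  case True
  have "A powr e \<le> (M * B) powr e" using assms True by (intro powr_mono2) auto
  thus ?thesis using True assms by (simp add: powr_mult)
next
  case False
  have "A powr e \<le> (B / M) powr e" using assms False by (intro powr_mono2') (auto simp: field_simps)
  thus ?thesis using False assms by (simp add: powr_divide powr_minus field_simps)
qed

text \<open>The complex modulus pair \<open>(\<bar>sin (z/2)\<bar>, \<bar>cos (z/2)\<bar>)\<close> has squared length \<open>cosh (Im z)\<close>, so the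
  gap below is of second order in \<open>Im z\<close>; a first-order loss would not be affordable.\<close>

lemma gap_identity:
  fixes a b S C c K :: real
  assumes "a\<^sup>2 + b\<^sup>2 = c" "S\<^sup>2 + C\<^sup>2 = 1"
  shows "K - (a * S + b * C) = K - 1/2 - c/2 + (a - S)\<^sup>2/2 + (b - C)\<^sup>2/2"
  using assms by (simp add: power2_eq_square algebra_simps field_simps)

lemma disc_geometry:
  fixes t \<theta> \<phi> :: real and z :: complex
  assumes t: "0 < t" "t \<le> 1" and th: "\<theta> \<in> {0<..<pi}" "\<phi> \<in> {0<..<pi}"
    and z: "norm (z - of_real \<theta>) \<le> sqrt (t\<^sup>2 + (\<theta> - \<phi>)\<^sup>2) / 16"
  defines "x \<equiv> norm (sin (z/2)) * sin (\<phi>/2) / cosh (t/2)"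
    and "y \<equiv> norm (cos (z/2)) * cos (\<phi>/2) / cosh (t/2)"
  shows "(t\<^sup>2 + (\<theta> - \<phi>)\<^sup>2) / 256 \<le> 1 - x - y"
    "1 - x - y + x \<le> 10000 * (t\<^sup>2 + \<theta>\<^sup>2 + \<phi>\<^sup>2)" "t\<^sup>2 + \<theta>\<^sup>2 + \<phi>\<^sup>2 \<le> 10000 * (1 - x - y + x)"
    "1 - x - y + y \<le> 10000 * (t\<^sup>2 + (pi - \<theta>)\<^sup>2 + (pi - \<phi>)\<^sup>2)" "t\<^sup>2 + (pi - \<theta>)\<^sup>2 + (pi - \<phi>)\<^sup>2 \<le> 10000 * (1 - x - y + y)"
proof -
  define q2 p K where "q2 = t\<^sup>2 + (\<theta> - \<phi>)\<^sup>2" and "p = sqrt q2 / 16" and "K = cosh (t/2)"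
  define a b S C S' C' where "a = norm (sin (z/2))" and "b = norm (cos (z/2))" and "S = sin (\<theta>/2)" and "C = cos (\<theta>/2)"
    and "S' = sin (\<phi>/2)" and "C' = cos (\<phi>/2)"
  have q2: "q2 > 0" using t by (simp add: q2_def add_pos_nonneg)
  have p: "p\<^sup>2 = q2/256" "p \<ge> 0" using q2 by (auto simp: p_def power_divide)
  have "\<bar>\<theta> - \<phi>\<bar> \<le> 4" using th pi_less_4 by auto
  hence td: "(\<theta> - \<phi>)\<^sup>2 \<le> 16" using power_mono[of "\<bar>\<theta> - \<phi>\<bar>" 4 2] by simp
  have "t\<^sup>2 \<le> 1" using t by (simp add: power_le_one)
  hence p1: "p \<le> 1" using td p power2_le_imp_le[of p 1] by (simp add: q2_def)
  have K: "1 + t\<^sup>2/8 \<le> K" "K \<le> 1 + t\<^sup>2/4"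
    using cosh_real_ge[of "t/2"] cosh_real_le[of "t/2"] t by (auto simp: K_def power_divide)
  have K12: "1 \<le> K" "K \<le> 2" using K \<open>t\<^sup>2 \<le> 1\<close> zero_le_power2[of t] by auto
  have half: "x/4 \<le> sin (x/2)" "sin (x/2) \<le> x/2" if "x \<in> {0<..<pi}" for x
    using that sin_ge_half[of "x/2"] sin_x_le_x[of "x/2"] by auto
  \<comment> \<open>This reflection reduces the endpoint \<open>pi\<close> to the endpoint
    0.\<close>
  have refl: "cos (x/2) = sin ((pi - x)/2)" for x :: real by (simp add: sin_diff diff_divide_distrib)
  have S: "\<theta>/4 \<le> S" "S \<le> \<theta>/2" "\<phi>/4 \<le> S'" "S' \<le> \<phi>/2" using half th by (auto simp: S_def S'_def)
  have C: "(pi - \<theta>)/4 \<le> C" "C \<le> (pi - \<theta>)/2" "(pi - \<phi>)/4 \<le> C'" "C' \<le> (pi - \<phi>)/2"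
    using half[of "pi - \<theta>"] half[of "pi - \<phi>"] th unfolding C_def C'_def refl by auto
  have S0: "S > 0" "S' > 0" "C > 0" "C' > 0" using S C th by auto
  have lip: "\<bar>a - S\<bar> \<le> p" "\<bar>b - C\<bar> \<le> p"
    using sin_cos_lipschitz[OF z[folded q2_def, folded p_def] p1] S0 by (simp_all add: a_def b_def S_def C_def)
  have lip2: "(a - S)\<^sup>2 \<le> p\<^sup>2" "(b - C)\<^sup>2 \<le> p\<^sup>2"
    using power_mono[OF lip(1), of 2] power_mono[OF lip(2), of 2] by simp_all
  define c where "c = cosh (Im z)"
  have ab: "a\<^sup>2 + b\<^sup>2 = c" using norm_sin_cos_squared[of "z/2"] by (simp add: a_def b_def c_def)
  have "\<bar>Im z\<bar> \<le> p" using abs_Im_le_cmod[of "z - of_real \<theta>"] z by (simp add: p_def q2_def)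
  hence Imz: "(Im z)\<^sup>2 \<le> p\<^sup>2" "\<bar>Im z\<bar> \<le> 1" using power_mono[of "\<bar>Im z\<bar>" p 2] p1 by auto
  have c: "1 \<le> c" "c \<le> 1 + p\<^sup>2" using cosh_real_le[OF Imz(2)] Imz(1) cosh_real_ge_1[of "Im z"] by (auto simp: c_def)
  have SC: "S'\<^sup>2 + C'\<^sup>2 = 1" by (simp add: S'_def C'_def)
  \<comment> \<open>Squared chord between two unit vectors at angle
    \<open>(\<theta> - \<phi>)/2\<close>.\<close>
  have D: "(S - S')\<^sup>2 + (C - C')\<^sup>2 = 4 * (sin ((\<theta> - \<phi>)/4))\<^sup>2"
  proof -
    have "(S - S')\<^sup>2 + (C - C')\<^sup>2 = 2 - 2 * (cos (\<theta>/2) * cos (\<phi>/2) + sin (\<theta>/2) * sin (\<phi>/2))"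
      using sin_cos_squared_add[of "\<theta>/2"] sin_cos_squared_add[of "\<phi>/2"]
      unfolding S_def S'_def C_def C'_def power2_diff by (simp add: algebra_simps)
    also have "\<dots> = 2 - 2 * cos (2 * ((\<theta> - \<phi>)/4))" by (simp add: cos_diff[symmetric] diff_divide_distrib)
    also have "\<dots> = 4 * (sin ((\<theta> - \<phi>)/4))\<^sup>2" unfolding cos_double_sin by simp
    finally show ?thesis .
  qed
  have Dup: "(S - S')\<^sup>2 + (C - C')\<^sup>2 \<le> (\<theta> - \<phi>)\<^sup>2/4"
    using power_mono[OF abs_sin_x_le_abs_x[of "(\<theta> - \<phi>)/4"], of 2] unfolding D by (simp add: power_divide)
  have Dlo: "(\<theta> - \<phi>)\<^sup>2/16 \<le> (S - S')\<^sup>2 + (C - C')\<^sup>2"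
  proof -
    have "\<bar>\<theta> - \<phi>\<bar>/4/2 \<le> sin (\<bar>\<theta> - \<phi>\<bar>/4)" using th by (intro sin_ge_half) auto
    hence "(\<bar>\<theta> - \<phi>\<bar>/4/2)\<^sup>2 \<le> (sin (\<bar>\<theta> - \<phi>\<bar>/4))\<^sup>2" by (intro power_mono) auto
    moreover have "(sin (\<bar>\<theta> - \<phi>\<bar>/4))\<^sup>2 = (sin ((\<theta> - \<phi>)/4))\<^sup>2" by (cases "\<theta> \<ge> \<phi>") (auto simp: minus_divide_left[symmetric] sin_minus abs_if minus_diff_eq[of \<theta> \<phi>, symmetric] simp del: minus_diff_eq)
    ultimately show ?thesis unfolding D by (simp add: power_divide)
  qed
  have tri: "(u + v)\<^sup>2 \<le> 2 * u\<^sup>2 + 2 * v\<^sup>2" for u v :: real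
    using zero_le_power2[of "u - v"] by (simp add: power2_eq_square algebra_simps)
  have up: "(a - S')\<^sup>2 + (b - C')\<^sup>2 \<le> 2 * ((S - S')\<^sup>2 + (C - C')\<^sup>2) + 4 * p\<^sup>2"
    using tri[of "a - S" "S - S'"] tri[of "b - C" "C - C'"] lip2 by simp
  have lo: "(S - S')\<^sup>2 + (C - C')\<^sup>2 \<le> 2 * ((a - S')\<^sup>2 + (b - C')\<^sup>2) + 4 * p\<^sup>2"
    using tri[of "S - a" "a - S'"] tri[of "C - b" "b - C'"] lip2 by (simp add: power2_commute)
  note gap = gap_identity[OF ab SC, of K]
  \<comment> \<open>The main terms \<open>t^2/8\<close> and \<open>(\<theta> - \<phi>)^2/64\<close>
    are together at least \<open>q2/64\<close>. Moving off the real axis costs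
    \<open>3 p^2 / 2 = 3 q2 / 512\<close> for the radius \<open>sqrt q2 / 16\<close>, which leaves
    more than \<open>q2/128\<close>. Division by \<open>K \<le> 2\<close> then gives the 256 of the
    claim.\<close>
  have g1: "q2/128 \<le> K - (a * S' + b * C')"
  proof -
    have "(\<theta> - \<phi>)\<^sup>2/64 - p\<^sup>2 \<le> (a - S')\<^sup>2/2 + (b - C')\<^sup>2/2" using lo Dlo by (simp add: field_simps)
    moreover have "t\<^sup>2/8 - p\<^sup>2/2 \<le> K - 1/2 - c/2" using K(1) c(2) by (simp add: field_simps)
    moreover have "q2/128 + p\<^sup>2 + p\<^sup>2/2 \<le> t\<^sup>2/8 + (\<theta> - \<phi>)\<^sup>2/64"
      unfolding p(1) q2_def using zero_le_power2[of t] zero_le_power2[of "\<theta> - \<phi>"] by (simp add: field_simps)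
    ultimately show ?thesis unfolding gap by linarith
  qed
  have g2: "K - (a * S' + b * C') \<le> q2"
  proof -
    have "(a - S')\<^sup>2/2 + (b - C')\<^sup>2/2 \<le> (\<theta> - \<phi>)\<^sup>2/4 + 2 * p\<^sup>2" using up Dup by (simp add: field_simps)
    moreover have "K - 1/2 - c/2 \<le> t\<^sup>2/4" using K(2) c(1) by (simp add: field_simps)
    moreover have "t\<^sup>2/4 + (\<theta> - \<phi>)\<^sup>2/4 + 2 * p\<^sup>2 \<le> q2"
      unfolding p(1) q2_def using zero_le_power2[of t] zero_le_power2[of "\<theta> - \<phi>"] by (simp add: field_simps)
    ultimately show ?thesis unfolding gap by linarith
  qed
  define \<delta> where "\<delta> = 1 - x - y"
  have \<delta>: "\<delta> = (K - (a * S' + b * C')) / K"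
    using K12 by (simp add: \<delta>_def x_def y_def a_def b_def S'_def C'_def K_def[symmetric] field_simps)
  have d: "q2/256 \<le> \<delta>" "\<delta> \<le> q2"
  proof -
    have "q2/256 * K \<le> q2/256 * 2" using K12 q2 by (intro mult_left_mono) auto
    also have "q2/256 * 2 = q2/128" by simp
    also note g1
    finally show "q2/256 \<le> \<delta>" unfolding \<delta> using K12 by (subst pos_le_divide_eq) auto
    have "q2 * 1 \<le> q2 * K" using K12 q2 by (intro mult_left_mono) auto
    hence "K - (a * S' + b * C') \<le> q2 * K" using g2 by simp
    thus "\<delta> \<le> q2" unfolding \<delta> using K12 by (subst pos_divide_le_eq) auto
  qed
  show "(t\<^sup>2 + (\<theta> - \<phi>)\<^sup>2) / 256 \<le> 1 - x - y" using d(1) by (simp add: \<delta>_def q2_def)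
  have xy: "x = a * S' / K" "y = b * C' / K" by (simp_all add: x_def y_def a_def b_def S'_def C'_def K_def)
  have dS: "(S - S')\<^sup>2 \<le> (\<theta> - \<phi>)\<^sup>2/4" "(C - C')\<^sup>2 \<le> ((pi - \<theta>) - (pi - \<phi>))\<^sup>2/4"
  proof -
    have "((pi - \<theta>) - (pi - \<phi>))\<^sup>2 = (\<theta> - \<phi>)\<^sup>2" by (simp add: power2_commute)
    thus "(S - S')\<^sup>2 \<le> (\<theta> - \<phi>)\<^sup>2/4" "(C - C')\<^sup>2 \<le> ((pi - \<theta>) - (pi - \<phi>))\<^sup>2/4"
      using Dup zero_le_power2[of "S - S'"] zero_le_power2[of "C - C'"] by linarith+
  qed
  have nn: "0 \<le> a" "0 \<le> b" by (simp_all add: a_def b_def)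
  have q2': "q2 = t\<^sup>2 + ((pi - \<theta>) - (pi - \<phi>))\<^sup>2" by (simp add: q2_def power2_commute)
  show "1 - x - y + x \<le> 10000 * (t\<^sup>2 + \<theta>\<^sup>2 + \<phi>\<^sup>2)" "t\<^sup>2 + \<theta>\<^sup>2 + \<phi>\<^sup>2 \<le> 10000 * (1 - x - y + x)"
    unfolding \<delta>_def[symmetric] unfolding xy(1)
    by (rule weight_comparison[OF S _ _ lip(1) nn(1) dS(1) q2_def _ p(2) d K12]; use th p in simp)+
  show "1 - x - y + y \<le> 10000 * (t\<^sup>2 + (pi - \<theta>)\<^sup>2 + (pi - \<phi>)\<^sup>2)" "t\<^sup>2 + (pi - \<theta>)\<^sup>2 + (pi - \<phi>)\<^sup>2 \<le> 10000 * (1 - x - y + y)"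
    unfolding \<delta>_def[symmetric] unfolding xy(2)
    by (rule weight_comparison[OF C _ _ lip(2) nn(2) dS(2) q2' _ p(2) d K12]; use th p in simp)+
qed

section \<open>Kernel estimates\<close>

context jacobi_params begin

section \<open>The range of small times\<close>

lemma norm_kernel_le:
  assumes "t > 0" "z \<in> region t \<phi>"
  shows "norm (kernel t \<phi> z) \<le> prefac t * (\<Sum>N. jk_term \<alpha> \<beta> N (norm (arg1 t \<phi> z)) (norm (arg2 t \<phi> z)))"
proof -
  have lt: "norm (arg1 t \<phi> z) + norm (arg2 t \<phi> z) < 1" using assms by (simp add: region_def)
  note sm = jk_norm_summable[OF \<alpha> \<beta> lt]
  have "norm (\<Sum>N. jk_term \<alpha> \<beta> N (arg1 t \<phi> z) (arg2 t \<phi> z)) \<le> (\<Sum>N. norm (jk_term \<alpha> \<beta> N (arg1 t \<phi> z) (arg2 t \<phi> z)))"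
    by (rule summable_norm[OF sm])
  also have "\<dots> \<le> (\<Sum>N. jk_term \<alpha> \<beta> N (norm (arg1 t \<phi> z)) (norm (arg2 t \<phi> z)))"
    by (intro suminf_le jk_term_norm_le \<alpha> \<beta> sm jk_summable_real lt) auto
  finally show ?thesis
    using prefac_nonneg[OF assms(1)] by (simp add: kernel_def norm_mult mult_left_mono)
qed

lemma prefac_le: "0 < t \<Longrightarrow> t \<le> 1 \<Longrightarrow> prefac t \<le> 2 * t"
proof -
  assume t: "0 < t" "t \<le> 1"
  have "2 * cosh (t/2) \<ge> 1" using cosh_real_ge_1[of "t/2"] by simp
  hence "(2 * cosh (t/2)) powr (-s) \<le> 1"
    using powr_mono[of "-s" 0 "2 * cosh (t/2)"] \<alpha> \<beta> by simp
  moreover have "2 * sinh (t/2) \<le> 2 * t" using sinh_real_le[of "t/2"] t by simp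
  ultimately show ?thesis
    unfolding prefac_def using t mult_mono[of "2 * sinh (t/2)" "2 * t" "(2 * cosh (t/2)) powr (-s)" 1] by simp
qed

definition majorant :: "real \<Rightarrow> real \<Rightarrow> real \<Rightarrow> real" where
  "majorant t \<theta> \<phi> = t / (t\<^sup>2 + (\<theta> - \<phi>)\<^sup>2) * (t\<^sup>2 + \<theta>\<^sup>2 + \<phi>\<^sup>2) powr (-\<alpha>-1/2) *
     (t\<^sup>2 + (pi - \<theta>)\<^sup>2 + (pi - \<phi>)\<^sup>2) powr (-\<beta>-1/2)"

lemma kernel_small_t:
  obtains C where "C > 0"
    "\<And>t \<theta> \<phi> z. 0 < t \<Longrightarrow> t \<le> 1 \<Longrightarrow> \<theta> \<in> {0<..<pi} \<Longrightarrow> \<phi> \<in> {0<..<pi} \<Longrightarrow>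
      norm (z - of_real \<theta>) \<le> sqrt (t\<^sup>2 + (\<theta> - \<phi>)\<^sup>2) / 16 \<Longrightarrow>
      z \<in> region t \<phi> \<and> norm (kernel t \<phi> z) \<le> C * majorant t \<theta> \<phi>"
proof -
  obtain C where C: "C > 0"
   "\<And>x y. x \<ge> 0 \<Longrightarrow> y \<ge> 0 \<Longrightarrow> x + y < 1 \<Longrightarrow> (\<Sum>N. jk_term \<alpha> \<beta> N x (y::real)) \<le>
      C / (1 - x - y) * (1 - x - y + x) powr (-\<alpha>-1/2) * (1 - x - y + y) powr (-\<beta>-1/2)"
    using jk_majorant[OF \<alpha> \<beta>] by metis
  define M1 M2 where "M1 = 10000 powr \<bar>-\<alpha>-1/2\<bar>" and "M2 = 10000 powr \<bar>-\<beta>-1/2\<bar>"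
  have M: "M1 > 0" "M2 > 0" by (auto simp: M1_def M2_def)
  \<comment> \<open>512 is the product of 2 from \<open>prefac_le\<close> and 256 from the lower
    bound for the gap.\<close>
  have main: "z \<in> region t \<phi> \<and> norm (kernel t \<phi> z) \<le> (512 * C * M1 * M2) * majorant t \<theta> \<phi>"
    if t: "0 < t" "t \<le> 1" and th: "\<theta> \<in> {0<..<pi}" "\<phi> \<in> {0<..<pi}"
      and z: "norm (z - of_real \<theta>) \<le> sqrt (t\<^sup>2 + (\<theta> - \<phi>)\<^sup>2) / 16" for t \<theta> \<phi> :: real and z
  proof -
    define x y where "x = norm (arg1 t \<phi> z)" and "y = norm (arg2 t \<phi> z)"
    define q2 A B where "q2 = t\<^sup>2 + (\<theta> - \<phi>)\<^sup>2" and "A = t\<^sup>2 + \<theta>\<^sup>2 + \<phi>\<^sup>2" and "B = t\<^sup>2 + (pi - \<theta>)\<^sup>2 + (pi - \<phi>)\<^sup>2"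
    have pos: "q2 > 0" "A > 0" "B > 0" using t by (auto simp: q2_def A_def B_def intro!: add_pos_nonneg)
    note geo = disc_geometry[OF t th z, folded norm_args[OF th(2)], folded x_def y_def, folded q2_def A_def B_def]
    have xy: "x \<ge> 0" "y \<ge> 0" by (simp_all add: x_def y_def)
    have d: "1 - x - y > 0" using geo(1) pos by linarith
    hence reg: "z \<in> region t \<phi>" by (simp add: region_def x_def y_def)
    have "norm (kernel t \<phi> z) \<le> prefac t * (\<Sum>N. jk_term \<alpha> \<beta> N x y)"
      unfolding x_def y_def by (rule norm_kernel_le[OF t(1) reg])
    also have "\<dots> \<le> (2 * t) * (C / (q2/256) * (M1 * A powr (-\<alpha>-1/2)) * (M2 * B powr (-\<beta>-1/2)))"
    proof (rule mult_mono)
      have "(\<Sum>N. jk_term \<alpha> \<beta> N x y) \<le> C / (1 - x - y) * (1 - x - y + x) powr (-\<alpha>-1/2) * (1 - x - y + y) powr (-\<beta>-1/2)"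
        using C(2)[OF xy] d by simp
      also have "\<dots> \<le> C / (q2/256) * (M1 * A powr (-\<alpha>-1/2)) * (M2 * B powr (-\<beta>-1/2))"
      proof (intro mult_mono)
        show "C / (1 - x - y) \<le> C / (q2/256)" using C pos geo(1) d by (intro divide_left_mono) auto
        show "(1 - x - y + x) powr (-\<alpha>-1/2) \<le> M1 * A powr (-\<alpha>-1/2)"
          unfolding M1_def using geo(2,3) pos d xy by (intro powr_comparable) auto
        show "(1 - x - y + y) powr (-\<beta>-1/2) \<le> M2 * B powr (-\<beta>-1/2)"
          unfolding M2_def using geo(4,5) pos d xy by (intro powr_comparable) auto
      qed (use C M pos d in auto)
      finally show "(\<Sum>N. jk_term \<alpha> \<beta> N x y) \<le> C / (q2/256) * (M1 * A powr (-\<alpha>-1/2)) * (M2 * B powr (-\<beta>-1/2))" .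
      show "0 \<le> (\<Sum>N. jk_term \<alpha> \<beta> N x y)"
        using xy d by (intro suminf_nonneg jk_summable_real jk_term_nonneg \<alpha> \<beta>) auto
    qed (use prefac_le t in auto)
    also have "\<dots> = (512 * C * M1 * M2) * majorant t \<theta> \<phi>"
      unfolding majorant_def q2_def[symmetric] A_def[symmetric] B_def[symmetric] by simp
    finally show ?thesis using reg by blast
  qed
  show ?thesis by (rule that[of "512 * C * M1 * M2"]) (use main C M in auto)
qed

text \<open>Needed to absorb \<open>corr t\<close>, which is O(t). Writing \<open>A\<close> and
  \<open>B\<close> for the two weights, \<open>q2 \<le> 2A\<close> and \<open>q2 \<le> 2B\<close>
  give \<open>q2 \<le> 2 sqrt (A B)\<close>, so the majorant is at least \<open>t/2\<close> times
  powers of \<open>A\<close> and \<open>B\<close> with negative exponents \<open>-\<alpha>-1\<close>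
  and \<open>-\<beta>-1\<close>. Both weights are at most \<open>33 = 1 + 16 + 16\<close>, as
  \<open>pi < 4\<close>.\<close>

lemma majorant_ge:
  obtains c where "c > 0"
    "\<And>t \<theta> \<phi>. 0 < t \<Longrightarrow> t \<le> 1 \<Longrightarrow> \<theta> \<in> {0<..<pi} \<Longrightarrow> \<phi> \<in> {0<..<pi} \<Longrightarrow> c * t \<le> majorant t \<theta> \<phi>"
proof -
  define c where "c = 1/2 * (33 powr (-\<alpha>-1) * 33 powr (-\<beta>-1))"
  have main: "c * t \<le> majorant t \<theta> \<phi>" if t: "0 < t" "t \<le> 1" and th: "\<theta> \<in> {0<..<pi}" "\<phi> \<in> {0<..<pi}" for t \<theta> \<phi> :: real
  proof -
    define q2 A B where "q2 = t\<^sup>2 + (\<theta> - \<phi>)\<^sup>2" and "A = t\<^sup>2 + \<theta>\<^sup>2 + \<phi>\<^sup>2" and "B = t\<^sup>2 + (pi - \<theta>)\<^sup>2 + (pi - \<phi>)\<^sup>2"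
    have pos: "q2 > 0" "A > 0" "B > 0" using t by (auto simp: q2_def A_def B_def intro!: add_pos_nonneg)
    have sq: "t\<^sup>2 \<le> 1" using t by (simp add: power_le_one)
    have sq': "x\<^sup>2 \<le> 4\<^sup>2" if "x \<in> {0<..<pi}" for x :: real
      using that pi_less_4 by (intro power_mono) auto
    have AB: "A \<le> 33" "B \<le> 33"
      using sq sq'[OF th(1)] sq'[OF th(2)] sq'[of "pi - \<theta>"] sq'[of "pi - \<phi>"] th by (auto simp: A_def B_def)
    have tri: "(u - v)\<^sup>2 \<le> 2 * u\<^sup>2 + 2 * v\<^sup>2" for u v :: real
      using zero_le_power2[of "u + v"] by (simp add: power2_eq_square algebra_simps)
    have "q2 \<le> 2 * A" unfolding q2_def A_def distrib_left using tri[of \<theta> \<phi>] zero_le_power2[of t] by linarith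
    moreover have "q2 \<le> 2 * B" 
    proof -
      have "(\<theta> - \<phi>)\<^sup>2 \<le> 2 * (pi - \<phi>)\<^sup>2 + 2 * (pi - \<theta>)\<^sup>2" using tri[of "pi - \<phi>" "pi - \<theta>"] by simp
      thus ?thesis unfolding q2_def B_def distrib_left using zero_le_power2[of t] by linarith
    qed
    ultimately have "q2 * q2 \<le> (2 * A) * (2 * B)" using pos by (intro mult_mono) auto
    hence "sqrt (q2 * q2) \<le> sqrt ((2 * A) * (2 * B))" by (rule real_sqrt_le_mono)
    also have "sqrt ((2 * A) * (2 * B)) = 2 * (sqrt A * sqrt B)" by (simp add: real_sqrt_mult)
    finally have q: "q2 \<le> 2 * (A powr (1/2) * B powr (1/2))" using pos by (simp add: powr_half_sqrt)
    have "c = 1/2 * (33 powr (-\<alpha>-1) * 33 powr (-\<beta>-1))" by (simp add: c_def)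
    also have "\<dots> \<le> 1/2 * (A powr (-\<alpha>-1) * B powr (-\<beta>-1))"
      using pos AB \<alpha> \<beta> by (intro mult_left_mono mult_mono powr_mono2') auto
    also have "\<dots> = 1 / (2 * (A powr (1/2) * B powr (1/2))) * (A powr (-\<alpha>-1/2) * B powr (-\<beta>-1/2))"
    proof -
      have "A powr (-\<alpha>-1/2) = A powr (-\<alpha>-1) * A powr (1/2)" "B powr (-\<beta>-1/2) = B powr (-\<beta>-1) * B powr (1/2)"
        by (simp_all add: algebra_simps flip: powr_add)
      thus ?thesis using pos by simp
    qed
    also have "\<dots> \<le> 1 / q2 * (A powr (-\<alpha>-1/2) * B powr (-\<beta>-1/2))"
      using q pos by (intro mult_right_mono divide_left_mono) auto
    finally have "t * c \<le> t * (1 / q2 * (A powr (-\<alpha>-1/2) * B powr (-\<beta>-1/2)))"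
      using t by (intro mult_left_mono) auto
    thus ?thesis unfolding majorant_def q2_def[symmetric] A_def[symmetric] B_def[symmetric] by (simp add: mult_ac)
  qed
  show ?thesis by (rule that[of c]) (use main in \<open>auto simp: c_def\<close>)
qed

text \<open>For \<open>\<tau> < 0\<close> the difference of exponentials is
  \<open>-2 sinh (t * \<bar>\<tau>\<bar>)\<close>, and \<open>\<bar>\<tau>\<bar> \<le> 1/2\<close>
  keeps the argument in the range of the linear bound.\<close>

lemma corr_le:
  assumes "0 < t" "t \<le> 1"
  shows "\<bar>corr t\<bar> \<le> 2 * (jacobi_c \<alpha> \<beta> 0)\<^sup>2 * t"
proof -
  define \<tau> where "\<tau> = jacobi_tau \<alpha> \<beta>"
  have "\<bar>exp (- t * \<bar>\<tau>\<bar>) - exp (- t * \<tau>)\<bar> \<le> 2 * t"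
  proof (cases "\<tau> \<ge> 0")
    case False
    have b: "0 \<le> t * \<bar>\<tau>\<bar>" "t * \<bar>\<tau>\<bar> \<le> t * (1/2)"
    proof -
      have "\<bar>\<tau>\<bar> \<le> 1/2" using tau_gt False unfolding \<tau>_def[symmetric] by linarith
      thus "0 \<le> t * \<bar>\<tau>\<bar>" "t * \<bar>\<tau>\<bar> \<le> t * (1/2)" using assms by (intro mult_left_mono mult_nonneg_nonneg; simp)+
    qed
    have "sinh (t * \<bar>\<tau>\<bar>) \<le> 2 * (t * \<bar>\<tau>\<bar>)" using b assms by (intro sinh_real_le) linarith+
    hence "exp (t * \<bar>\<tau>\<bar>) - exp (- (t * \<bar>\<tau>\<bar>)) \<le> 2 * t" using b by (simp add: sinh_field_def)
    moreover have "exp (- (t * \<bar>\<tau>\<bar>)) \<le> exp (t * \<bar>\<tau>\<bar>)" using b(1) by (subst exp_le_cancel_iff) linarith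
    ultimately show ?thesis using False by simp
  qed (use assms in auto)
  hence "\<bar>exp (- t * \<bar>\<tau>\<bar>) - exp (- t * \<tau>)\<bar> * (jacobi_c \<alpha> \<beta> 0)\<^sup>2 \<le> 2 * t * (jacobi_c \<alpha> \<beta> 0)\<^sup>2"
    by (intro mult_right_mono) auto
  thus ?thesis unfolding corr_def \<tau>_def[symmetric] by (simp add: abs_mult mult_ac)
qed

theorem poisson_small_t:
  "\<exists>C>0. \<forall>t \<theta> \<phi>. 0 < t \<and> t \<le> 1 \<and> \<theta> \<in> {0<..<pi} \<and> \<phi> \<in> {0<..<pi} \<longrightarrow>
        \<bar>(deriv ^^ j) (\<lambda>x. jacobi_poisson \<alpha> \<beta> t x \<phi>) \<theta>\<bar>
          \<le> C * (t\<^sup>2 + \<theta>\<^sup>2 + \<phi>\<^sup>2) powr (- \<alpha> - 1/2)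
              * (t\<^sup>2 + (pi - \<theta>)\<^sup>2 + (pi - \<phi>)\<^sup>2) powr (- \<beta> - 1/2)
              * (t / (t\<^sup>2 + (\<theta> - \<phi>)\<^sup>2) powr (1 + real j / 2))"
proof -
  obtain C where C: "C > 0"
    "\<And>t \<theta> \<phi> z. 0 < t \<Longrightarrow> t \<le> 1 \<Longrightarrow> \<theta> \<in> {0<..<pi} \<Longrightarrow> \<phi> \<in> {0<..<pi} \<Longrightarrow>
      norm (z - of_real \<theta>) \<le> sqrt (t\<^sup>2 + (\<theta> - \<phi>)\<^sup>2) / 16 \<Longrightarrow>
      z \<in> region t \<phi> \<and> norm (kernel t \<phi> z) \<le> C * majorant t \<theta> \<phi>"
    using kernel_small_t by metis
  obtain c where c: "c > 0"
    "\<And>t \<theta> \<phi>. 0 < t \<Longrightarrow> t \<le> 1 \<Longrightarrow> \<theta> \<in> {0<..<pi} \<Longrightarrow> \<phi> \<in> {0<..<pi} \<Longrightarrow> c * t \<le> majorant t \<theta> \<phi>"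
    using majorant_ge by metis
  \<comment> \<open>The second summand pays for \<open>corr t\<close> by means of
    \<open>c * t \<le> majorant t \<theta> \<phi>\<close>.\<close>
  define D where "D = C + 2 * (jacobi_c \<alpha> \<beta> 0)\<^sup>2 / c"
  have D: "D > 0" using C c by (simp add: D_def add_pos_nonneg)
  show ?thesis
  proof (intro exI[of _ "fact j * D * 16 ^ j"] conjI allI impI)
    show "fact j * D * 16 ^ j > 0" using D by simp
    fix t \<theta> \<phi> :: real assume "0 < t \<and> t \<le> 1 \<and> \<theta> \<in> {0<..<pi} \<and> \<phi> \<in> {0<..<pi}"
    hence t: "0 < t" "t \<le> 1" and th: "\<theta> \<in> {0<..<pi}" "\<phi> \<in> {0<..<pi}" by auto
    define q2 where "q2 = t\<^sup>2 + (\<theta> - \<phi>)\<^sup>2"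
    have q2: "q2 > 0" using t by (auto simp: q2_def intro!: add_pos_nonneg)
    define r where "r = sqrt q2 / 16"
    have r: "r > 0" using q2 by (simp add: r_def)
    define F where "F = (\<lambda>z. kernel t \<phi> z + of_real (corr t + 0))"
    have cball: "z \<in> region t \<phi> \<and> norm (kernel t \<phi> z) \<le> C * majorant t \<theta> \<phi>" if "z \<in> cball (of_real \<theta>) r" for z
      using that C(2)[OF t th, of z] by (simp add: r_def q2_def dist_norm norm_minus_commute)
    have hol: "F holomorphic_on region t \<phi>"
      unfolding F_def by (intro holomorphic_on_add kernel_holomorphic holomorphic_on_const)
    have bd: "norm (F z) \<le> D * majorant t \<theta> \<phi>" if "z \<in> cball (of_real \<theta>) r" for z
    proof -
      have "\<bar>corr t\<bar> \<le> 2 * (jacobi_c \<alpha> \<beta> 0)\<^sup>2 / c * (c * t)" using corr_le[OF t] c by simp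
      also have "\<dots> \<le> 2 * (jacobi_c \<alpha> \<beta> 0)\<^sup>2 / c * majorant t \<theta> \<phi>" using c t th by (intro mult_left_mono) auto
      finally have "\<bar>corr t\<bar> \<le> 2 * (jacobi_c \<alpha> \<beta> 0)\<^sup>2 / c * majorant t \<theta> \<phi>" .
      moreover have "norm (F z) \<le> norm (kernel t \<phi> z) + \<bar>corr t\<bar>"
        unfolding F_def using norm_triangle_ineq[of "kernel t \<phi> z" "of_real (corr t)"] by simp
      ultimately show ?thesis using cball[OF that] unfolding D_def by (simp add: distrib_right)
    qed
    have "\<bar>(deriv ^^ j) (\<lambda>x. jacobi_poisson \<alpha> \<beta> t x \<phi>) \<theta>\<bar> = norm ((deriv ^^ j) F (of_real \<theta>))"
      unfolding F_def by (rule higher_deriv_jacobi_poisson[OF t(1) th]) simp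
    \<comment> \<open>The bound on the circle is stated at the centre \<open>\<theta>\<close>, so
      Cauchy's estimate only adds \<open>r ^ j\<close>, which is \<open>sqrt q2 ^ j\<close> up to
      \<open>16 ^ j\<close>.\<close>
    also have "\<dots> \<le> fact j * (D * majorant t \<theta> \<phi>) / r ^ j"
    proof (rule Cauchy_inequality[OF _ _ r])
      show "F holomorphic_on ball (of_real \<theta>) r" by (rule holomorphic_on_subset[OF hol]) (use cball in auto)
      show "continuous_on (cball (of_real \<theta>) r) F"
        by (rule holomorphic_on_imp_continuous_on[OF holomorphic_on_subset[OF hol]]) (use cball in auto)
      show "norm (F x) \<le> D * majorant t \<theta> \<phi>" if "norm (of_real \<theta> - x) = r" for x
        using bd[of x] that by (simp add: dist_norm)
    qed
    also have "\<dots> = fact j * D * 16 ^ j * (t\<^sup>2 + \<theta>\<^sup>2 + \<phi>\<^sup>2) powr (- \<alpha> - 1/2)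
              * (t\<^sup>2 + (pi - \<theta>)\<^sup>2 + (pi - \<phi>)\<^sup>2) powr (- \<beta> - 1/2) * (t / q2 powr (1 + real j / 2))"
    proof -
      have "q2 powr (1 + real j / 2) = q2 * sqrt q2 ^ j"
        using q2 by (simp add: powr_add powr_half_sqrt_powr[symmetric] powr_realpow[symmetric] powr_half_sqrt[symmetric] powr_powr)
      thus ?thesis unfolding majorant_def q2_def[symmetric] r_def by (simp add: power_divide)
    qed
    finally show "\<bar>(deriv ^^ j) (\<lambda>x. jacobi_poisson \<alpha> \<beta> t x \<phi>) \<theta>\<bar>
          \<le> fact j * D * 16 ^ j * (t\<^sup>2 + \<theta>\<^sup>2 + \<phi>\<^sup>2) powr (- \<alpha> - 1/2)
              * (t\<^sup>2 + (pi - \<theta>)\<^sup>2 + (pi - \<phi>)\<^sup>2) powr (- \<beta> - 1/2)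
              * (t / (t\<^sup>2 + (\<theta> - \<phi>)\<^sup>2) powr (1 + real j / 2))" unfolding q2_def .
  qed
qed

section \<open>The range of large times\<close>

definition kernel_const :: "real \<Rightarrow> real" where
  "kernel_const t = prefac t * jk_coeff \<alpha> \<beta> 0 0"

text \<open>The term \<open>N = 0\<close> is constant in \<open>z\<close> and only of order
  \<open>exp (-t \<tau>)\<close>, so it is subtracted. The remaining terms are those of the series
  at \<open>t = 1\<close>, rescaled by \<open>\<kappa> = cosh (1/2) / cosh (t/2)\<close>, and gain
  \<open>\<kappa>^2\<close>, which is of order \<open>exp (-t)\<close>. A fixed radius 1/4 suffices
  because the gap at \<open>t = 1\<close> is bounded below.\<close>

lemma kernel_large_t:
  obtains M where "M > 0"
    "\<And>t \<theta> \<phi> z. t \<ge> 1 \<Longrightarrow> \<theta> \<in> {0<..<pi} \<Longrightarrow> \<phi> \<in> {0<..<pi} \<Longrightarrow> norm (z - of_real \<theta>) \<le> 1/4 \<Longrightarrow>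
      z \<in> region t \<phi> \<and> norm (kernel t \<phi> z - of_real (kernel_const t)) \<le> M * exp (- t * (jacobi_tau \<alpha> \<beta> + 1))"
proof -
  obtain C where C: "C > 0"
   "\<And>x y. x \<ge> 0 \<Longrightarrow> y \<ge> 0 \<Longrightarrow> x + y < 1 \<Longrightarrow> (\<Sum>N. jk_term \<alpha> \<beta> N x (y::real)) \<le>
      C / (1 - x - y) * (1 - x - y + x) powr (-\<alpha>-1/2) * (1 - x - y + y) powr (-\<beta>-1/2)"
    using jk_majorant[OF \<alpha> \<beta>] by metis
  define K1 where "K1 = cosh (1/2 :: real)"
  define G where "G = C / (1/12) * 12 powr \<bar>-\<alpha>-1/2\<bar> * 12 powr \<bar>-\<beta>-1/2\<bar>"
  have G: "G > 0" using C by (simp add: G_def)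
  have K1: "K1 \<ge> 9/8" using cosh_real_ge[of "1/2"] by (simp add: K1_def power2_eq_square)
  have main: "z \<in> region t \<phi> \<and> norm (kernel t \<phi> z - of_real (kernel_const t)) \<le> (4 * K1\<^sup>2 * G) * exp (- t * (jacobi_tau \<alpha> \<beta> + 1))"
    if t: "t \<ge> 1" and th: "\<theta> \<in> {0<..<pi}" "\<phi> \<in> {0<..<pi}" and z: "norm (z - of_real \<theta>) \<le> 1/4" for t \<theta> \<phi> :: real and z
  proof -
    have t0: "t > 0" using t by simp
    define K where "K = cosh (t/2)"
    define a b S C' where "a = norm (sin (z/2))" and "b = norm (cos (z/2))" and "S = sin (\<phi>/2)" and "C' = cos (\<phi>/2)"
    have nn: "a \<ge> 0" "b \<ge> 0" "S > 0" "C' > 0" using half_angle_products[OF th(2) th(2)] by (auto simp: a_def b_def S_def C'_def)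
    have KK: "K1 \<le> K" unfolding K_def K1_def using t by (simp add: cosh_real_nonneg_le_iff)
    have K0: "K > 0" "K1 > 0" using KK K1 by auto
    have Im: "\<bar>Im z\<bar> \<le> 1/4" using abs_Im_le_cmod[of "z - of_real \<theta>"] z by simp
    hence "(Im z)\<^sup>2 \<le> 1/16" using power_mono[of "\<bar>Im z\<bar>" "1/4" 2] by (simp add: power2_eq_square)
    hence c: "cosh (Im z) \<le> 17/16" using cosh_real_le[of "Im z"] Im by simp
    have "a\<^sup>2 + b\<^sup>2 = cosh (Im z)" using norm_sin_cos_squared[of "z/2"] by (simp add: a_def b_def)
    \<comment> \<open>\<open>33/32 = (1 + 17/16)/2\<close>; the 11/12 below is its quotient by the
      bound \<open>9/8 \<le> K1\<close>, and leaves a gap of 1/12.\<close>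
    from gap_identity[OF this, of S C' 0] have "a * S + b * C' \<le> 33/32"
      using c zero_le_power2[of "a - S"] zero_le_power2[of "b - C'"] sin_cos_squared_add[of "\<phi>/2"]
      unfolding S_def C'_def by linarith
    also have "33/32 \<le> 11/12 * K1" using K1 by simp
    finally have uv: "a * S + b * C' \<le> 11/12 * K1" .
    define x1 y1 where "x1 = a * S / K1" and "y1 = b * C' / K1"
    have xy1: "x1 \<ge> 0" "y1 \<ge> 0" using nn K0 by (auto simp: x1_def y1_def)
    have "x1 + y1 = (a * S + b * C') / K1" by (simp add: x1_def y1_def add_divide_distrib)
    hence d: "x1 + y1 \<le> 11/12" using uv K0 by (simp add: pos_divide_le_eq)
    define \<kappa> where "\<kappa> = K1 / K"
    have \<kappa>: "0 < \<kappa>" "\<kappa> \<le> 1" using KK K0 by (auto simp: \<kappa>_def)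
    have n: "norm (arg1 t \<phi> z) = \<kappa> * x1" "norm (arg2 t \<phi> z) = \<kappa> * y1"
      unfolding norm_args[OF th(2)] using K0 by (simp_all add: \<kappa>_def x1_def y1_def a_def b_def S_def C'_def K_def)
    have "\<kappa> * x1 + \<kappa> * y1 \<le> 1 * (11/12)"
      unfolding distrib_left[symmetric] using d \<kappa> xy1 by (intro mult_mono) auto
    hence lt: "norm (arg1 t \<phi> z) + norm (arg2 t \<phi> z) < 1" unfolding n by simp
    hence reg: "z \<in> region t \<phi>" by (simp add: region_def)
    have sum1: "(\<Sum>N. jk_term \<alpha> \<beta> N x1 y1) \<le> G"
    proof -
      have "(\<Sum>N. jk_term \<alpha> \<beta> N x1 y1) \<le> C / (1 - x1 - y1) * (1 - x1 - y1 + x1) powr (-\<alpha>-1/2) * (1 - x1 - y1 + y1) powr (-\<beta>-1/2)"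
        using C(2)[OF xy1] d by simp
      also have "\<dots> \<le> C / (1/12) * (12 powr \<bar>-\<alpha>-1/2\<bar> * 1 powr (-\<alpha>-1/2)) * (12 powr \<bar>-\<beta>-1/2\<bar> * 1 powr (-\<beta>-1/2))"
      proof (intro mult_mono)
        show "C / (1 - x1 - y1) \<le> C / (1/12)" using C d by (intro divide_left_mono) auto
        show "(1 - x1 - y1 + x1) powr (-\<alpha>-1/2) \<le> 12 powr \<bar>-\<alpha>-1/2\<bar> * 1 powr (-\<alpha>-1/2)"
             "(1 - x1 - y1 + y1) powr (-\<beta>-1/2) \<le> 12 powr \<bar>-\<beta>-1/2\<bar> * 1 powr (-\<beta>-1/2)"
          using d xy1 by (intro powr_comparable; simp)+
      qed (use C d in auto)
      finally show ?thesis by (simp add: G_def)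
    qed
    have sm1: "summable (\<lambda>N. jk_term \<alpha> \<beta> N x1 y1)" using d xy1 by (intro jk_summable_real \<alpha> \<beta>) auto
    have j0: "jk_term \<alpha> \<beta> 0 x1 y1 \<ge> 0" by (intro jk_term_nonneg \<alpha> \<beta> xy1)
    have sm: "summable (\<lambda>N. norm (jk_term \<alpha> \<beta> N (arg1 t \<phi> z) (arg2 t \<phi> z)))" by (rule jk_norm_summable[OF \<alpha> \<beta> lt])
    have "kernel t \<phi> z - of_real (kernel_const t) = of_real (prefac t) * (\<Sum>N. jk_term \<alpha> \<beta> (Suc N) (arg1 t \<phi> z) (arg2 t \<phi> z))"
      unfolding kernel_def kernel_const_def suminf_split_head[OF summable_norm_cancel[OF sm]]
      by (simp add: jk_term_def right_diff_distrib)
    hence "norm (kernel t \<phi> z - of_real (kernel_const t)) = prefac t * norm (\<Sum>N. jk_term \<alpha> \<beta> (Suc N) (arg1 t \<phi> z) (arg2 t \<phi> z))"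
      using prefac_nonneg[OF t0] by (simp add: norm_mult)
    also have "norm (\<Sum>N. jk_term \<alpha> \<beta> (Suc N) (arg1 t \<phi> z) (arg2 t \<phi> z)) \<le> \<kappa>\<^sup>2 * G"
    proof -
      have smS: "summable (\<lambda>N. norm (jk_term \<alpha> \<beta> (Suc N) (arg1 t \<phi> z) (arg2 t \<phi> z)))" using sm by (subst summable_Suc_iff)
      have sm1S: "summable (\<lambda>N. jk_term \<alpha> \<beta> (Suc N) x1 y1)" using sm1 by (subst summable_Suc_iff)
      have "norm (\<Sum>N. jk_term \<alpha> \<beta> (Suc N) (arg1 t \<phi> z) (arg2 t \<phi> z)) \<le> (\<Sum>N. norm (jk_term \<alpha> \<beta> (Suc N) (arg1 t \<phi> z) (arg2 t \<phi> z)))"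
        by (rule summable_norm[OF smS])
      also have "\<dots> \<le> (\<Sum>N. \<kappa>\<^sup>2 * jk_term \<alpha> \<beta> (Suc N) x1 y1)"
      proof (rule suminf_le[OF _ smS summable_mult[OF sm1S]])
        fix N
        have "norm (jk_term \<alpha> \<beta> (Suc N) (arg1 t \<phi> z) (arg2 t \<phi> z)) \<le> jk_term \<alpha> \<beta> (Suc N) (\<kappa> * x1) (\<kappa> * y1)"
          unfolding n[symmetric] by (rule jk_term_norm_le[OF \<alpha> \<beta>])
        also have "\<dots> = \<kappa> ^ (2 * Suc N) * jk_term \<alpha> \<beta> (Suc N) x1 y1" by (rule jk_term_scale)
        also have "\<dots> \<le> \<kappa>\<^sup>2 * jk_term \<alpha> \<beta> (Suc N) x1 y1"
          using \<kappa> xy1 by (intro mult_right_mono power_decreasing jk_term_nonneg \<alpha> \<beta>) auto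
        finally show "norm (jk_term \<alpha> \<beta> (Suc N) (arg1 t \<phi> z) (arg2 t \<phi> z)) \<le> \<kappa>\<^sup>2 * jk_term \<alpha> \<beta> (Suc N) x1 y1" .
      qed
      also have "\<dots> = \<kappa>\<^sup>2 * (\<Sum>N. jk_term \<alpha> \<beta> (Suc N) x1 y1)" by (rule suminf_mult[OF sm1S])
      also have "(\<Sum>N. jk_term \<alpha> \<beta> (Suc N) x1 y1) \<le> (\<Sum>N. jk_term \<alpha> \<beta> N x1 y1)"
        using suminf_split_head[OF sm1] j0 by simp
      also note sum1
      finally show ?thesis by (simp add: mult_left_mono)
    qed
    also have "prefac t * (\<kappa>\<^sup>2 * G) \<le> (exp (t/2) * exp (t/2) powr (-s)) * ((4 * K1\<^sup>2 * exp (-t)) * G)"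
    proof (intro mult_mono mult_right_mono)
      have K2: "exp (t/2) \<le> 2 * K" by (simp add: K_def cosh_field_def)
      have "2 * sinh (t/2) \<le> exp (t/2)" by (simp add: sinh_field_def)
      moreover have "(2 * K) powr (-s) \<le> exp (t/2) powr (-s)" using K2 \<alpha> \<beta> by (intro powr_mono2') auto
      ultimately show "prefac t \<le> exp (t/2) * exp (t/2) powr (-s)"
        unfolding prefac_def K_def[symmetric] using t by (intro mult_mono) auto
      have "(exp (t/2))\<^sup>2 \<le> (2 * K)\<^sup>2" using K2 by (intro power_mono) auto
      hence e: "exp t \<le> 4 * K\<^sup>2" by (simp add: power_mult_distrib flip: exp_double)
      have "\<kappa>\<^sup>2 = 4 * K1\<^sup>2 * (1 / (4 * K\<^sup>2))" by (simp add: \<kappa>_def power_divide)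
      also have "\<dots> \<le> 4 * K1\<^sup>2 * (1 / exp t)" using e K0 by (intro mult_left_mono divide_left_mono) auto
      finally show "\<kappa>\<^sup>2 \<le> 4 * K1\<^sup>2 * exp (-t)" by (simp add: exp_minus divide_inverse)
    qed (use G \<kappa> prefac_nonneg[OF t0] in auto)
    also have "\<dots> = (4 * K1\<^sup>2 * G) * exp (- t * (jacobi_tau \<alpha> \<beta> + 1))"
    proof -
      have e: "- t * (jacobi_tau \<alpha> \<beta> + 1) = t/2 + (t/2) * (-s) + (-t)"
        by (simp add: jacobi_tau_def algebra_simps add_divide_distrib)
      have "exp (t/2) powr (-s) = exp ((t/2) * (-s))" by (simp only: powr_def exp_not_eq_zero if_False ln_exp mult.commute)
      thus ?thesis unfolding e exp_add by simp
    qed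
    finally show ?thesis using reg prefac_nonneg[OF t0] by (simp add: mult_left_mono)
  qed
  show ?thesis by (rule that[of "4 * K1\<^sup>2 * G"]) (use main G K1 in auto)
qed

text \<open>\<open>g\<close> and \<open>c\<close> are quantified after \<open>C\<close>, so one
  constant covers both kernels although \<open>c\<close> depends on \<open>t\<close>.\<close>

lemma poisson_deriv_large_t:
  assumes "j > 0"
  shows "\<exists>C>0. \<forall>t \<theta> \<phi> g c. t \<ge> 1 \<and> \<theta> \<in> {0<..<pi} \<and> \<phi> \<in> {0<..<pi} \<and>
     (\<forall>x\<in>{0<..<pi}. g x = jacobi_poisson \<alpha> \<beta> t x \<phi> + c) \<longrightarrow> \<bar>(deriv ^^ j) g \<theta>\<bar> \<le> C * exp (- t * (jacobi_tau \<alpha> \<beta> + 1))"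
proof -
  obtain M where M: "M > 0"
    "\<And>t \<theta> \<phi> z. t \<ge> 1 \<Longrightarrow> \<theta> \<in> {0<..<pi} \<Longrightarrow> \<phi> \<in> {0<..<pi} \<Longrightarrow> norm (z - of_real \<theta>) \<le> 1/4 \<Longrightarrow>
      z \<in> region t \<phi> \<and> norm (kernel t \<phi> z - of_real (kernel_const t)) \<le> M * exp (- t * (jacobi_tau \<alpha> \<beta> + 1))"
    using kernel_large_t by metis
  show ?thesis
  proof (intro exI[of _ "fact j * (2 * M) * 4 ^ j"] conjI allI impI)
    show "fact j * (2 * M) * 4 ^ j > 0" using M by simp
    fix t \<theta> \<phi> c :: real and g assume asm: "t \<ge> 1 \<and> \<theta> \<in> {0<..<pi} \<and> \<phi> \<in> {0<..<pi} \<and> (\<forall>x\<in>{0<..<pi}. g x = jacobi_poisson \<alpha> \<beta> t x \<phi> + c)"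
    hence t: "t \<ge> 1" "t > 0" and th: "\<theta> \<in> {0<..<pi}" "\<phi> \<in> {0<..<pi}" by auto
    define F where "F = (\<lambda>z. kernel t \<phi> z + of_real (corr t + c))"
    define e where "e = exp (- t * (jacobi_tau \<alpha> \<beta> + 1))"
    have cball: "z \<in> region t \<phi> \<and> norm (kernel t \<phi> z - of_real (kernel_const t)) \<le> M * e" if "z \<in> cball (of_real \<theta>) (1/4)" for z
      using that M(2)[OF t(1) th, of z] by (simp add: e_def dist_norm norm_minus_commute)
    have hol: "F holomorphic_on region t \<phi>"
      unfolding F_def by (intro holomorphic_on_add kernel_holomorphic holomorphic_on_const)
    have "\<bar>(deriv ^^ j) g \<theta>\<bar> = norm ((deriv ^^ j) F (of_real \<theta>))"
      unfolding F_def by (rule higher_deriv_jacobi_poisson[OF t(2) th]) (use asm in auto)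
    also have "\<dots> \<le> fact j * (2 * M * e) / (1/4) ^ j"
    \<comment> \<open>This form of Cauchy's estimate measures \<open>F\<close> against a constant,
      which derivatives of positive order do not see. The factor 2 in \<open>2 * M\<close> makes the
      inequality strict for the open ball.\<close>
    proof (rule Cauchy_higher_deriv_bound[where y = "of_real (kernel_const t + corr t + c)"])
      show "F holomorphic_on ball (of_real \<theta>) (1/4)" by (rule holomorphic_on_subset[OF hol]) (use cball in auto)
      show "continuous_on (cball (of_real \<theta>) (1/4)) F"
        by (rule holomorphic_on_imp_continuous_on[OF holomorphic_on_subset[OF hol]]) (use cball in auto)
      fix w assume "w \<in> ball (complex_of_real \<theta>) (1/4)"
      hence "norm (kernel t \<phi> w - of_real (kernel_const t)) \<le> M * e" using cball[of w] by simp
      also have "\<dots> < 2 * M * e" using M by (simp add: e_def)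
      finally show "F w \<in> ball (of_real (kernel_const t + corr t + c)) (2 * M * e)"
        by (simp add: F_def dist_norm norm_minus_commute)
    qed (use assms in auto)
    finally show "\<bar>(deriv ^^ j) g \<theta>\<bar> \<le> fact j * (2 * M) * 4 ^ j * exp (- t * (jacobi_tau \<alpha> \<beta> + 1))"
      by (simp add: e_def power_one_over mult_ac)
  qed
qed

text \<open>For \<open>j = 0\<close> the additive constants matter, so instead of comparing
  \<open>kernel_const t\<close> with the term \<open>n = 0\<close> the tail \<open>n \<ge> 1\<close>
  of the series is estimated. There \<open>exp (-t (n + \<tau>)) \<le> exp (-(t - 1) (\<tau> + 1)) *
  exp (-(n + \<tau>))\<close>, and the last factor belongs to the kernel at
  \<open>t = 1\<close>.\<close>

lemma compensated_large_t:
  "\<exists>C>0. \<forall>t \<theta> \<phi>. t \<ge> 1 \<and> \<theta> \<in> {0<..<pi} \<and> \<phi> \<in> {0<..<pi} \<longrightarrow>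
     \<bar>compensated_jacobi_poisson \<alpha> \<beta> t \<theta> \<phi>\<bar> \<le> C * exp (- t * (jacobi_tau \<alpha> \<beta> + 1))"
proof -
  define \<tau> where "\<tau> = jacobi_tau \<alpha> \<beta>"
  obtain M where M: "M > 0"
    "\<And>t \<theta> \<phi> z. t \<ge> 1 \<Longrightarrow> \<theta> \<in> {0<..<pi} \<Longrightarrow> \<phi> \<in> {0<..<pi} \<Longrightarrow> norm (z - of_real \<theta>) \<le> 1/4 \<Longrightarrow>
      z \<in> region t \<phi> \<and> norm (kernel t \<phi> z - of_real (kernel_const t)) \<le> M * exp (- t * (\<tau> + 1))"
    unfolding \<tau>_def using kernel_large_t by metis
  \<comment> \<open>A bound for the series with exponents \<open>n + \<tau>\<close> at
    \<open>t = 1\<close> on the diagonal, uniform in the angle.\<close>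
  define V where "V = \<bar>kernel_const 1\<bar> + M * exp (- (\<tau> + 1))"
  have V: "V > 0" using M by (simp add: V_def add_nonneg_pos)
  define D where "D = (\<lambda>x n. exp (- 1 * (real n + \<tau>)) * (jacobi_fun \<alpha> \<beta> n x * jacobi_fun \<alpha> \<beta> n x))"
  have D0: "D x n \<ge> 0" for x n by (simp add: D_def)
  have diag: "summable (\<lambda>n. D x (Suc n)) \<and> (\<Sum>n. D x (Suc n)) \<le> V" if x: "x \<in> {0<..<pi}" for x
  proof -
    have s: "D x sums (prefac 1 * (\<Sum>N. kernel_term 1 x x N))"
      using kernel_closed_form[OF zero_less_one x x] unfolding D_def prefac_def \<tau>_def .
    have "norm (kernel 1 x (of_real x) - of_real (kernel_const 1)) \<le> M * exp (- 1 * (\<tau> + 1))"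
      using M(2)[of 1 x x "of_real x"] x by simp
    hence "\<bar>prefac 1 * (\<Sum>N. kernel_term 1 x x N) - kernel_const 1\<bar> \<le> M * exp (- (\<tau> + 1))"
      unfolding kernel_real(2)[OF zero_less_one x x] of_real_diff[symmetric] norm_of_real by simp
    hence "prefac 1 * (\<Sum>N. kernel_term 1 x x N) \<le> V" unfolding V_def by linarith
    moreover have "summable (D x)" using s by (simp add: sums_iff)
    ultimately show ?thesis using suminf_split_head[of "D x"] s D0[of x 0] by (simp add: sums_iff summable_Suc_iff)
  qed
  show ?thesis
  proof (intro exI[of _ "exp (\<tau> + 1) * (2 * V)"] conjI allI impI)
    show "exp (\<tau> + 1) * (2 * V) > 0" using V by simp
    fix t \<theta> \<phi> :: real assume "t \<ge> 1 \<and> \<theta> \<in> {0<..<pi} \<and> \<phi> \<in> {0<..<pi}"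
    hence t: "t \<ge> 1" "t > 0" and th: "\<theta> \<in> {0<..<pi}" "\<phi> \<in> {0<..<pi}" by auto
    define T where "T = (\<lambda>n. exp (- t * \<bar>real n + \<tau>\<bar>) * jacobi_fun \<alpha> \<beta> n \<theta> * jacobi_fun \<alpha> \<beta> n \<phi>)"
    have sT: "summable T" using jacobi_poisson_sums[OF t(2) th] by (simp add: T_def \<tau>_def sums_iff)
    have "compensated_jacobi_poisson \<alpha> \<beta> t \<theta> \<phi> = (\<Sum>n. T (Suc n))"
      using suminf_split_head[OF sT] by (simp add: compensated_jacobi_poisson_def jacobi_poisson_def T_def \<tau>_def)
    moreover have "norm (\<Sum>n. T (Suc n)) \<le> (\<Sum>n. exp (- (t - 1) * (\<tau> + 1)) * (D \<theta> (Suc n) + D \<phi> (Suc n)))"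
    proof (rule norm_suminf_le)
      show "summable (\<lambda>n. exp (- (t - 1) * (\<tau> + 1)) * (D \<theta> (Suc n) + D \<phi> (Suc n)))"
        using diag th by (intro summable_mult summable_add) auto
      fix n
      have pos: "real (Suc n) + \<tau> \<ge> \<tau> + 1" "\<tau> + 1 \<ge> 0" using tau_gt by (auto simp: \<tau>_def)
      have e: "exp (- t * \<bar>real (Suc n) + \<tau>\<bar>) \<le> exp (- (t - 1) * (\<tau> + 1)) * exp (- 1 * (real (Suc n) + \<tau>))"
      proof -
        have "(t - 1) * (\<tau> + 1) \<le> (t - 1) * (real (Suc n) + \<tau>)" using t pos by (intro mult_left_mono) auto
        hence "- t * \<bar>real (Suc n) + \<tau>\<bar> \<le> - (t - 1) * (\<tau> + 1) + - 1 * (real (Suc n) + \<tau>)"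
          using pos by (simp add: algebra_simps)
        thus ?thesis unfolding exp_add[symmetric] exp_le_cancel_iff .
      qed
      have "norm (T (Suc n)) = exp (- t * \<bar>real (Suc n) + \<tau>\<bar>) * \<bar>jacobi_fun \<alpha> \<beta> (Suc n) \<theta> * jacobi_fun \<alpha> \<beta> (Suc n) \<phi>\<bar>"
        by (simp add: T_def abs_mult)
      also have "\<dots> \<le> (exp (- (t - 1) * (\<tau> + 1)) * exp (- 1 * (real (Suc n) + \<tau>))) *
        (jacobi_fun \<alpha> \<beta> (Suc n) \<theta> * jacobi_fun \<alpha> \<beta> (Suc n) \<theta> + jacobi_fun \<alpha> \<beta> (Suc n) \<phi> * jacobi_fun \<alpha> \<beta> (Suc n) \<phi>)"
        by (intro mult_mono e abs_mult_le_squares) auto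
      also have "\<dots> = exp (- (t - 1) * (\<tau> + 1)) * (D \<theta> (Suc n) + D \<phi> (Suc n))"
        unfolding D_def by (simp only: distrib_left mult.assoc)
      finally show "norm (T (Suc n)) \<le> exp (- (t - 1) * (\<tau> + 1)) * (D \<theta> (Suc n) + D \<phi> (Suc n))" .
    qed
    moreover have "(\<Sum>n. exp (- (t - 1) * (\<tau> + 1)) * (D \<theta> (Suc n) + D \<phi> (Suc n))) \<le> exp (- (t - 1) * (\<tau> + 1)) * (2 * V)"
      using diag[OF th(1)] diag[OF th(2)] by (simp add: suminf_mult suminf_add[symmetric] summable_add)
    moreover have "exp (- (t - 1) * (\<tau> + 1)) = exp (\<tau> + 1) * exp (- t * (\<tau> + 1))"
      by (simp add: algebra_simps flip: exp_add)
    ultimately show "\<bar>compensated_jacobi_poisson \<alpha> \<beta> t \<theta> \<phi>\<bar> \<le> exp (\<tau> + 1) * (2 * V) * exp (- t * (jacobi_tau \<alpha> \<beta> + 1))"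
      by (simp add: \<tau>_def mult_ac)
  qed
qed

lemma exp_tau_le: "t \<ge> 1 \<Longrightarrow> c \<le> 1/2 \<Longrightarrow> exp (- t * (jacobi_tau \<alpha> \<beta> + 1)) \<le> exp (- c * t)"
proof -
  assume t: "t \<ge> 1" "c \<le> 1/2"
  have "c * t \<le> (jacobi_tau \<alpha> \<beta> + 1) * t" using t tau_gt by (intro mult_right_mono) auto
  thus ?thesis by (simp add: mult.commute)
qed

text \<open>The true rate is \<open>\<tau> + 1\<close>, which exceeds 1/2 for all
  \<open>\<alpha>, \<beta> > -1\<close>; hence 1/2 serves for every \<open>j\<close>.\<close>

theorem compensated_deriv_large_t:
  assumes "c \<le> 1/2"
  shows "\<exists>C>0. \<forall>t \<theta> \<phi>. t \<ge> 1 \<and> \<theta> \<in> {0<..<pi} \<and> \<phi> \<in> {0<..<pi} \<longrightarrow>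
    \<bar>(deriv ^^ j) (\<lambda>x. compensated_jacobi_poisson \<alpha> \<beta> t x \<phi>) \<theta>\<bar> \<le> C * exp (- c * t)"
proof -
  have "\<exists>C>0. \<forall>t \<theta> \<phi>. t \<ge> 1 \<and> \<theta> \<in> {0<..<pi} \<and> \<phi> \<in> {0<..<pi} \<longrightarrow>
    \<bar>(deriv ^^ j) (\<lambda>x. compensated_jacobi_poisson \<alpha> \<beta> t x \<phi>) \<theta>\<bar> \<le> C * exp (- t * (jacobi_tau \<alpha> \<beta> + 1))"
  proof (cases "j = 0")
    case True
    thus ?thesis using compensated_large_t by simp
  next
    case False
    then obtain C where C: "C > 0" "\<And>t \<theta> \<phi> g c. t \<ge> 1 \<and> \<theta> \<in> {0<..<pi} \<and> \<phi> \<in> {0<..<pi} \<and>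
       (\<forall>x\<in>{0<..<pi}. g x = jacobi_poisson \<alpha> \<beta> t x \<phi> + c) \<Longrightarrow> \<bar>(deriv ^^ j) g \<theta>\<bar> \<le> C * exp (- t * (jacobi_tau \<alpha> \<beta> + 1))"
      using poisson_deriv_large_t[of j] by blast
    show ?thesis
    proof (intro exI[of _ C] conjI allI impI C(1))
      fix t \<theta> \<phi> :: real assume "t \<ge> 1 \<and> \<theta> \<in> {0<..<pi} \<and> \<phi> \<in> {0<..<pi}"
      thus "\<bar>(deriv ^^ j) (\<lambda>x. compensated_jacobi_poisson \<alpha> \<beta> t x \<phi>) \<theta>\<bar> \<le> C * exp (- t * (jacobi_tau \<alpha> \<beta> + 1))"
        by (intro C(2)[of t \<theta> \<phi> _ "- exp (- t * \<bar>jacobi_tau \<alpha> \<beta>\<bar>) * (jacobi_c \<alpha> \<beta> 0)\<^sup>2"])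
           (simp add: compensated_jacobi_poisson_def jacobi_fun_0 power2_eq_square)
    qed
  qed
  then obtain C where "C > 0" and C: "\<And>t \<theta> \<phi>. t \<ge> 1 \<Longrightarrow> \<theta> \<in> {0<..<pi} \<Longrightarrow> \<phi> \<in> {0<..<pi} \<Longrightarrow>
    \<bar>(deriv ^^ j) (\<lambda>x. compensated_jacobi_poisson \<alpha> \<beta> t x \<phi>) \<theta>\<bar> \<le> C * exp (- t * (jacobi_tau \<alpha> \<beta> + 1))" by blast
  show ?thesis
  proof (intro exI[of _ C] conjI allI impI \<open>C > 0\<close>)
    fix t \<theta> \<phi> :: real assume a: "t \<ge> 1 \<and> \<theta> \<in> {0<..<pi} \<and> \<phi> \<in> {0<..<pi}"
    hence "\<bar>(deriv ^^ j) (\<lambda>x. compensated_jacobi_poisson \<alpha> \<beta> t x \<phi>) \<theta>\<bar> \<le> C * exp (- t * (jacobi_tau \<alpha> \<beta> + 1))"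
      by (intro C) auto
    also have "\<dots> \<le> C * exp (- c * t)" using a \<open>C > 0\<close> assms by (intro mult_left_mono exp_tau_le) auto
    finally show "\<bar>(deriv ^^ j) (\<lambda>x. compensated_jacobi_poisson \<alpha> \<beta> t x \<phi>) \<theta>\<bar> \<le> C * exp (- c * t)" .
  qed
qed

text \<open>The rate must not depend on \<open>j\<close>. The term \<open>n = 0\<close> decays like
  \<open>exp (-t \<bar>\<tau>\<bar>)\<close> and matters only for \<open>j = 0\<close>, where
  \<open>\<tau> = 0\<close> is excluded; the minimum accounts for it, and for
  \<open>\<tau> = 0\<close> only derivatives of positive order remain.\<close>

theorem poisson_large_t:
  defines "c \<equiv> if jacobi_tau \<alpha> \<beta> = 0 then 1/2 else min (1/2) \<bar>jacobi_tau \<alpha> \<beta>\<bar>"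
  assumes j: "\<not> (j = 0 \<and> jacobi_tau \<alpha> \<beta> = 0)"
  shows "\<exists>C>0. \<forall>t \<theta> \<phi>. t \<ge> 1 \<and> \<theta> \<in> {0<..<pi} \<and> \<phi> \<in> {0<..<pi} \<longrightarrow>
    \<bar>(deriv ^^ j) (\<lambda>x. jacobi_poisson \<alpha> \<beta> t x \<phi>) \<theta>\<bar> \<le> C * exp (- c * t)"
proof (cases "j = 0")
  case True
  hence tau: "jacobi_tau \<alpha> \<beta> \<noteq> 0" using j by simp
  have c: "c \<le> 1/2" "c \<le> \<bar>jacobi_tau \<alpha> \<beta>\<bar>" using tau by (auto simp: c_def)
  obtain C where C: "C > 0" "\<And>t \<theta> \<phi>. t \<ge> 1 \<and> \<theta> \<in> {0<..<pi} \<and> \<phi> \<in> {0<..<pi} \<Longrightarrow>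
    \<bar>compensated_jacobi_poisson \<alpha> \<beta> t \<theta> \<phi>\<bar> \<le> C * exp (- c * t)"
    using compensated_deriv_large_t[OF c(1), of 0] by auto
  show ?thesis
  proof (intro exI[of _ "C + (jacobi_c \<alpha> \<beta> 0)\<^sup>2"] conjI allI impI)
    show "C + (jacobi_c \<alpha> \<beta> 0)\<^sup>2 > 0" using C by (simp add: add_pos_nonneg)
    fix t \<theta> \<phi> :: real assume a: "t \<ge> 1 \<and> \<theta> \<in> {0<..<pi} \<and> \<phi> \<in> {0<..<pi}"
    have "c * t \<le> \<bar>jacobi_tau \<alpha> \<beta>\<bar> * t" using c a by (intro mult_right_mono) auto
    hence "exp (- t * \<bar>jacobi_tau \<alpha> \<beta>\<bar>) \<le> exp (- c * t)" by (simp add: mult.commute)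
    hence "(jacobi_c \<alpha> \<beta> 0)\<^sup>2 * exp (- t * \<bar>jacobi_tau \<alpha> \<beta>\<bar>) \<le> (jacobi_c \<alpha> \<beta> 0)\<^sup>2 * exp (- c * t)"
      by (intro mult_left_mono) auto
    moreover have "jacobi_poisson \<alpha> \<beta> t \<theta> \<phi> = compensated_jacobi_poisson \<alpha> \<beta> t \<theta> \<phi> + (jacobi_c \<alpha> \<beta> 0)\<^sup>2 * exp (- t * \<bar>jacobi_tau \<alpha> \<beta>\<bar>)"
      by (simp add: compensated_jacobi_poisson_def jacobi_fun_0 power2_eq_square)
    moreover have "0 \<le> (jacobi_c \<alpha> \<beta> 0)\<^sup>2 * exp (- t * \<bar>jacobi_tau \<alpha> \<beta>\<bar>)" by simp
    ultimately have "\<bar>jacobi_poisson \<alpha> \<beta> t \<theta> \<phi>\<bar> \<le> (C + (jacobi_c \<alpha> \<beta> 0)\<^sup>2) * exp (- c * t)"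
      using C(2)[OF a] unfolding distrib_right by linarith
    thus "\<bar>(deriv ^^ j) (\<lambda>x. jacobi_poisson \<alpha> \<beta> t x \<phi>) \<theta>\<bar> \<le> (C + (jacobi_c \<alpha> \<beta> 0)\<^sup>2) * exp (- c * t)"
      using True by simp
  qed
next
  case False
  have c: "c \<le> 1/2" by (auto simp: c_def)
  from False obtain C where C: "C > 0" "\<And>t \<theta> \<phi> g c. t \<ge> 1 \<and> \<theta> \<in> {0<..<pi} \<and> \<phi> \<in> {0<..<pi} \<and>
     (\<forall>x\<in>{0<..<pi}. g x = jacobi_poisson \<alpha> \<beta> t x \<phi> + c) \<Longrightarrow> \<bar>(deriv ^^ j) g \<theta>\<bar> \<le> C * exp (- t * (jacobi_tau \<alpha> \<beta> + 1))"
    using poisson_deriv_large_t[of j] by blast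
  show ?thesis
  proof (intro exI[of _ C] conjI allI impI C(1))
    fix t \<theta> \<phi> :: real assume a: "t \<ge> 1 \<and> \<theta> \<in> {0<..<pi} \<and> \<phi> \<in> {0<..<pi}"
    have "\<bar>(deriv ^^ j) (\<lambda>x. jacobi_poisson \<alpha> \<beta> t x \<phi>) \<theta>\<bar> \<le> C * exp (- t * (jacobi_tau \<alpha> \<beta> + 1))"
      using a by (intro C(2)[of t \<theta> \<phi> _ 0]) auto
    also have "\<dots> \<le> C * exp (- c * t)" using a C(1) c by (intro mult_left_mono exp_tau_le) auto
    finally show "\<bar>(deriv ^^ j) (\<lambda>x. jacobi_poisson \<alpha> \<beta> t x \<phi>) \<theta>\<bar> \<le> C * exp (- c * t)" .
  qed
qed

end

theorem lemma3p4:
  fixes \<alpha> \<beta> :: real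
  assumes "\<alpha> > -1" and "\<beta> > -1"
  shows
    "(\<forall>j::nat. \<exists>C>0. \<forall>t \<theta> \<phi>. 0 < t \<and> t \<le> 1 \<and> \<theta> \<in> {0<..<pi} \<and> \<phi> \<in> {0<..<pi} \<longrightarrow>
        \<bar>(deriv ^^ j) (\<lambda>x. jacobi_poisson \<alpha> \<beta> t x \<phi>) \<theta>\<bar>
          \<le> C * (t\<^sup>2 + \<theta>\<^sup>2 + \<phi>\<^sup>2) powr (- \<alpha> - 1/2)
              * (t\<^sup>2 + (pi - \<theta>)\<^sup>2 + (pi - \<phi>)\<^sup>2) powr (- \<beta> - 1/2)
              * (t / (t\<^sup>2 + (\<theta> - \<phi>)\<^sup>2) powr (1 + real j / 2)))
     \<and> (\<exists>c>0. \<forall>j::nat. \<not> (j = 0 \<and> jacobi_tau \<alpha> \<beta> = 0) \<longrightarrow>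
        (\<exists>C>0. \<forall>t \<theta> \<phi>. t \<ge> 1 \<and> \<theta> \<in> {0<..<pi} \<and> \<phi> \<in> {0<..<pi} \<longrightarrow>
          \<bar>(deriv ^^ j) (\<lambda>x. jacobi_poisson \<alpha> \<beta> t x \<phi>) \<theta>\<bar> \<le> C * exp (- c * t)))
     \<and> (\<exists>c>0. \<forall>j::nat. \<exists>C>0. \<forall>t \<theta> \<phi>. t \<ge> 1 \<and> \<theta> \<in> {0<..<pi} \<and> \<phi> \<in> {0<..<pi} \<longrightarrow>
          \<bar>(deriv ^^ j) (\<lambda>x. compensated_jacobi_poisson \<alpha> \<beta> t x \<phi>) \<theta>\<bar> \<le> C * exp (- c * t))"
proof -
  interpret jacobi_params \<alpha> \<beta> using assms by unfold_locales
  show ?thesis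
  proof (intro conjI)
    show "\<exists>c>0. \<forall>j::nat. \<not> (j = 0 \<and> jacobi_tau \<alpha> \<beta> = 0) \<longrightarrow>
        (\<exists>C>0. \<forall>t \<theta> \<phi>. t \<ge> 1 \<and> \<theta> \<in> {0<..<pi} \<and> \<phi> \<in> {0<..<pi} \<longrightarrow>
          \<bar>(deriv ^^ j) (\<lambda>x. jacobi_poisson \<alpha> \<beta> t x \<phi>) \<theta>\<bar> \<le> C * exp (- c * t))"
      by (rule exI[of _ "if jacobi_tau \<alpha> \<beta> = 0 then 1/2 else min (1/2) \<bar>jacobi_tau \<alpha> \<beta>\<bar>"], intro conjI allI impI poisson_large_t) auto
    show "\<exists>c>0. \<forall>j::nat. \<exists>C>0. \<forall>t \<theta> \<phi>. t \<ge> 1 \<and> \<theta> \<in> {0<..<pi} \<and> \<phi> \<in> {0<..<pi} \<longrightarrow>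
          \<bar>(deriv ^^ j) (\<lambda>x. compensated_jacobi_poisson \<alpha> \<beta> t x \<phi>) \<theta>\<bar> \<le> C * exp (- c * t)"
      by (rule exI[of _ "1/2"]) (intro conjI allI compensated_deriv_large_t; simp)
  qed (intro allI poisson_small_t)
qed

end
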